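(* Let $G$ be a connected, locally finite weighted graph and let $\widetilde G$ be a connected, locally finite weighted graph which is model (weakly spherically symmetric). (1) If $G$ has stronger curvature growth outside of a finite set than $\widetilde G$ and $\widetilde G$ is Feller, then $G$ is Feller. (2) If $G$ has weaker curvature growth outside of a finite set than $\widetilde G$ and $\widetilde G$ is not Feller, then $G$ is not Feller.
   Context: Weighted graph: $G=(X,b,m)$ where $X$ is a countably infinite set (vertices), $b:X\times X\to[0,\infty)$ satisfies $b(x,y)=b(y,x)$, $b(x,x)=0$ and $|\{y : b(x,y)>0\}|<\infty$ for all $x$ (local finiteness), and $m:X\to(0,\infty)$ is a vertex measure. Write $x\sim y$ if $b(x,y)>0$. $G$ is connected if any two vertices are joined by a finite path $x=x_0\sim x_1\sim\dots\sim x_n=y$; $d(x,y)$ is the least number $n$ of edges of such a path (combinatorial graph metric). Laplacian and heat semigroup: the formal Laplacian is $\widetilde\Delta f(x)=\frac1{m(x)}\sum_{y\in X}b(x,y)(f(x)-f(y))$ for $f:X\to\mathbb{R}$. $C_c(X)$ is the space of finitely supported real functions, and $\ell^2(X,m)$ is the Hilbert space of real functions with $\sum_x f(x)^2m(x)<\infty$, with inner product $\langle f,g\rangle=\sum_x f(x)g(x)m(x)$. $\Delta$ is the Friedrichs extension in $\ell^2(X,m)$ of $\widetilde\Delta|_{C_c(X)}$, i.e. the self-adjoint operator of the closure of the form $\frac12\sum_{x,y}b(x,y)(f(x)-f(y))(g(x)-g(y))$ on $C_c(X)$. The semigroup $P_t=e^{-t\Delta}$ has a heat kernel $p_t(x,y)\ge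 0$ and acts on bounded functions by $P_tf(x)=\sum_{y\in X}p_t(x,y)f(y)m(y)$. Feller: $C_0(X)$ is the space of functions vanishing at infinity, i.e. the closure of $C_c(X)$ in the sup norm. $G$ is Feller if $P_t$ maps $C_0(X)$ into $C_0(X)$ for all $t\ge0$. Curvatures: for $x_0\in X$ and integer $r$ let $S_r(x_0)=\{y : d(y,x_0)=r\}$ (empty if $r<0$). For $x\in S_r(x_0)$, the outer ($+$) and inner ($-$) curvatures with respect to $x_0$ are $\kappa_\pm(x)=\frac1{m(x)}\sum_{y\in S_{r\pm1}(x_0)}b(x,y)$. Model graph: a weighted graph is model (weakly spherically symmetric) if it has a vertex $o$ (the root) such that its curvatures $\kappa_\pm$ with respect to $o$ depend only on the distance to $o$. For the model graph $\widetilde G$, $\widetilde\kappa_\pm(r)$ denotes the common value of its outer/inner curvature (with respect to its root) on the sphere of radius $r$ about the root. Curvature comparison: $G$ has stronger curvature growth outside of a finite set than $\widetilde G$ if there are a vertex $x_0$ of $G$ and some $R$ such that, with $\kappa_\pm$ the curvatures of $G$ with respect to $x_0$, $\kappa_+(x)\ge\widetilde\kappa_+(r)$ and $\kappa_-(x)\le\widetilde\kappa_-(r)$ for all vertices $x\in S_r(x_0)$ of $G$ and all $r\ge R$. $G$ has weaker curvature growth outside of a finite set than $\widetilde G$ if there are a vertex $x_0$ of $G$ and some $R$ such that the opposite inequalities $\kappa_+(x)\le\widetilde\kappa_+(r)$ and $\kappa_-(x)\ge\widetilde\kappa_-(r)$ hold for all $x\in S_r(x_0)$ and all $r\ge R$.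 *)

theory Defs
  imports "HOL-Analysis.Analysis"
begin

text \<open>The vertex set is the whole type \<open>'a\<close>; the graph is the pair of an edge weight \<open>b\<close> and
  a vertex measure \<open>m\<close>.\<close>

locale weighted_graph =
  fixes b :: "'a \<Rightarrow> 'a \<Rightarrow> real" and m :: "'a \<Rightarrow> real"
  assumes countable_vertices: "countable (UNIV :: 'a set)"
    and infinite_vertices: "infinite (UNIV :: 'a set)"
    and weight_nonneg: "b x y \<ge> 0"
    and weight_sym: "b x y = b y x"
    and weight_diag: "b x x = 0"
    and locally_finite: "finite {y. b x y > 0}"
    and measure_pos: "m x > 0"

definition adj :: "('a \<Rightarrow> 'a \<Rightarrow> real) \<Rightarrow> 'a rel" where
  "adj b = {(x, y). b x y > 0}"

definition connected_graph :: "('a \<Rightarrow> 'a \<Rightarrow> real) \<Rightarrow> bool" where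
  "connected_graph b \<longleftrightarrow> (\<forall>x y. (x, y) \<in> (adj b)\<^sup>*)"

definition graph_dist :: "('a \<Rightarrow> 'a \<Rightarrow> real) \<Rightarrow> 'a \<Rightarrow> 'a \<Rightarrow> nat" where
  "graph_dist b x y = (LEAST n. (x, y) \<in> adj b ^^ n)"

definition sph :: "('a \<Rightarrow> 'a \<Rightarrow> real) \<Rightarrow> 'a \<Rightarrow> int \<Rightarrow> 'a set" where
  "sph b x0 r = {y. int (graph_dist b y x0) = r}"

definition Cc :: "('a \<Rightarrow> real) set" where
  "Cc = {f. finite {x. f x \<noteq> 0}}"

definition l2 :: "('a \<Rightarrow> real) \<Rightarrow> ('a \<Rightarrow> real) set" where
  "l2 m = {f. (\<lambda>x. (f x)\<^sup>2 * m x) summable_on UNIV}"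

definition l2_inner :: "('a \<Rightarrow> real) \<Rightarrow> ('a \<Rightarrow> real) \<Rightarrow> ('a \<Rightarrow> real) \<Rightarrow> real" where
  "l2_inner m f g = (\<Sum>\<^sub>\<infinity>x. f x * g x * m x)"

definition l2_norm :: "('a \<Rightarrow> real) \<Rightarrow> ('a \<Rightarrow> real) \<Rightarrow> real" where
  "l2_norm m f = sqrt (l2_inner m f f)"

text \<open>On finitely supported functions this is a finite sum, and equals the \<open>l2\<close> inner product of
  \<open>f\<close>'s formal Laplacian with \<open>g\<close>. It is only ever applied to such functions.\<close>

definition energy :: "('a \<Rightarrow> 'a \<Rightarrow> real) \<Rightarrow> ('a \<Rightarrow> real) \<Rightarrow> ('a \<Rightarrow> real) \<Rightarrow> real" where
  "energy b f g = 1 / 2 * (\<Sum>\<^sub>\<infinity>(x, y). b x y * (f x - f y) * (g x - g y))"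

text \<open>The closure of the form: its domain consists of the \<open>l2\<close> limits of sequences in \<open>Cc\<close> that
  are Cauchy with respect to the form, and its values are the limits along such sequences.\<close>

definition form_approx ::
    "('a \<Rightarrow> 'a \<Rightarrow> real) \<Rightarrow> ('a \<Rightarrow> real) \<Rightarrow> (nat \<Rightarrow> 'a \<Rightarrow> real) \<Rightarrow> ('a \<Rightarrow> real) \<Rightarrow> bool" where
  "form_approx b m \<phi> f \<longleftrightarrow>
     (\<forall>n. \<phi> n \<in> Cc) \<and>
     (\<lambda>n. l2_norm m (\<lambda>x. \<phi> n x - f x)) \<longlonglongrightarrow> 0 \<and>
     (\<forall>\<epsilon>>0. \<exists>N. \<forall>k\<ge>N. \<forall>n\<ge>N.
        energy b (\<lambda>x. \<phi> k x - \<phi> n x) (\<lambda>x. \<phi> k x - \<phi> n x) < \<epsilon>)"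

definition form_dom :: "('a \<Rightarrow> 'a \<Rightarrow> real) \<Rightarrow> ('a \<Rightarrow> real) \<Rightarrow> ('a \<Rightarrow> real) set" where
  "form_dom b m = {f \<in> l2 m. \<exists>\<phi>. form_approx b m \<phi> f}"

definition closed_form ::
    "('a \<Rightarrow> 'a \<Rightarrow> real) \<Rightarrow> ('a \<Rightarrow> real) \<Rightarrow> ('a \<Rightarrow> real) \<Rightarrow> ('a \<Rightarrow> real) \<Rightarrow> real" where
  "closed_form b m f g =
     (THE q. \<forall>\<phi> \<psi>. form_approx b m \<phi> f \<longrightarrow> form_approx b m \<psi> g \<longrightarrow>
        (\<lambda>n. energy b (\<phi> n) (\<psi> n)) \<longlonglongrightarrow> q)"

text \<open>The operator of the closed form, given by its graph: \<open>(f, h)\<close> belongs to it iff \<open>f\<close> is in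
  the operator domain and \<open>h\<close> is the value of the operator at \<open>f\<close>.\<close>

definition laplacian ::
    "('a \<Rightarrow> 'a \<Rightarrow> real) \<Rightarrow> ('a \<Rightarrow> real) \<Rightarrow> (('a \<Rightarrow> real) \<times> ('a \<Rightarrow> real)) set" where
  "laplacian b m =
     {(f, h). f \<in> form_dom b m \<and> h \<in> l2 m \<and>
        (\<forall>g\<in>form_dom b m. closed_form b m f g = l2_inner m h g)}"

definition C0_semigroup ::
    "('a \<Rightarrow> real) \<Rightarrow> (real \<Rightarrow> ('a \<Rightarrow> real) \<Rightarrow> ('a \<Rightarrow> real)) \<Rightarrow> bool" where
  "C0_semigroup m P \<longleftrightarrow>
     (\<forall>t\<ge>0. \<forall>f\<in>l2 m. P t f \<in> l2 m) \<and>
     (\<forall>t\<ge>0. \<forall>f\<in>l2 m. \<forall>g\<in>l2 m. \<forall>c d.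
        P t (\<lambda>x. c * f x + d * g x) = (\<lambda>x. c * P t f x + d * P t g x)) \<and>
     (\<forall>t\<ge>0. \<exists>C. \<forall>f\<in>l2 m. l2_norm m (P t f) \<le> C * l2_norm m f) \<and>
     (\<forall>f\<in>l2 m. P 0 f = f) \<and>
     (\<forall>s\<ge>0. \<forall>t\<ge>0. \<forall>f\<in>l2 m. P (s + t) f = P s (P t f)) \<and>
     (\<forall>f\<in>l2 m. ((\<lambda>t. l2_norm m (\<lambda>x. P t f x - f x)) \<longlongrightarrow> 0) (at_right 0))"

text \<open>Graph of the infinitesimal generator of \<open>P\<close>, i.e. of the strong derivative of \<open>P\<close> at \<open>0\<close>.\<close>

definition generator ::
    "('a \<Rightarrow> real) \<Rightarrow> (real \<Rightarrow> ('a \<Rightarrow> real) \<Rightarrow> ('a \<Rightarrow> real))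
       \<Rightarrow> (('a \<Rightarrow> real) \<times> ('a \<Rightarrow> real)) set" where
  "generator m P =
     {(f, h). f \<in> l2 m \<and> h \<in> l2 m \<and>
        ((\<lambda>t. l2_norm m (\<lambda>x. (P t f x - f x) / t - h x)) \<longlongrightarrow> 0) (at_right 0)}"

text \<open>\<open>heat_semigroup b m t\<close> is the operator exponential of \<open>- t\<close> times the Laplacian, understood as
  the strongly continuous semigroup on \<open>l2 m\<close> generated by minus the Laplacian. A semigroup is
  determined by its generator, so the choice only affects the irrelevant values at negative times
  and outside \<open>l2 m\<close>.\<close>

definition heat_semigroup ::
    "('a \<Rightarrow> 'a \<Rightarrow> real) \<Rightarrow> ('a \<Rightarrow> real) \<Rightarrow> real \<Rightarrow> ('a \<Rightarrow> real) \<Rightarrow> ('a \<Rightarrow> real)" where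
  "heat_semigroup b m =
     (SOME P. C0_semigroup m P \<and>
        generator m P = {(f, h). (f, \<lambda>x. - h x) \<in> laplacian b m})"

text \<open>The heat kernel is the integral kernel of the semigroup with respect to \<open>m\<close>, hence is read off
  from the action on indicator functions of single vertices.\<close>

definition heat_kernel ::
    "('a \<Rightarrow> 'a \<Rightarrow> real) \<Rightarrow> ('a \<Rightarrow> real) \<Rightarrow> real \<Rightarrow> 'a \<Rightarrow> 'a \<Rightarrow> real" where
  "heat_kernel b m t x y = heat_semigroup b m t (indicator {y}) x / m y"

definition heat_action ::
    "('a \<Rightarrow> 'a \<Rightarrow> real) \<Rightarrow> ('a \<Rightarrow> real) \<Rightarrow> real \<Rightarrow> ('a \<Rightarrow> real) \<Rightarrow> ('a \<Rightarrow> real)" where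
  "heat_action b m t f = (\<lambda>x. \<Sum>\<^sub>\<infinity>y. heat_kernel b m t x y * f y * m y)"

text \<open>The closure of \<open>Cc\<close> in the sup norm.\<close>

definition C0 :: "('a \<Rightarrow> real) set" where
  "C0 = {f. \<forall>\<epsilon>>0. \<exists>g\<in>Cc. \<forall>x. \<bar>f x - g x\<bar> \<le> \<epsilon>}"

definition Feller :: "('a \<Rightarrow> 'a \<Rightarrow> real) \<Rightarrow> ('a \<Rightarrow> real) \<Rightarrow> bool" where
  "Feller b m \<longleftrightarrow> (\<forall>t\<ge>0. \<forall>f\<in>C0. heat_action b m t f \<in> C0)"

definition outer_curv ::
    "('a \<Rightarrow> 'a \<Rightarrow> real) \<Rightarrow> ('a \<Rightarrow> real) \<Rightarrow> 'a \<Rightarrow> 'a \<Rightarrow> real" where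
  "outer_curv b m x0 x =
     1 / m x * (\<Sum>\<^sub>\<infinity>y\<in>sph b x0 (int (graph_dist b x x0) + 1). b x y)"

definition inner_curv ::
    "('a \<Rightarrow> 'a \<Rightarrow> real) \<Rightarrow> ('a \<Rightarrow> real) \<Rightarrow> 'a \<Rightarrow> 'a \<Rightarrow> real" where
  "inner_curv b m x0 x =
     1 / m x * (\<Sum>\<^sub>\<infinity>y\<in>sph b x0 (int (graph_dist b x x0) - 1). b x y)"

definition model_with_root ::
    "('a \<Rightarrow> 'a \<Rightarrow> real) \<Rightarrow> ('a \<Rightarrow> real) \<Rightarrow> 'a \<Rightarrow> bool" where
  "model_with_root b m v \<longleftrightarrow>
     (\<forall>x y. graph_dist b x v = graph_dist b y v \<longrightarrow>
        outer_curv b m v x = outer_curv b m v y \<and> inner_curv b m v x = inner_curv b m v y)"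

text \<open>The common values on spheres about the root \<open>v\<close> of a model graph. Spheres of radius
  \<open>r \<ge> 0\<close> in an infinite, connected, locally finite graph are nonempty; for \<open>r < 0\<close> the values are
  meaningless and never used.\<close>

definition model_outer_curv ::
    "('a \<Rightarrow> 'a \<Rightarrow> real) \<Rightarrow> ('a \<Rightarrow> real) \<Rightarrow> 'a \<Rightarrow> int \<Rightarrow> real" where
  "model_outer_curv b m v r = (THE k. \<forall>x\<in>sph b v r. outer_curv b m v x = k)"

definition model_inner_curv ::
    "('a \<Rightarrow> 'a \<Rightarrow> real) \<Rightarrow> ('a \<Rightarrow> real) \<Rightarrow> 'a \<Rightarrow> int \<Rightarrow> real" where
  "model_inner_curv b m v r = (THE k. \<forall>x\<in>sph b v r. inner_curv b m v x = k)"

text \<open>Comparison of a graph \<open>(b, m)\<close> with a model graph \<open>(b', m')\<close> with root \<open>v\<close>, outside of a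
  finite set.\<close>

definition stronger_curv_growth ::
    "('a \<Rightarrow> 'a \<Rightarrow> real) \<Rightarrow> ('a \<Rightarrow> real) \<Rightarrow>
     ('c \<Rightarrow> 'c \<Rightarrow> real) \<Rightarrow> ('c \<Rightarrow> real) \<Rightarrow> 'c \<Rightarrow> bool" where
  "stronger_curv_growth b m b' m' v \<longleftrightarrow>
     (\<exists>x0. \<exists>R. \<forall>r\<ge>R. \<forall>x\<in>sph b x0 r.
        outer_curv b m x0 x \<ge> model_outer_curv b' m' v r \<and>
        inner_curv b m x0 x \<le> model_inner_curv b' m' v r)"

definition weaker_curv_growth ::
    "('a \<Rightarrow> 'a \<Rightarrow> real) \<Rightarrow> ('a \<Rightarrow> real) \<Rightarrow>
     ('c \<Rightarrow> 'c \<Rightarrow> real) \<Rightarrow> ('c \<Rightarrow> real) \<Rightarrow> 'c \<Rightarrow> bool" where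
  "weaker_curv_growth b m b' m' v \<longleftrightarrow>
     (\<exists>x0. \<exists>R. \<forall>r\<ge>R. \<forall>x\<in>sph b x0 r.
        outer_curv b m x0 x \<le> model_outer_curv b' m' v r \<and>
        inner_curv b m x0 x \<ge> model_inner_curv b' m' v r)"

end

theory Submission imports Defs begin

text \<open>The Feller property is read off from the Green function \<open>G = (\<Delta> + 1)\<^sup>-\<^sup>1 1\<^bsub>{root}\<^esub>\<close>, and
  Green functions are compared by a minimum principle on finite sets.

  First, \<open>Feller_iff_green\<close>: a connected graph is Feller iff \<open>G\<close> vanishes at infinity. The link is
  the identity
  \<open>G(x) = \<integral>\<^sub>0\<^sup>T e\<^sup>-\<^sup>s P\<^sub>s 1\<^bsub>{root}\<^esub>(x) ds + e\<^sup>-\<^sup>T P\<^sub>T G(x)\<close> (\<open>heat_integral\<close>). It gives \<open>P\<^sub>t G \<le> e\<^sup>t G\<close>; since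
  \<open>G > 0\<close>, each \<open>P\<^sub>t 1\<^bsub>{y}\<^esub>\<close> is at most a multiple of \<open>G\<close>, and as the heat kernel has total mass at
  most one, all of \<open>C\<^sub>0\<close> is preserved when \<open>G\<close> vanishes at infinity. Conversely, for a Feller graph
  the integrand tends to zero at infinity for each \<open>s\<close>, hence so does the integral, by dominated
  convergence, and the last term is uniformly small for large \<open>T\<close>.

  Second, on a model graph the solution of the Dirichlet problem for \<open>\<Delta> + 1\<close> on a ball, with source
  at the root, is radial: the equation is a three-term recursion in the radius that can be solved
  from the boundary inwards. The solution is visibly decreasing in the radius, so \<open>G(x) = \<gamma>(r(x))\<close>
  with \<open>\<gamma>\<close> positive and decreasing (\<open>model_green\<close>). For such \<open>\<gamma>\<close>, the expression
  \<open>\<kappa>\<^sub>+ (\<gamma>(r) - \<gamma>(r+1)) + \<kappa>\<^sub>- (\<gamma>(r) - \<gamma>(r-1)) + \<gamma>(r)\<close> increases with \<open>\<kappa>\<^sub>+\<close> and decreases with \<open>\<kappa>\<^sub>-\<close>.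
  So if the other graph has stronger curvature growth, \<open>\<gamma>\<close> transplanted to it is a supersolution far
  out, and its Green function is at most a multiple of \<open>\<gamma>\<close>
  (\<open>green_le_radial_supersolution\<close>). If the growth is weaker, the Dirichlet solutions of the model are
  subsolutions, and \<open>\<gamma>\<close> is at most a multiple of the Green function
  (\<open>radial_subsolution_le_green\<close>). It is essential here to transplant the Dirichlet solutions and
  not \<open>\<gamma>\<close> itself: their finite support is what makes the minimum principle applicable.

  The analytic part identifies the heat semigroup. The resolvents \<open>(\<Delta> + k)\<^sup>-\<^sup>1\<close> are limits of the
  Dirichlet resolvents on balls; these are Cauchy in the form norm, which at once places the limit
  in the domain of the closed form (\<open>laplacian_Res\<close>). The Hille-Yosida construction turns the
  resolvents into a semigroup, unique with its generator (\<open>flow_unique\<close>), so that the semigroup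
  chosen in the definition of the heat kernel is this one (\<open>heat_semigroup_flow\<close>). Positivity
  and the sub-Markov property pass from the resolvents to the semigroup, as does the invariance of
  any closed convex set containing zero (\<open>flow_convex_invariant\<close>).\<close>

section \<open>Square-summable functions as a Hilbert space\<close>

text \<open>The Hilbert space is unweighted; a measure \<open>m\<close> enters through the isometry multiplying by
  \<open>sqrt m\<close>, because a type cannot depend on \<open>m\<close>.\<close>

typedef 'a ell2 = "{f :: 'a \<Rightarrow> real. (\<lambda>x. (f x)\<^sup>2) summable_on UNIV}"
  morphisms coord Abs_ell2
  by (rule exI[of _ "\<lambda>_. 0"]) simp

setup_lifting type_definition_ell2

lemma coord_summable: "(\<lambda>x. (coord u x)\<^sup>2) summable_on UNIV"
  using coord[of u] by simp

lemma square_summable_mult: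
  fixes f g :: "'a \<Rightarrow> real"
  assumes "(\<lambda>x. (f x)\<^sup>2) summable_on UNIV" "(\<lambda>x. (g x)\<^sup>2) summable_on UNIV"
  shows "(\<lambda>x. f x * g x) summable_on UNIV"
proof (rule abs_summable_summable, rule Infinite_Sum.abs_summable_on_comparison_test')
  show "(\<lambda>x. (f x)\<^sup>2 + (g x)\<^sup>2) summable_on UNIV" by (intro summable_on_add assms)
  show "norm (f x * g x) \<le> (f x)\<^sup>2 + (g x)\<^sup>2" for x
  proof -
    have "2 * \<bar>f x * g x\<bar> \<le> (f x)\<^sup>2 + (g x)\<^sup>2"
      using sum_squares_bound[of "\<bar>f x\<bar>" "\<bar>g x\<bar>"] by (simp add: abs_mult mult.assoc)
    then show ?thesis using abs_ge_zero[of "f x * g x"] unfolding real_norm_def by linarith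
  qed
qed

lemma square_summable_add:
  fixes f g :: "'a \<Rightarrow> real"
  assumes "(\<lambda>x. (f x)\<^sup>2) summable_on UNIV" "(\<lambda>x. (g x)\<^sup>2) summable_on UNIV"
  shows "(\<lambda>x. (f x + g x)\<^sup>2) summable_on UNIV"
proof -
  have "(\<lambda>x. (f x)\<^sup>2 + (g x)\<^sup>2 + 2 * (f x * g x)) summable_on UNIV"
    by (intro summable_on_add assms summable_on_cmult_right square_summable_mult)
  then show ?thesis by (simp add: power2_sum algebra_simps)
qed

lemma coord_mult_summable: "(\<lambda>x. coord u x * coord w x) summable_on UNIV"
  by (intro square_summable_mult coord_summable)

instantiation ell2 :: (type) real_inner
begin

lift_definition zero_ell2 :: "'a ell2" is "\<lambda>_. 0" by simp
lift_definition plus_ell2 :: "'a ell2 \<Rightarrow> 'a ell2 \<Rightarrow> 'a ell2" is "\<lambda>f g x. f x + g x"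
  by (simp add: square_summable_add)
lift_definition uminus_ell2 :: "'a ell2 \<Rightarrow> 'a ell2" is "\<lambda>f x. - f x" by simp
lift_definition scaleR_ell2 :: "real \<Rightarrow> 'a ell2 \<Rightarrow> 'a ell2" is "\<lambda>c f x. c * f x"
  by (simp add: power_mult_distrib summable_on_cmult_right)
lift_definition minus_ell2 :: "'a ell2 \<Rightarrow> 'a ell2 \<Rightarrow> 'a ell2" is "\<lambda>f g x. f x - g x"
  subgoal for f g using square_summable_add[of f "\<lambda>x. - g x"] by simp
  done
definition inner_ell2 :: "'a ell2 \<Rightarrow> 'a ell2 \<Rightarrow> real" where
  "inner_ell2 u w = (\<Sum>\<^sub>\<infinity>x. coord u x * coord w x)"
definition norm_ell2 :: "'a ell2 \<Rightarrow> real" where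
  "norm_ell2 u = sqrt (inner u u)"
definition dist_ell2 :: "'a ell2 \<Rightarrow> 'a ell2 \<Rightarrow> real" where
  "dist_ell2 u w = norm (u - w)"
definition sgn_ell2 :: "'a ell2 \<Rightarrow> 'a ell2" where
  "sgn_ell2 u = inverse (norm u) *\<^sub>R u"
definition uniformity_ell2 :: "('a ell2 \<times> 'a ell2) filter" where
  "uniformity_ell2 = (INF e\<in>{0<..}. principal {(u, w). dist u w < e})"
definition open_ell2 :: "'a ell2 set \<Rightarrow> bool" where
  "open_ell2 U \<longleftrightarrow> (\<forall>u\<in>U. eventually (\<lambda>(u', w). u' = u \<longrightarrow> w \<in> U) uniformity)"

instance
proof
  fix u w z :: "'a ell2" and a b :: real
  show "u + w + z = u + (w + z)" by transfer (simp add: algebra_simps)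
  show "u + w = w + u" by transfer (simp add: algebra_simps)
  show "0 + u = u" by transfer simp
  show "- u + u = 0" by transfer simp
  show "u - w = u + - w" by transfer simp
  show "a *\<^sub>R (u + w) = a *\<^sub>R u + a *\<^sub>R w" by transfer (simp add: algebra_simps)
  show "(a + b) *\<^sub>R u = a *\<^sub>R u + b *\<^sub>R u" by transfer (simp add: algebra_simps)
  show "a *\<^sub>R b *\<^sub>R u = (a * b) *\<^sub>R u" by transfer (simp add: algebra_simps)
  show "1 *\<^sub>R u = u" by transfer simp
  show "dist u w = norm (u - w)" by (rule dist_ell2_def)
  show "sgn u = inverse (norm u) *\<^sub>R u" by (rule sgn_ell2_def)
  show "uniformity = (INF e\<in>{0<..}. principal {(u, w :: 'a ell2). dist u w < e})"
    by (rule uniformity_ell2_def)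
  show "open U \<longleftrightarrow> (\<forall>u\<in>U. eventually (\<lambda>(u', w). u' = u \<longrightarrow> w \<in> U) uniformity)"
    for U :: "'a ell2 set" by (rule open_ell2_def)
  show "norm u = sqrt (inner u u)" by (rule norm_ell2_def)
  show "inner u w = inner w u" by (simp add: inner_ell2_def mult.commute)
  show "inner (u + w) z = inner u z + inner w z"
    unfolding inner_ell2_def plus_ell2.rep_eq
    by (subst infsum_add[symmetric]) (auto intro: coord_mult_summable simp: algebra_simps)
  show "inner (a *\<^sub>R u) w = a * inner u w"
    unfolding inner_ell2_def scaleR_ell2.rep_eq
    by (subst infsum_cmult_right[symmetric]) (auto intro: coord_mult_summable simp: algebra_simps)
  show "0 \<le> inner u u"
    unfolding inner_ell2_def by (intro infsum_nonneg) simp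
  show "inner u u = 0 \<longleftrightarrow> u = 0"
  proof
    assume *: "inner u u = 0"
    have "coord u x = 0" for x
    proof -
      have "(\<Sum>y\<in>{x}. coord u y * coord u y) \<le> (\<Sum>\<^sub>\<infinity>y. coord u y * coord u y)"
        by (intro finite_sum_le_infsum coord_mult_summable) auto
      with * show ?thesis by (simp add: inner_ell2_def) (metis mult_eq_0_iff not_square_less_zero nle_le linorder_not_less)
    qed
    then show "u = 0" by (metis coord_inject zero_ell2.rep_eq ext)
  qed (simp add: inner_ell2_def zero_ell2.rep_eq)
qed

end

lemmas coord_simps [simp] =
  zero_ell2.rep_eq plus_ell2.rep_eq uminus_ell2.rep_eq scaleR_ell2.rep_eq minus_ell2.rep_eq

lemma ell2_eqI: "(\<And>x. coord u x = coord w x) \<Longrightarrow> u = w"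
  by (metis coord_inject ext)

lemma coord_Abs: "(\<lambda>x. (f x)\<^sup>2) summable_on UNIV \<Longrightarrow> coord (Abs_ell2 f) = f"
  by (simp add: Abs_ell2_inverse)

lemma norm_ell2_power2: "(norm u)\<^sup>2 = (\<Sum>\<^sub>\<infinity>x. (coord u x)\<^sup>2)"
  unfolding power2_norm_eq_inner inner_ell2_def by (simp add: power2_eq_square)

lemma finite_sum_coord_le: "finite F \<Longrightarrow> (\<Sum>x\<in>F. (coord u x)\<^sup>2) \<le> (norm u)\<^sup>2"
  unfolding norm_ell2_power2 by (intro finite_sum_le_infsum coord_summable) auto

lemma coord_le_norm: "\<bar>coord u x\<bar> \<le> norm u"
  using finite_sum_coord_le[of "{x}" u] abs_le_square_iff[of "coord u x" "norm u"] by simp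

lemma bounded_linear_coord: "bounded_linear (\<lambda>u. coord u x)"
  by (rule bounded_linear_intro[of _ 1]) (simp_all add: coord_le_norm)

text \<open>Completeness rests on Fatou's lemma: a pointwise limit inherits every bound on the finite partial
  sums of squares.\<close>

lemma ell2_Fatou:
  assumes lim: "\<And>x. (\<lambda>n. coord (X n) x) \<longlonglongrightarrow> f x" and bnd: "\<And>n. n \<ge> N \<Longrightarrow> norm (X n) \<le> C"
  shows "(\<lambda>x. (f x)\<^sup>2) summable_on UNIV" "norm (Abs_ell2 f) \<le> C"
proof -
  have C: "0 \<le> C" using bnd[of N] norm_ge_zero[of "X N"] by linarith
  have fin: "(\<Sum>x\<in>F. (f x)\<^sup>2) \<le> C\<^sup>2" if "finite F" for F
  proof (rule tendsto_upperbound)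
    show "(\<lambda>n. \<Sum>x\<in>F. (coord (X n) x)\<^sup>2) \<longlonglongrightarrow> (\<Sum>x\<in>F. (f x)\<^sup>2)"
      by (intro tendsto_sum tendsto_power lim)
    show "\<forall>\<^sub>F n in sequentially. (\<Sum>x\<in>F. (coord (X n) x)\<^sup>2) \<le> C\<^sup>2"
      using eventually_ge_at_top[of N]
    proof eventually_elim
      case (elim n)
      then show ?case
        using finite_sum_coord_le[OF that, of "X n"] bnd[OF elim] power_mono[of "norm (X n)" C 2]
        by simp
    qed
  qed simp
  show s: "(\<lambda>x. (f x)\<^sup>2) summable_on UNIV"
    by (rule nonneg_bdd_above_summable_on) (auto intro!: bdd_aboveI2 fin)
  have "(norm (Abs_ell2 f))\<^sup>2 \<le> C\<^sup>2"
    unfolding norm_ell2_power2 coord_Abs[OF s] by (intro infsum_le_finite_sums s fin)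
  then show "norm (Abs_ell2 f) \<le> C" using C by (simp add: power2_le_iff_abs_le)
qed

instance ell2 :: (type) banach
proof
  fix X :: "nat \<Rightarrow> 'a ell2"
  assume X: "Cauchy X"
  define f where "f x = lim (\<lambda>n. coord (X n) x)" for x
  have lim: "(\<lambda>n. coord (X n) x) \<longlonglongrightarrow> f x" for x
    unfolding f_def convergent_LIMSEQ_iff[symmetric]
    by (intro Cauchy_convergent bounded_linear.Cauchy[OF bounded_linear_coord X])
  obtain C where C: "\<And>n. norm (X n) \<le> C" using Cauchy_Bseq[OF X] by (auto simp: Bseq_def)
  have s: "(\<lambda>x. (f x)\<^sup>2) summable_on UNIV" by (rule ell2_Fatou[OF lim, of 0]) (rule C)
  have "X \<longlonglongrightarrow> Abs_ell2 f"
  proof (rule LIMSEQ_I)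
    fix r :: real assume "0 < r"
    then obtain M where M: "\<And>k n. k \<ge> M \<Longrightarrow> n \<ge> M \<Longrightarrow> norm (X k - X n) < r / 2"
      using X unfolding Cauchy_iff by (meson half_gt_zero)
    have "norm (X k - Abs_ell2 f) < r" if k: "k \<ge> M" for k
    proof -
      have "norm (Abs_ell2 (\<lambda>x. coord (X k) x - f x)) \<le> r / 2"
      proof (rule ell2_Fatou(2)[where X = "\<lambda>n. X k - X n" and N = M])
        show "(\<lambda>n. coord (X k - X n) x) \<longlonglongrightarrow> coord (X k) x - f x" for x
          using tendsto_diff[OF tendsto_const lim] by simp
        show "norm (X k - X n) \<le> r / 2" if "n \<ge> M" for n using M[OF k that] by simp
      qed
      moreover have "X k - Abs_ell2 f = Abs_ell2 (\<lambda>x. coord (X k) x - f x)"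
        using s square_summable_add[of "coord (X k)" "\<lambda>x. - f x"] coord_summable[of "X k"]
        by (intro ell2_eqI) (simp add: coord_Abs)
      ultimately show ?thesis using \<open>0 < r\<close> by simp
    qed
    then show "\<exists>no. \<forall>n\<ge>no. norm (X n - Abs_ell2 f) < r" by blast
  qed
  then show "convergent X" by (auto simp: convergent_def)
qed

definition unit_vec :: "'a \<Rightarrow> 'a ell2" where
  "unit_vec x = Abs_ell2 (indicator {x})"

lemma square_summable_finite_support:
  fixes f :: "'a \<Rightarrow> real"
  assumes "finite {x. f x \<noteq> 0}" shows "(\<lambda>x. (f x)\<^sup>2) summable_on UNIV"
  by (rule summable_on_cong_neutral[where T = "{x. f x \<noteq> 0}", THEN iffD2])
     (use assms in auto)

lemma coord_unit_vec [simp]: "coord (unit_vec x) = indicator {x}"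
  unfolding unit_vec_def
  by (rule coord_Abs, rule square_summable_finite_support) (simp add: indicator_def)

text \<open>Nontriviality of the space, which gives the identity operator norm one.\<close>

instance ell2 :: (type) perfect_space
proof
  fix u :: "'a ell2"
  show "\<not> open {u}"
  proof
    assume "open {u}"
    then obtain e where e: "e > 0" "\<And>w. dist w u < e \<Longrightarrow> w = u"
      unfolding open_dist by auto
    define z where "z = unit_vec (undefined :: 'a)"
    have "coord z undefined = 1" by (simp add: z_def)
    then have z: "z \<noteq> 0" by auto
    have "dist (u + (e / 2 / norm z) *\<^sub>R z) u < e" using e(1) z by (simp add: dist_norm)
    from e(2)[OF this] show False using e(1) z by simp
  qed
qed

lemma finite_support_dense:
  assumes "0 < e"
  shows "\<exists>w. finite {x. coord w x \<noteq> 0} \<and> norm (u - w) < e"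
proof -
  have "((\<lambda>x. (coord u x)\<^sup>2) has_sum (norm u)\<^sup>2) UNIV"
    unfolding norm_ell2_power2 by (rule has_sum_infsum[OF coord_summable])
  then have "\<forall>\<^sub>F F in finite_subsets_at_top UNIV. dist (\<Sum>x\<in>F. (coord u x)\<^sup>2) ((norm u)\<^sup>2) < e\<^sup>2"
    unfolding has_sum_def tendsto_iff using assms by simp
  then obtain F where F: "finite F" "dist (\<Sum>x\<in>F. (coord u x)\<^sup>2) ((norm u)\<^sup>2) < e\<^sup>2"
    unfolding eventually_finite_subsets_at_top by blast
  define w where "w = Abs_ell2 (\<lambda>x. coord u x * indicator F x)"
  have fin: "finite {x. coord u x * indicator F x \<noteq> 0}"
    by (rule finite_subset[OF _ F(1)]) (auto simp: indicator_def)
  have w: "coord w x = coord u x * indicator F x" for x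
    unfolding w_def by (subst coord_Abs[OF square_summable_finite_support[OF fin]]) simp
  have "inner w w = (\<Sum>x\<in>F. (coord u x)\<^sup>2)" "inner u w = (\<Sum>x\<in>F. (coord u x)\<^sup>2)"
    unfolding inner_ell2_def w
    by (subst infsum_cong_neutral[where T = F and g = "\<lambda>x. (coord u x)\<^sup>2"],
        auto simp: power2_eq_square F)+
  then have "(norm (u - w))\<^sup>2 = (norm u)\<^sup>2 - (\<Sum>x\<in>F. (coord u x)\<^sup>2)"
    by (simp add: power2_norm_eq_inner inner_diff inner_commute)
  also have "\<dots> < e\<^sup>2" using F(2) by (simp add: dist_real_def abs_less_iff)
  finally have "norm (u - w) < e" using assms by (simp add: power_less_imp_less_base)
  with fin show ?thesis by (intro exI[of _ w]) (simp add: w)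
qed

section \<open>Strongly continuous semigroups\<close>

definition semigroup_C0 :: "(real \<Rightarrow> 'h \<Rightarrow> 'h::real_normed_vector) \<Rightarrow> bool" where
  "semigroup_C0 P \<longleftrightarrow>
     (\<forall>t\<ge>0. bounded_linear (P t)) \<and> (\<forall>f. P 0 f = f) \<and>
     (\<forall>s\<ge>0. \<forall>t\<ge>0. \<forall>f. P (s + t) f = P s (P t f)) \<and>
     (\<forall>f. ((\<lambda>t. P t f) \<longlongrightarrow> f) (at_right 0))"

text \<open>The infinitesimal generator, given as a graph because it is only partially defined.\<close>

definition gen :: "(real \<Rightarrow> 'h \<Rightarrow> 'h::real_normed_vector) \<Rightarrow> ('h \<times> 'h) set" where
  "gen P = {(f, h). ((\<lambda>t. (P t f - f) /\<^sub>R t) \<longlongrightarrow> h) (at_right 0)}"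

lemma semigroup_C0D:
  assumes "semigroup_C0 P"
  shows "t \<ge> 0 \<Longrightarrow> bounded_linear (P t)" "P 0 f = f"
    "s \<ge> 0 \<Longrightarrow> t \<ge> 0 \<Longrightarrow> P (s + t) f = P s (P t f)"
    "((\<lambda>t. P t f) \<longlongrightarrow> f) (at_right 0)"
  using assms by (auto simp: semigroup_C0_def)

text \<open>The Banach-Steinhaus theorem for sequences: by Baire's theorem one of the closed sets where all
  \<open>norm (T n x)\<close> are at most \<open>k\<close> contains a ball, and linearity spreads the bound from that ball.\<close>

lemma uniform_boundedness:
  fixes T :: "nat \<Rightarrow> 'h::banach \<Rightarrow> 'k::real_normed_vector"
  assumes lin: "\<And>n. bounded_linear (T n)" and bnd: "\<And>x. \<exists>C. \<forall>n. norm (T n x) \<le> C"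
  shows "\<exists>M. \<forall>n x. norm (T n x) \<le> M * norm x"
proof -
  define A where "A k = {x. \<forall>n. norm (T n x) \<le> real k}" for k :: nat
  have cont: "continuous_on UNIV (T n)" for n
    by (rule linear_continuous_on[OF lin])
  have A_eq: "A k = (\<Inter>n. {x. norm (T n x) \<le> real k})" for k by (auto simp: A_def)
  have clA: "closed (A k)" for k
    unfolding A_eq by (intro closed_INT ballI closed_Collect_le continuous_intros cont)
  have cov: "\<exists>k. x \<in> A k" for x
  proof -
    obtain C where "\<forall>n. norm (T n x) \<le> C" using bnd by blast
    then have "x \<in> A (nat \<lceil>C\<rceil>)"
      unfolding A_def using of_nat_ceiling[of C] order_trans by blast
    then show ?thesis ..
  qed
  have "\<exists>k. closure (- A k) \<noteq> UNIV"
  proof (rule ccontr)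
    assume "\<not> ?thesis"
    then have d: "closure (- A k) = UNIV" for k by blast
    have "Met_TC.mtopology closure_of \<Inter>(range (\<lambda>k. - A k)) = (UNIV :: 'h set)"
    proof (rule Met_TC.metric_Baire_category)
      show "Met_TC.mcomplete TYPE('h)" by (simp add: complete_UNIV)
      show "openin Met_TC.mtopology U \<and> Met_TC.mtopology closure_of U = UNIV"
        if "U \<in> range (\<lambda>k. - A k)" for U
        using that clA d by (auto simp: open_Compl)
    qed simp
    moreover have "\<Inter>(range (\<lambda>k. - A k)) = {}" using cov by auto
    ultimately show False by simp
  qed
  then obtain k where k: "closure (- A k) \<noteq> UNIV" by blast
  then have "interior (A k) \<noteq> {}" unfolding closure_complement by (metis Compl_empty_eq)
  then obtain x r where r: "r > 0" "cball x r \<subseteq> A k"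
    by (metis all_not_in_conv mem_interior_cball)
  have "norm (T n y) \<le> (2 * real k / r) * norm y" for n y
  proof (cases "y = 0")
    case True
    then show ?thesis using linear_0[OF bounded_linear.linear[OF lin]] by simp
  next
    case False
    interpret bounded_linear "T n" by (rule lin)
    define c where "c = r / norm y"
    have c: "c > 0" using r False by (simp add: c_def)
    have "x + c *\<^sub>R y \<in> cball x r" using r False by (simp add: c_def dist_norm)
    then have "norm (T n (x + c *\<^sub>R y)) \<le> k" using r by (auto simp: A_def)
    moreover have "x \<in> A k" using r by (meson centre_in_cball less_imp_le subsetD)
    then have "norm (T n x) \<le> k" by (simp add: A_def)
    moreover have "c *\<^sub>R T n y = T n (x + c *\<^sub>R y) - T n x" by (simp add: add scaleR)
    ultimately have "norm (c *\<^sub>R T n y) \<le> 2 * k"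
      using norm_triangle_ineq4[of "T n (x + c *\<^sub>R y)" "T n x"] by simp
    then have "norm (T n y) * c \<le> 2 * k" using c by (simp add: mult.commute)
    then have "norm (T n y) \<le> 2 * k / c" using c by (simp add: pos_le_divide_eq)
    also have "2 * k / c = (2 * real k / r) * norm y" by (simp add: c_def)
    finally show ?thesis .
  qed
  then show ?thesis by blast
qed

lemma semigroup_power:
  assumes "semigroup_C0 P" "s \<ge> 0" shows "P (real n * s) f = (P s ^^ n) f"
proof (induction n)
  case (Suc n)
  have "P (real (Suc n) * s) f = P (s + real n * s) f" by (simp add: algebra_simps)
  also have "\<dots> = P s (P (real n * s) f)" using assms by (simp add: semigroup_C0D(3))
  finally show ?case by (simp add: Suc)
qed (simp add: semigroup_C0D(2)[OF assms(1)])

text \<open>The definition bounds each \<open>P t\<close> separately. If the bounds were not uniform near zero there would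
  be times tending to zero with exploding norms, against uniform boundedness, as \<open>P t f\<close> converges
  along these times for each \<open>f\<close>. The semigroup law extends the bound to compact intervals.\<close>

lemma semigroup_locally_bounded:
  fixes P :: "real \<Rightarrow> 'h::banach \<Rightarrow> 'h"
  assumes P: "semigroup_C0 P"
  shows "\<exists>M\<ge>1. \<forall>t\<in>{0..T}. \<forall>f. norm (P t f) \<le> M * norm f"
proof -
  have "\<exists>\<delta>>0. \<exists>M. \<forall>t\<in>{0..\<delta>}. \<forall>f. norm (P t f) \<le> M * norm f"
  proof (rule ccontr)
    assume neg: "\<not> ?thesis"
    have "\<exists>t\<in>{0..inverse (real (Suc n))}. \<exists>f. norm (P t f) > real n * norm f" for n
    proof (rule ccontr)
      assume "\<not> ?thesis"
      then have "\<forall>t\<in>{0..inverse (real (Suc n))}. \<forall>f. norm (P t f) \<le> real n * norm f"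
        by (auto simp: not_less)
      moreover have "inverse (real (Suc n)) > 0" by simp
      ultimately show False using neg by blast
    qed
    then obtain t where t: "\<And>n. t n \<in> {0..inverse (real (Suc n))}"
      and bad: "\<And>n. \<exists>f. norm (P (t n) f) > real n * norm f" by metis
    have t0: "t \<longlonglongrightarrow> 0"
      by (rule tendsto_sandwich[OF _ _ tendsto_const LIMSEQ_inverse_real_of_nat]) (use t in auto)
    have "\<exists>C. \<forall>n. norm (P (t n) f) \<le> C" for f
    proof -
      have "(\<lambda>n. P (t n) f) \<longlonglongrightarrow> f"
      proof (rule LIMSEQ_I)
        fix r :: real assume r: "0 < r"
        have "\<forall>\<^sub>F s in at_right 0. dist (P s f) f < r"
          using tendstoD[OF semigroup_C0D(4)[OF P] r] .
        then obtain d where d: "d > 0" "\<And>s. 0 < s \<Longrightarrow> s < d \<Longrightarrow> dist (P s f) f < r"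
          unfolding eventually_at_right_field by auto
        obtain N where "\<And>n. n \<ge> N \<Longrightarrow> norm (t n - 0) < d" using LIMSEQ_D[OF t0 d(1)] by auto
        then have tn: "t n < d" if "n \<ge> N" for n using that by fastforce
        have "norm (P (t n) f - f) < r" if "n \<ge> N" for n
        proof (cases "t n = 0")
          case False
          then have "0 < t n" using t[of n] by simp
          from d(2)[OF this tn[OF that]] show ?thesis by (simp add: dist_norm)
        qed (simp add: semigroup_C0D(2)[OF P] r)
        then show "\<exists>N. \<forall>n\<ge>N. norm (P (t n) f - f) < r" by blast
      qed
      then have "Bseq (\<lambda>n. P (t n) f)" by (rule convergent_imp_Bseq[OF convergentI])
      then show ?thesis by (auto simp: Bseq_def)
    qed
    then obtain M where M: "\<And>n f. norm (P (t n) f) \<le> M * norm f"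
      using uniform_boundedness[of "\<lambda>n. P (t n)"] semigroup_C0D(1)[OF P] t by auto
    obtain f where "norm (P (t (nat \<lceil>M\<rceil>)) f) > real (nat \<lceil>M\<rceil>) * norm f" using bad by blast
    with M[of "nat \<lceil>M\<rceil>" f] mult_right_mono[OF of_nat_ceiling[of M], of "norm f"]
    show False by simp
  qed
  then obtain \<delta> M0 where \<delta>: "\<delta> > 0" and M0: "\<And>t f. t \<in> {0..\<delta>} \<Longrightarrow> norm (P t f) \<le> M0 * norm f" by blast
  define M1 where "M1 = max 1 M0"
  have M1: "norm (P t f) \<le> M1 * norm f" if "t \<in> {0..\<delta>}" for t f
    using M0[OF that, of f] mult_right_mono[of M0 M1 "norm f"] by (simp add: M1_def)
  have M1_1: "M1 \<ge> 1" by (simp add: M1_def)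
  define N where "N = Suc (nat \<lceil>T / \<delta>\<rceil>)"
  have N: "T / real N \<le> \<delta>" "N > 0"
  proof -
    have "T / \<delta> \<le> real N" unfolding N_def using of_nat_ceiling[of "T / \<delta>"] by linarith
    then show "T / real N \<le> \<delta>" using \<delta> by (simp add: N_def field_simps)
  qed (simp add: N_def)
  have "norm (P t f) \<le> M1 ^ N * norm f" if t: "t \<in> {0..T}" for t f
  proof -
    have s: "t / real N \<in> {0..\<delta>}"
      using t N divide_right_mono[of t T "real N"] by auto
    have pow: "norm ((P (t / real N) ^^ n) f) \<le> M1 ^ n * norm f" for n
    proof (induction n)
      case (Suc n)
      have "norm ((P (t / real N) ^^ Suc n) f) \<le> M1 * norm ((P (t / real N) ^^ n) f)"
        using M1[OF s] by simp
      also have "\<dots> \<le> M1 * (M1 ^ n * norm f)" using Suc M1_1 by (intro mult_left_mono) auto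
      finally show ?case by simp
    qed simp
    have "P (real N * (t / real N)) f = (P (t / real N) ^^ N) f"
      using s by (intro semigroup_power[OF P]) auto
    then show ?thesis using pow[of N] N by simp
  qed
  moreover have "M1 ^ N \<ge> 1" using M1_1 by simp
  ultimately show ?thesis by blast
qed

text \<open>Two commuting semigroups differ by at most the difference of their generators. Cutting \<open>[0, t]\<close>
  into \<open>N\<close> steps and replacing the steps of one semigroup by those of the other one at a time needs
  nothing but the derivatives at zero; a proof by differentiating \<open>P (t - s) (Q s f)\<close> would need
  left derivatives, too. The estimate is used both to construct a semigroup and for its uniqueness.\<close>

lemma semigroup_difference:
  fixes P Q :: "real \<Rightarrow> 'h::real_normed_vector \<Rightarrow> 'h"
  assumes P: "semigroup_C0 P" and Q: "semigroup_C0 Q" and t: "t \<ge> 0"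
    and comm: "\<And>s r f. s \<ge> 0 \<Longrightarrow> r \<ge> 0 \<Longrightarrow> P s (Q r f) = Q r (P s f)"
    and MP: "\<And>s f. s \<in> {0..t} \<Longrightarrow> norm (P s f) \<le> M * norm f"
    and MQ: "\<And>s f. s \<in> {0..t} \<Longrightarrow> norm (Q s f) \<le> M * norm f" and M: "M \<ge> 0"
    and a: "(f, a) \<in> gen P" and b: "(f, b) \<in> gen Q"
  shows "norm (P t f - Q t f) \<le> t * M\<^sup>2 * norm (a - b)"
proof (cases "t = 0")
  case True
  then show ?thesis by (simp add: semigroup_C0D(2)[OF P] semigroup_C0D(2)[OF Q])
next
  case False
  with t have tp: "t > 0" by simp
  have step: "norm (P t f - Q t f) \<le> t * M\<^sup>2 * norm ((P s f - f) /\<^sub>R s - (Q s f - f) /\<^sub>R s)"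
    if N: "N > 0" and s: "s = t / real N" for N s
  proof -
    have sp: "s > 0" using tp N s by simp
    have st: "real N * s = t" using N s by simp
    have "n \<le> N \<Longrightarrow> norm (P (real (N - n) * s) (P (real n * s) f - Q (real n * s) f))
            \<le> real n * M\<^sup>2 * norm (P s f - Q s f)" for n
    proof (induction n)
      case 0
      then show ?case
        using linear_0[OF bounded_linear.linear[OF semigroup_C0D(1)[OF P]], of "real N * s"] sp
        by (simp add: semigroup_C0D(2)[OF P] semigroup_C0D(2)[OF Q])
    next
      case (Suc n)
      define k where "k = N - Suc n"
      have kN: "N - n = Suc k" using Suc.prems by (simp add: k_def)
      have kt: "real k * s \<in> {0..t}" "real n * s \<in> {0..t}"
        using sp Suc.prems st mult_right_mono[of "real k" "real N" s] mult_right_mono[of "real n" "real N" s]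
        by (auto simp: k_def)
      have linP: "linear (P r)" "linear (Q r)" if "r \<ge> 0" for r
        using semigroup_C0D(1)[OF P that] semigroup_C0D(1)[OF Q that] by (auto intro: bounded_linear.linear)
      have Ps: "P (real (Suc n) * s) f = P s (P (real n * s) f)"
        "P (real (Suc k) * s) g = P (real k * s) (P s g)" for g
        using semigroup_C0D(3)[OF P, of s "real n * s" f] semigroup_C0D(3)[OF P, of "real k * s" s] sp
        by (simp_all add: algebra_simps)
      have Qs: "Q (real (Suc n) * s) f = Q (real n * s) (Q s f)"
        using semigroup_C0D(3)[OF Q, of "real n * s" s f] sp by (simp add: algebra_simps)
      \<comment> \<open>trade one step of \<open>Q\<close> for one step of \<open>P\<close>\<close>
      have "P (real k * s) (P (real (Suc n) * s) f - Q (real (Suc n) * s) f)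
          = P (real (Suc k) * s) (P (real n * s) f - Q (real n * s) f)
            + P (real k * s) (Q (real n * s) (P s f - Q s f))"
        using sp comm[of s "real n * s" f]
        by (simp only: Ps Qs) (simp add: linear_diff[OF linP(1)] linear_diff[OF linP(2)])
      then have "norm (P (real k * s) (P (real (Suc n) * s) f - Q (real (Suc n) * s) f))
          \<le> real n * M\<^sup>2 * norm (P s f - Q s f) + norm (P (real k * s) (Q (real n * s) (P s f - Q s f)))"
        using Suc.IH Suc.prems unfolding kN by (metis Suc_leD add_right_mono norm_triangle_mono order_refl)
      also have "norm (P (real k * s) (Q (real n * s) (P s f - Q s f))) \<le> M * (M * norm (P s f - Q s f))"
        by (rule order_trans[OF MP[OF kt(1)]]) (intro mult_left_mono MQ kt M)
      finally show ?case by (simp add: k_def[symmetric] power2_eq_square algebra_simps)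
    qed
    from this[of N] have "norm (P t f - Q t f) \<le> real N * M\<^sup>2 * norm (P s f - Q s f)"
      by (simp add: st semigroup_C0D(2)[OF P])
    also have "real N * norm (P s f - Q s f) = t * norm ((P s f - f) /\<^sub>R s - (Q s f - f) /\<^sub>R s)"
    proof -
      have *: "(P s f - f) /\<^sub>R s - (Q s f - f) /\<^sub>R s = (P s f - Q s f) /\<^sub>R s"
        by (simp flip: scaleR_diff_right)
      show ?thesis unfolding * norm_scaleR st[symmetric] using sp by simp
    qed
    then have "real N * M\<^sup>2 * norm (P s f - Q s f)
        = t * M\<^sup>2 * norm ((P s f - f) /\<^sub>R s - (Q s f - f) /\<^sub>R s)" by (metis mult.assoc mult.commute)
    finally show ?thesis .
  qed
  have lim0: "((\<lambda>s. t * M\<^sup>2 * norm ((P s f - f) /\<^sub>R s - (Q s f - f) /\<^sub>R s)) \<longlongrightarrow> t * M\<^sup>2 * norm (a - b)) (at_right 0)"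
    using a b by (auto simp: gen_def intro!: tendsto_intros)
  have "LIM n sequentially. real (Suc n) :> at_top"
    by (rule filterlim_compose[OF filterlim_real_sequentially filterlim_Suc])
  then have "(\<lambda>n. t / real (Suc n)) \<longlonglongrightarrow> 0"
    by (intro tendsto_divide_0[OF tendsto_const] filterlim_at_top_imp_at_infinity)
  then have s0: "filterlim (\<lambda>n. t / real (Suc n)) (at_right 0) sequentially"
    unfolding filterlim_at using tp by (auto intro!: always_eventually)
  show ?thesis
  proof (rule tendsto_lowerbound[OF filterlim_compose[OF lim0 s0]])
    show "\<forall>\<^sub>F n in sequentially. norm (P t f - Q t f) \<le> t * M\<^sup>2 *
       norm ((P (t / real (Suc n)) f - f) /\<^sub>R (t / real (Suc n)) - (Q (t / real (Suc n)) f - f) /\<^sub>R (t / real (Suc n)))"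
      by (intro always_eventually allI step[of "Suc _"]) auto
  qed simp
qed

section \<open>Bounded operators and their exponentials\<close>

text \<open>The bounded operators are copied to a type of their own so that composition can be made the
  multiplication of a Banach algebra, where the exponential and its derivative are available.\<close>

typedef (overloaded) 'h oper = "UNIV :: ('h::real_normed_vector \<Rightarrow>\<^sub>L 'h) set"
  morphisms lin_of Oper by simp

setup_lifting type_definition_oper

instantiation oper :: ("{banach, perfect_space}") real_normed_algebra_1
begin

lift_definition zero_oper :: "'a oper" is 0 .
lift_definition one_oper :: "'a oper" is id_blinfun .
lift_definition plus_oper :: "'a oper \<Rightarrow> 'a oper \<Rightarrow> 'a oper" is "(+)" .
lift_definition minus_oper :: "'a oper \<Rightarrow> 'a oper \<Rightarrow> 'a oper" is "(-)" .
lift_definition uminus_oper :: "'a oper \<Rightarrow> 'a oper" is uminus .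
lift_definition times_oper :: "'a oper \<Rightarrow> 'a oper \<Rightarrow> 'a oper" is "(o\<^sub>L)" .
lift_definition scaleR_oper :: "real \<Rightarrow> 'a oper \<Rightarrow> 'a oper" is scaleR .
lift_definition norm_oper :: "'a oper \<Rightarrow> real" is norm .
definition dist_oper :: "'a oper \<Rightarrow> 'a oper \<Rightarrow> real" where
  "dist_oper S T = norm (S - T)"
definition sgn_oper :: "'a oper \<Rightarrow> 'a oper" where
  "sgn_oper T = inverse (norm T) *\<^sub>R T"
definition uniformity_oper :: "('a oper \<times> 'a oper) filter" where
  "uniformity_oper = (INF e\<in>{0<..}. principal {(S, T). dist S T < e})"
definition open_oper :: "'a oper set \<Rightarrow> bool" where
  "open_oper U \<longleftrightarrow> (\<forall>T\<in>U. eventually (\<lambda>(T', S). T' = T \<longrightarrow> S \<in> U) uniformity)"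

instance
proof
  fix S T U :: "'a oper" and a b :: real
  show "S + T + U = S + (T + U)" by transfer (simp add: algebra_simps)
  show "S + T = T + S" by transfer (simp add: algebra_simps)
  show "0 + T = T" by transfer simp
  show "- T + T = 0" by transfer simp
  show "S - T = S + - T" by transfer simp
  show "a *\<^sub>R (S + T) = a *\<^sub>R S + a *\<^sub>R T" by transfer (simp add: algebra_simps)
  show "(a + b) *\<^sub>R T = a *\<^sub>R T + b *\<^sub>R T" by transfer (simp add: algebra_simps)
  show "a *\<^sub>R b *\<^sub>R T = (a * b) *\<^sub>R T" by transfer simp
  show "1 *\<^sub>R T = T" by transfer simp
  show "S * T * U = S * (T * U)" by transfer (auto intro: blinfun_eqI)
  show "1 * T = T" by transfer (auto intro: blinfun_eqI)
  show "T * 1 = T" by transfer (auto intro: blinfun_eqI)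
  show "(S + T) * U = S * U + T * U" by transfer (auto intro!: blinfun_eqI simp: blinfun.bilinear_simps)
  show "S * (T + U) = S * T + S * U" by transfer (auto intro!: blinfun_eqI simp: blinfun.bilinear_simps)
  show "a *\<^sub>R S * T = a *\<^sub>R (S * T)" by transfer (auto intro!: blinfun_eqI simp: blinfun.bilinear_simps)
  show "S * a *\<^sub>R T = a *\<^sub>R (S * T)" by transfer (auto intro!: blinfun_eqI simp: blinfun.bilinear_simps)
  have n1: "norm (1 :: 'a oper) = 1" by transfer (rule norm_blinfun_id)
  have n0: "norm (0 :: 'a oper) = 0" by transfer simp
  show "(0 :: 'a oper) \<noteq> 1" using n0 n1 by auto
  show "norm (1 :: 'a oper) = 1" by (rule n1)
  show "dist S T = norm (S - T)" by (rule dist_oper_def)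
  show "sgn T = inverse (norm T) *\<^sub>R T" by (rule sgn_oper_def)
  show "uniformity = (INF e\<in>{0<..}. principal {(S, T :: 'a oper). dist S T < e})"
    by (rule uniformity_oper_def)
  show "open W \<longleftrightarrow> (\<forall>T\<in>W. eventually (\<lambda>(T', S). T' = T \<longrightarrow> S \<in> W) uniformity)"
    for W :: "'a oper set" by (rule open_oper_def)
  show "norm T = 0 \<longleftrightarrow> T = 0" by transfer simp
  show "norm (S + T) \<le> norm S + norm T" by transfer (rule norm_triangle_ineq)
  show "norm (a *\<^sub>R T) = \<bar>a\<bar> * norm T" by transfer simp
  show "norm (S * T) \<le> norm S * norm T" by transfer (rule norm_blinfun_compose)
qed

end

instance oper :: ("{banach, perfect_space}") banach
proof
  fix X :: "nat \<Rightarrow> 'a oper" assume X: "Cauchy X"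
  then have "Cauchy (\<lambda>n. lin_of (X n))"
    unfolding Cauchy_iff by (simp add: norm_oper.rep_eq minus_oper.rep_eq)
  then obtain L where L: "(\<lambda>n. lin_of (X n)) \<longlonglongrightarrow> L" using Cauchy_convergent convergent_def by blast
  have "X \<longlonglongrightarrow> Oper L"
    using L unfolding LIMSEQ_iff by (simp add: norm_oper.rep_eq minus_oper.rep_eq Oper_inverse)
  then show "convergent X" by (auto simp: convergent_def)
qed

definition act :: "'h::{banach, perfect_space} oper \<Rightarrow> 'h \<Rightarrow> 'h" where
  "act T f = blinfun_apply (lin_of T) f"

lemma act_one [simp]: "act 1 f = f" and act_times: "act (S * T) f = act S (act T f)"
  by (simp_all add: act_def one_oper.rep_eq times_oper.rep_eq)

lemma norm_act: "norm (act T f) \<le> norm T * norm f"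
  unfolding act_def norm_oper.rep_eq by (rule norm_blinfun)

lemma bounded_bilinear_act: "bounded_bilinear act"
  by standard
     (auto simp: act_def plus_oper.rep_eq scaleR_oper.rep_eq blinfun.bilinear_simps
        intro!: exI[of _ 1] norm_act[unfolded act_def])

interpretation act: bounded_bilinear act by (rule bounded_bilinear_act)

lemma act_power: "act (T ^ n) f = (act T ^^ n) f"
  by (induction n) (simp_all add: act_times)

lemma ex_oper:
  assumes "bounded_linear F" "\<And>f. norm (F f) \<le> C * norm f" "0 \<le> C"
  shows "\<exists>T. (\<forall>f. act T f = F f) \<and> norm T \<le> C"
  by (rule exI[of _ "Oper (Blinfun F)"])
     (simp add: act_def norm_oper.rep_eq Oper_inverse bounded_linear_Blinfun_apply assms norm_blinfun_bound)

lemma exp_commute: 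
  fixes A B :: "'b::{real_normed_algebra_1, banach}"
  assumes "A * B = B * A" shows "exp A * B = B * exp A"
proof -
  have "A ^ n * B = B * A ^ n" for n using assms by (metis power_commuting_commutes)
  then have "(A ^ n /\<^sub>R fact n) * B = B * (A ^ n /\<^sub>R fact n)" for n by simp
  then show ?thesis
    by (simp add: exp_def suminf_mult[OF summable_exp_generic, symmetric] suminf_mult2[OF summable_exp_generic])
qed

lemma semigroup_exp:
  fixes A :: "'h::{banach, perfect_space} oper"
  shows "semigroup_C0 (\<lambda>t. act (exp (t *\<^sub>R A)))" and "(f, act A f) \<in> gen (\<lambda>t. act (exp (t *\<^sub>R A)))"
proof -
  have "((\<lambda>t. exp (t *\<^sub>R A)) has_vector_derivative A) (at 0 within {0<..})"
    using exp_scaleR_has_vector_derivative_right[of A 0 "{0<..}"] by simp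
  then have "((\<lambda>t. norm (exp (t *\<^sub>R A) - 1 - t *\<^sub>R A) / \<bar>t\<bar>) \<longlongrightarrow> 0) (at_right 0)"
    by (simp add: has_vector_derivative_def has_derivative_iff_norm)
  moreover have "\<forall>\<^sub>F t in at_right (0::real). norm (exp (t *\<^sub>R A) - 1 - t *\<^sub>R A) / \<bar>t\<bar>
      = norm ((exp (t *\<^sub>R A) - 1) /\<^sub>R t - A)"
    using eventually_at_right_less[of 0]
  proof eventually_elim
    case (elim t)
    then have "exp (t *\<^sub>R A) - 1 - t *\<^sub>R A = t *\<^sub>R ((exp (t *\<^sub>R A) - 1) /\<^sub>R t - A)"
      by (simp add: scaleR_diff_right)
    then show ?case using elim by simp
  qed
  ultimately have "((\<lambda>t. norm ((exp (t *\<^sub>R A) - 1) /\<^sub>R t - A)) \<longlongrightarrow> 0) (at_right 0)"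
    by (simp add: tendsto_cong)
  then have lim: "((\<lambda>t. (exp (t *\<^sub>R A) - 1) /\<^sub>R t) \<longlongrightarrow> A) (at_right 0)"
    using tendsto_norm_zero_iff LIM_zero_iff by blast
  show "(f, act A f) \<in> gen (\<lambda>t. act (exp (t *\<^sub>R A)))"
    using act.tendsto[OF lim tendsto_const, of f]
    by (simp add: gen_def act.scaleR_left act.diff_left)
  show "semigroup_C0 (\<lambda>t. act (exp (t *\<^sub>R A)))"
    unfolding semigroup_C0_def
  proof (intro conjI allI impI)
    show "bounded_linear (act (exp (t *\<^sub>R A)))" for t by (rule act.bounded_linear_right)
    show "act (exp ((s + t) *\<^sub>R A)) f = act (exp (s *\<^sub>R A)) (act (exp (t *\<^sub>R A)) f)" for s t f
      unfolding act_times[symmetric] by (subst exp_add_commuting[symmetric]) (simp_all add: scaleR_left_distrib)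
    have "((\<lambda>t. exp (t *\<^sub>R A)) \<longlongrightarrow> exp (0 *\<^sub>R A)) (at_right 0)"
      using has_vector_derivative_continuous[OF exp_scaleR_has_vector_derivative_right[of A 0 "{0<..}"]]
      unfolding continuous_within .
    then show "((\<lambda>t. act (exp (t *\<^sub>R A)) f) \<longlongrightarrow> f) (at_right 0)" for f
      using act.tendsto[OF _ tendsto_const, of _ "exp (0 *\<^sub>R A)" _ f] by simp
  qed simp
qed

text \<open>\<open>exp (s (T - 1))\<close> is a Poisson average of the powers of \<open>T\<close>, so it preserves each closed convex
  set that \<open>T\<close> preserves.\<close>

lemma exp_convex_invariant:
  fixes T :: "'h::{banach, perfect_space} oper"
  assumes S: "closed S" "convex S" "0 \<in> S" and inv: "\<And>f. f \<in> S \<Longrightarrow> act T f \<in> S"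
    and s: "s \<ge> 0" and f: "f \<in> S"
  shows "act (exp (s *\<^sub>R (T - 1))) f \<in> S"
proof -
  have "exp (s *\<^sub>R (T - 1)) = exp (s *\<^sub>R T + of_real (- s))"
    by (simp add: scaleR_diff_right of_real_def)
  also have "\<dots> = exp (s *\<^sub>R T) * of_real (exp (- s))"
    unfolding exp_of_real[symmetric] by (rule exp_add_commuting) (simp add: of_real_def)
  finally have e: "act (exp (s *\<^sub>R (T - 1))) f = exp (- s) *\<^sub>R act (exp (s *\<^sub>R T)) f"
    by (simp add: of_real_def act.scaleR_left)
  define c where "c n = exp (- s) * (s ^ n / fact n)" for n
  have c0: "c n \<ge> 0" for n using s by (simp add: c_def)
  have csum: "c sums 1"
  proof -
    have "(\<lambda>n. exp (- s) * (s ^ n /\<^sub>R fact n)) sums (exp (- s) * exp s)"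
      by (intro sums_mult exp_converges)
    then show ?thesis by (simp add: c_def[abs_def] exp_minus divide_inverse mult.commute)
  qed
  define x where "x n = (act T ^^ n) f" for n
  have x: "x n \<in> S" for n by (induction n) (simp_all add: x_def f inv)
  have part: "(\<Sum>n<N. c n *\<^sub>R x n) \<in> S" for N
  proof -
    \<comment> \<open>complete the partial sum to a convex combination by putting the missing mass on 0\<close>
    define r where "r = (\<Sum>n<N. c n)"
    have r: "0 \<le> r" "r \<le> 1"
      using c0 sum_le_suminf[OF sums_summable[OF csum], of "{..<N}"] sums_unique[OF csum]
      by (auto simp: r_def sum_nonneg)
    show ?thesis
    proof (cases "r = 0")
      case True
      then have "c n = 0" if "n < N" for n
        using c0 that by (simp add: r_def sum_nonneg_eq_0_iff)
      then show ?thesis using S by simp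
    next
      case False
      have "(\<Sum>n<N. (c n / r) *\<^sub>R x n) \<in> S"
        by (rule convex_sum) (use S x c0 r False in \<open>auto simp: r_def sum_divide_distrib[symmetric]\<close>)
      then have "r *\<^sub>R (\<Sum>n<N. (c n / r) *\<^sub>R x n) + (1 - r) *\<^sub>R 0 \<in> S"
        using S r by (intro convexD) auto
      then show ?thesis using False by (simp add: scaleR_sum_right)
    qed
  qed
  have "(\<lambda>n. act ((s *\<^sub>R T) ^ n /\<^sub>R fact n) f) sums act (exp (s *\<^sub>R T)) f"
    by (rule bounded_linear.sums[OF act.bounded_linear_left exp_converges])
  then have "(\<lambda>n. exp (- s) *\<^sub>R act ((s *\<^sub>R T) ^ n /\<^sub>R fact n) f) sums act (exp (s *\<^sub>R (T - 1))) f"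
    unfolding e by (rule sums_scaleR_right)
  moreover have "exp (- s) *\<^sub>R act ((s *\<^sub>R T) ^ n /\<^sub>R fact n) f = c n *\<^sub>R x n" for n
    by (simp add: c_def x_def act.scaleR_left act_power[symmetric] scaleR_power divide_inverse mult.commute)
  ultimately have "(\<lambda>n. c n *\<^sub>R x n) sums act (exp (s *\<^sub>R (T - 1))) f" by simp
  then show ?thesis
    unfolding sums_def using S(1) part by (meson closed_sequentially)
qed

section \<open>The semigroup generated by a family of resolvents\<close>

text \<open>The resolvents \<open>R k = (k - A)\<^sup>-\<^sup>1\<close> of a generator \<open>A\<close> that stays implicit: its domain is the range
  of \<open>R 1\<close>, and \<open>A (R 1 h) = R 1 h - h\<close>.\<close>

locale resolvent_family =
  fixes R :: "real \<Rightarrow> 'h::{banach, perfect_space} oper"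
  assumes norm_R: "k > 0 \<Longrightarrow> norm (R k) \<le> 1 / k"
    and resolvent_identity: "j > 0 \<Longrightarrow> k > 0 \<Longrightarrow> R j - R k = (k - j) *\<^sub>R (R j * R k)"
    and R_inj: "act (R 1) h = 0 \<Longrightarrow> h = 0"
    and R_dense: "e > 0 \<Longrightarrow> \<exists>h. norm (f - act (R 1) h) < e"
begin

text \<open>The bounded approximations \<open>k A (k - A)\<^sup>-\<^sup>1\<close> of \<open>A\<close>.\<close>

definition Yosida :: "real \<Rightarrow> 'h oper" where
  "Yosida k = k *\<^sub>R (k *\<^sub>R R k - 1)"

definition approx :: "real \<Rightarrow> real \<Rightarrow> 'h \<Rightarrow> 'h" where
  "approx k t = act (exp (t *\<^sub>R Yosida k))"

definition flow :: "real \<Rightarrow> 'h \<Rightarrow> 'h" where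
  "flow t f = lim (\<lambda>n. approx (real (Suc n)) t f)"

lemma R_commute: "j > 0 \<Longrightarrow> k > 0 \<Longrightarrow> R j * R k = R k * R j"
proof (cases "j = k")
  case False
  assume "j > 0" "k > 0"
  then have "(k - j) *\<^sub>R (R j * R k) = - ((j - k) *\<^sub>R (R k * R j))"
    using resolvent_identity[of j k] resolvent_identity[of k j] by (metis minus_diff_eq)
  then have "(k - j) *\<^sub>R (R j * R k) = (k - j) *\<^sub>R (R k * R j)"
    by (simp flip: scaleR_minus_left)
  with False show ?thesis by simp
qed simp

lemma Yosida_commute: "j > 0 \<Longrightarrow> k > 0 \<Longrightarrow> Yosida j * Yosida k = Yosida k * Yosida j"
  by (simp add: Yosida_def algebra_simps R_commute)

lemma exp_Yosida_commute:
  assumes "j > 0" "k > 0"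
  shows "exp (s *\<^sub>R Yosida j) * exp (t *\<^sub>R Yosida k) = exp (t *\<^sub>R Yosida k) * exp (s *\<^sub>R Yosida j)"
proof -
  have "s *\<^sub>R Yosida j * t *\<^sub>R Yosida k = t *\<^sub>R Yosida k * s *\<^sub>R Yosida j"
    using Yosida_commute[OF assms] by (simp add: mult.commute)
  from exp_commute[OF this] show ?thesis by (metis exp_commute)
qed

lemma approx_convex_invariant:
  assumes "closed S" "convex S" "0 \<in> S" "\<And>f. f \<in> S \<Longrightarrow> k *\<^sub>R act (R k) f \<in> S"
    and "k > 0" "t \<ge> 0" "f \<in> S"
  shows "approx k t f \<in> S"
  using exp_convex_invariant[of S "k *\<^sub>R R k" "t * k" f] assms
  by (simp add: approx_def Yosida_def act.scaleR_left)

lemma norm_kR: "k > 0 \<Longrightarrow> norm (k *\<^sub>R act (R k) f) \<le> norm f"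
proof -
  assume k: "k > 0"
  have "norm (k *\<^sub>R act (R k) f) \<le> k * (norm (R k) * norm f)"
    using k norm_act[of "R k" f] by simp
  also have "\<dots> \<le> k * (1 / k * norm f)"
    using k norm_R[OF k] by (intro mult_left_mono mult_right_mono) auto
  finally show ?thesis using k by simp
qed

lemma norm_approx: "k > 0 \<Longrightarrow> t \<ge> 0 \<Longrightarrow> norm (approx k t f) \<le> norm f"
  using approx_convex_invariant[of "cball 0 (norm f)" k t f] order_trans[OF norm_kR] by simp

lemma semigroup_approx: "semigroup_C0 (approx k)" "(f, act (Yosida k) f) \<in> gen (approx k)"
  using semigroup_exp(1)[of "Yosida k"] semigroup_exp(2)[where A = "Yosida k" and f = f]
  by (simp_all add: approx_def[abs_def])

lemma R_times_R1:
  assumes "k > 0" shows "(k - 1) *\<^sub>R act (R k) (act (R 1) h) = act (R 1) h - act (R k) h"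
  using resolvent_identity[of 1 k] R_commute[of 1 k] assms
  by (simp flip: act_times act.scaleR_left act.diff_left)

text \<open>On the range of \<open>R 1\<close> the resolvent identity gives the rate \<open>1/k\<close>; density and the uniform bound
  \<open>norm (k R k) \<le> 1\<close> do the rest.\<close>

lemma kR_tendsto: "((\<lambda>k. k *\<^sub>R act (R k) f) \<longlongrightarrow> f) at_top"
proof (rule tendstoI)
  fix e :: real assume e: "e > 0"
  obtain h where h: "norm (f - act (R 1) h) < e / 3" using R_dense[of "e / 3" f] e by auto
  define g where "g = act (R 1) h"
  have "((\<lambda>k. (norm g + norm h) / k) \<longlongrightarrow> 0) at_top"
    by (intro tendsto_divide_0[OF tendsto_const] filterlim_at_top_imp_at_infinity filterlim_ident)
  then have "\<forall>\<^sub>F k in at_top. (norm g + norm h) / k < e / 3"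
    by (rule order_tendstoD(2)) (use e in simp)
  then show "\<forall>\<^sub>F k in at_top. dist (k *\<^sub>R act (R k) f) f < e"
    using eventually_gt_at_top[of 0]
  proof eventually_elim
    case (elim k)
    have "k *\<^sub>R act (R k) g - g = act (R k) g - act (R k) h"
      using R_times_R1[OF elim(2), of h] by (simp add: g_def algebra_simps)
    then have "norm (k *\<^sub>R act (R k) g - g) \<le> norm (act (R k) g) + norm (act (R k) h)"
      by (simp add: norm_triangle_ineq4)
    also have "\<dots> \<le> (norm g + norm h) / k"
      using norm_kR[OF elim(2), of g] norm_kR[OF elim(2), of h] elim(2) by (simp add: field_simps)
    finally have 1: "norm (k *\<^sub>R act (R k) g - g) < e / 3" using elim(1) by (rule le_less_trans)
    have 2: "norm (k *\<^sub>R act (R k) (f - g)) < e / 3"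
      using norm_kR[OF elim(2), of "f - g"] h by (simp add: g_def)
    have "k *\<^sub>R act (R k) f - f = k *\<^sub>R act (R k) (f - g) + (k *\<^sub>R act (R k) g - g) + (g - f)"
      by (simp add: act.diff_right algebra_simps)
    then have "norm (k *\<^sub>R act (R k) f - f)
        \<le> norm (k *\<^sub>R act (R k) (f - g)) + norm (k *\<^sub>R act (R k) g - g) + norm (g - f)"
      by (simp only:) (meson norm_triangle_ineq order_trans add_right_mono)
    then show ?case using 1 2 h by (simp add: dist_norm g_def norm_minus_commute)
  qed
qed

text \<open>On the domain of \<open>A\<close> the Yosida approximation of \<open>A\<close> is \<open>k R k\<close> applied to \<open>A\<close>.\<close>

lemma Yosida_tendsto: "((\<lambda>k. act (Yosida k) (act (R 1) h)) \<longlongrightarrow> act (R 1) h - h) at_top"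
proof (rule Lim_transform_eventually[OF kR_tendsto])
  show "\<forall>\<^sub>F k in at_top. k *\<^sub>R act (R k) (act (R 1) h - h) = act (Yosida k) (act (R 1) h)"
    using eventually_gt_at_top[of 0]
  proof eventually_elim
    case (elim k)
    have "k *\<^sub>R ((k - 1) *\<^sub>R act (R k) (act (R 1) h)) = k *\<^sub>R (act (R 1) h - act (R k) h)"
      using R_times_R1[OF elim, of h] by simp
    then show ?case
      by (simp add: Yosida_def act.diff_right act.diff_left act.scaleR_left algebra_simps)
  qed
qed

lemmas of_Suc_at_top = filterlim_compose[OF filterlim_real_sequentially filterlim_Suc]

lemma commuting_semigroup_approx:
  assumes Q: "semigroup_C0 Q" and comm: "\<And>s r k f. s \<ge> 0 \<Longrightarrow> r \<ge> 0 \<Longrightarrow> k > 0 \<Longrightarrow> Q s (approx k r f) = approx k r (Q s f)"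
    and MQ: "\<And>s f. s \<in> {0..t} \<Longrightarrow> norm (Q s f) \<le> M * norm f" and M: "M \<ge> 1"
    and a: "(f, a) \<in> gen Q" and k: "k > 0" and t: "t \<ge> 0"
  shows "norm (Q t f - approx k t f) \<le> t * M\<^sup>2 * norm (a - act (Yosida k) f)"
proof (rule semigroup_difference[OF Q semigroup_approx(1) t _ _ _ _ a semigroup_approx(2)])
  show "norm (approx k s f) \<le> M * norm f" if "s \<in> {0..t}" for s f
    using norm_approx[OF k, of s f] that M mult_right_mono[of 1 M "norm f"] by simp
qed (use comm MQ M k in auto)

lemma approx_difference:
  assumes "j > 0" "k > 0" "t \<ge> 0"
  shows "norm (approx j t f - approx k t f) \<le> t * norm (act (Yosida j) f - act (Yosida k) f)"
proof -
  have "approx j s (approx i r g) = approx i r (approx j s g)" if "i > 0" for s r i g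
    using exp_Yosida_commute[OF assms(1) that, of s r] by (simp add: approx_def flip: act_times)
  then show ?thesis
    using commuting_semigroup_approx[OF semigroup_approx(1)[of j] _ _ _ semigroup_approx(2)[of f j] assms(2,3), of 1]
      norm_approx[OF assms(1)] by simp
qed

lemma approx_linear: "linear (approx k t)"
  unfolding approx_def by (rule bounded_linear.linear[OF act.bounded_linear_right])

lemma approx_convergent:
  assumes t: "t \<ge> 0"
  shows "(\<lambda>n. approx (real (Suc n)) t f) \<longlonglongrightarrow> flow t f"
  unfolding flow_def convergent_LIMSEQ_iff[symmetric]
proof (rule Cauchy_convergent, unfold Cauchy_iff, intro allI impI)
  fix e :: real assume e: "e > 0"
  obtain h where h: "norm (f - act (R 1) h) < e / 3" using R_dense[of "e / 3" f] e by auto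
  define g where "g = act (R 1) h"
  have "(\<lambda>n. act (Yosida (real (Suc n))) g) \<longlonglongrightarrow> g - h"
    unfolding g_def by (rule filterlim_compose[OF Yosida_tendsto of_Suc_at_top])
  then have "Cauchy (\<lambda>n. act (Yosida (real (Suc n))) g)" by (rule LIMSEQ_imp_Cauchy)
  moreover have "e / (3 * (t + 1)) > 0" using e t by simp
  ultimately obtain M where M: "\<And>m n. m \<ge> M \<Longrightarrow> n \<ge> M \<Longrightarrow>
      norm (act (Yosida (real (Suc m))) g - act (Yosida (real (Suc n))) g) < e / (3 * (t + 1))"
    unfolding Cauchy_iff by blast
  have "norm (approx (real (Suc m)) t f - approx (real (Suc n)) t f) < e" if mn: "m \<ge> M" "n \<ge> M" for m n
  proof -
    have "norm (approx (real (Suc m)) t g - approx (real (Suc n)) t g)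
        \<le> t * norm (act (Yosida (real (Suc m))) g - act (Yosida (real (Suc n))) g)"
      by (rule approx_difference) (use t in auto)
    also have "\<dots> \<le> t * (e / (3 * (t + 1)))" using M[OF mn] t by (intro mult_left_mono) auto
    also have "\<dots> \<le> e / 3" using t e by (simp add: field_simps)
    finally have 1: "norm (approx (real (Suc m)) t g - approx (real (Suc n)) t g) \<le> e / 3" .
    have 2: "norm (approx (real (Suc i)) t (f - g)) < e / 3" for i
      using norm_approx[of "real (Suc i)" t "f - g"] t h by (simp add: g_def)
    have "approx (real (Suc m)) t f - approx (real (Suc n)) t f
        = approx (real (Suc m)) t (f - g) + (approx (real (Suc m)) t g - approx (real (Suc n)) t g)
          - approx (real (Suc n)) t (f - g)"
      by (simp add: linear_diff[OF approx_linear])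
    also have "norm \<dots> \<le> norm (approx (real (Suc m)) t (f - g))
        + norm (approx (real (Suc m)) t g - approx (real (Suc n)) t g) + norm (approx (real (Suc n)) t (f - g))"
      by (meson norm_triangle_ineq norm_triangle_ineq4 order_trans add_right_mono)
    finally show ?thesis using 1 2[of m] 2[of n] by linarith
  qed
  then show "\<exists>M. \<forall>m\<ge>M. \<forall>n\<ge>M. norm (approx (real (Suc m)) t f - approx (real (Suc n)) t f) < e" by blast
qed

lemma flow_convex_invariant:
  assumes "closed S" "convex S" "0 \<in> S" "\<And>k f. k > 0 \<Longrightarrow> f \<in> S \<Longrightarrow> k *\<^sub>R act (R k) f \<in> S"
    and "t \<ge> 0" "f \<in> S"
  shows "flow t f \<in> S"
proof (rule closed_sequentially[OF assms(1) _ approx_convergent[OF assms(5)]])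
  show "approx (real (Suc n)) t f \<in> S" for n by (rule approx_convex_invariant) (use assms in auto)
qed

lemma norm_flow: "t \<ge> 0 \<Longrightarrow> norm (flow t f) \<le> norm f"
  using flow_convex_invariant[of "cball 0 (norm f)" t f] order_trans[OF norm_kR] by simp

lemma flow_linear: "t \<ge> 0 \<Longrightarrow> linear (flow t)"
proof
  assume t: "t \<ge> 0"
  show "flow t (f + g) = flow t f + flow t g" for f g
    by (rule LIMSEQ_unique[OF approx_convergent[OF t]])
       (simp only: linear_add[OF approx_linear], intro tendsto_add approx_convergent t)
  show "flow t (c *\<^sub>R f) = c *\<^sub>R flow t f" for c f
    by (rule LIMSEQ_unique[OF approx_convergent[OF t]])
       (simp only: linear_scale[OF approx_linear], intro tendsto_scaleR tendsto_const approx_convergent t)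
qed

lemma flow_bounded_linear: "t \<ge> 0 \<Longrightarrow> bounded_linear (flow t)"
  using norm_flow linear_add[OF flow_linear] linear_scale[OF flow_linear]
  by (intro bounded_linear_intro[of _ 1]) auto

lemma flow_0: "flow 0 f = f"
  by (rule LIMSEQ_unique[OF approx_convergent]) (simp_all add: approx_def)

lemma flow_add:
  assumes "s \<ge> 0" "t \<ge> 0" shows "flow (s + t) f = flow s (flow t f)"
proof (rule LIMSEQ_unique[OF approx_convergent])
  let ?k = "\<lambda>n. real (Suc n)"
  have "(\<lambda>n. norm (approx (?k n) s (approx (?k n) t f - flow t f))) \<longlonglongrightarrow> 0"
  proof (rule tendsto_sandwich[OF _ _ tendsto_const])
    show "(\<lambda>n. norm (approx (?k n) t f - flow t f)) \<longlonglongrightarrow> 0"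
      using approx_convergent[OF assms(2), of f] by (intro tendsto_norm_zero LIM_zero)
  qed (use norm_approx assms in auto)
  then have "(\<lambda>n. approx (?k n) s (approx (?k n) t f - flow t f) + approx (?k n) s (flow t f)) \<longlonglongrightarrow> 0 + flow s (flow t f)"
    by (intro tendsto_add approx_convergent assms) (simp add: tendsto_norm_zero_iff)
  then show "(\<lambda>n. approx (?k n) (s + t) f) \<longlonglongrightarrow> flow s (flow t f)"
    using semigroup_C0D(3)[OF semigroup_approx(1) assms] by (simp add: linear_diff[OF approx_linear])
qed (use assms in simp)

lemma flow_approx:
  assumes k: "k > 0" and t: "t \<ge> 0" and f: "f = act (R 1) h"
  shows "norm (flow t f - approx k t f) \<le> t * norm (f - h - act (Yosida k) f)"
proof (rule tendsto_le[OF sequentially_bot])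
  show "(\<lambda>n. norm (approx (real (Suc n)) t f - approx k t f)) \<longlonglongrightarrow> norm (flow t f - approx k t f)"
    by (intro tendsto_intros approx_convergent t)
  show "(\<lambda>n. t * norm (act (Yosida (real (Suc n))) f - act (Yosida k) f)) \<longlonglongrightarrow> t * norm (f - h - act (Yosida k) f)"
    unfolding f by (intro tendsto_intros filterlim_compose[OF Yosida_tendsto of_Suc_at_top])
  show "\<forall>\<^sub>F n in sequentially. norm (approx (real (Suc n)) t f - approx k t f)
      \<le> t * norm (act (Yosida (real (Suc n))) f - act (Yosida k) f)"
    by (intro always_eventually allI approx_difference k t) simp
qed

lemma range_R_subset_gen: "(act (R 1) h, act (R 1) h - h) \<in> gen flow"
  unfolding gen_def
proof (clarify, rule tendstoI)
  fix e :: real assume e: "e > 0"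
  define f where "f = act (R 1) h"
  have "\<forall>\<^sub>F k in at_top. k > 0 \<and> dist (act (Yosida k) f) (f - h) < e / 3"
    unfolding f_def by (intro eventually_conj eventually_gt_at_top tendstoD[OF Yosida_tendsto]) (use e in simp)
  then obtain k where k: "k > 0" "norm (f - h - act (Yosida k) f) < e / 3"
    by (auto simp: eventually_at_top_linorder dist_norm norm_minus_commute)
  have "((\<lambda>t. (approx k t f - f) /\<^sub>R t) \<longlongrightarrow> act (Yosida k) f) (at_right 0)"
    using semigroup_approx(2)[of f k] by (simp add: gen_def)
  then have "\<forall>\<^sub>F t in at_right 0. dist ((approx k t f - f) /\<^sub>R t) (act (Yosida k) f) < e / 3"
    using e by (intro tendstoD) auto
  then show "\<forall>\<^sub>F t in at_right 0. dist ((flow t (act (R 1) h) - act (R 1) h) /\<^sub>R t) (act (R 1) h - h) < e"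
    using eventually_at_right_less[of 0]
  proof eventually_elim
    case (elim t)
    have "norm ((flow t f - approx k t f) /\<^sub>R t) \<le> norm (f - h - act (Yosida k) f)"
      using flow_approx[OF k(1) _ f_def, of t] elim(2)
      unfolding norm_scaleR by (simp add: divide_simps mult.commute)
    then have 1: "norm ((flow t f - approx k t f) /\<^sub>R t) < e / 3" using k by simp
    have "(flow t f - f) /\<^sub>R t - (f - h) = (flow t f - approx k t f) /\<^sub>R t
        + ((approx k t f - f) /\<^sub>R t - act (Yosida k) f) - (f - h - act (Yosida k) f)"
      by (simp add: scaleR_diff_right)
    also have "norm \<dots> \<le> norm ((flow t f - approx k t f) /\<^sub>R t)
        + norm ((approx k t f - f) /\<^sub>R t - act (Yosida k) f) + norm (f - h - act (Yosida k) f)"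
      by (meson norm_triangle_ineq norm_triangle_ineq4 order_trans add_right_mono)
    finally show ?case using 1 k elim(1) by (simp add: dist_norm f_def)
  qed
qed

lemma semigroup_flow: "semigroup_C0 flow"
  unfolding semigroup_C0_def
proof (intro conjI allI impI)
  fix f
  show "((\<lambda>t. flow t f) \<longlongrightarrow> f) (at_right 0)"
  proof (rule tendstoI)
    fix e :: real assume e: "e > 0"
    obtain h where h: "norm (f - act (R 1) h) < e / 3" using R_dense[of "e / 3" f] e by auto
    define g where "g = act (R 1) h"
    have "((\<lambda>t. t *\<^sub>R ((flow t g - g) /\<^sub>R t)) \<longlongrightarrow> 0 *\<^sub>R (g - h)) (at_right 0)"
      using range_R_subset_gen[of h] unfolding gen_def g_def
      by (intro tendsto_scaleR tendsto_ident_at) auto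
    then have "\<forall>\<^sub>F t in at_right 0. dist (t *\<^sub>R ((flow t g - g) /\<^sub>R t)) (0 *\<^sub>R (g - h)) < e / 3"
      using e by (intro tendstoD) auto
    then show "\<forall>\<^sub>F t in at_right 0. dist (flow t f) f < e"
      using eventually_at_right_less[of 0]
    proof eventually_elim
      case (elim t)
      have 1: "norm (flow t g - g) < e / 3" using elim by simp
      have 2: "norm (flow t (f - g)) < e / 3" using norm_flow[of t "f - g"] h elim by (simp add: g_def)
      have "flow t f - f = flow t (f - g) + (flow t g - g) - (f - g)"
        using elim by (simp add: linear_diff[OF flow_linear])
      also have "norm \<dots> \<le> norm (flow t (f - g)) + norm (flow t g - g) + norm (f - g)"
        by (meson norm_triangle_ineq norm_triangle_ineq4 order_trans add_right_mono)
      finally show ?case using 1 2 h by (simp add: dist_norm g_def)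
    qed
  qed
qed (auto simp: flow_0 flow_add flow_bounded_linear)

text \<open>The inclusion from right to left was the construction. Conversely, for \<open>(f, a)\<close> in the generator,
  \<open>w = f - R 1 (f - a)\<close> would be an eigenvector with eigenvalue one, along which the semigroup would
  have to expand; contractivity forces \<open>w = 0\<close>.\<close>

lemma gen_flow: "gen flow = {(act (R 1) h, act (R 1) h - h) | h. True}"
proof (intro equalityI subsetI)
  fix p assume "p \<in> gen flow"
  then obtain f a where p: "p = (f, a)" and fa: "(f, a) \<in> gen flow" by (cases p) auto
  define h where "h = f - a"
  define w where "w = f - act (R 1) h"
  have "((\<lambda>t. (flow t f - f) /\<^sub>R t - (flow t (act (R 1) h) - act (R 1) h) /\<^sub>R t)
      \<longlongrightarrow> a - (act (R 1) h - h)) (at_right 0)"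
    using fa range_R_subset_gen[of h] by (auto simp: gen_def intro!: tendsto_diff)
  then have "((\<lambda>t. norm ((flow t f - f) /\<^sub>R t - (flow t (act (R 1) h) - act (R 1) h) /\<^sub>R t - w)) \<longlongrightarrow> 0) (at_right 0)"
    by (intro tendsto_norm_zero LIM_zero) (simp add: h_def w_def)
  moreover have "\<forall>\<^sub>F t in at_right 0.
      norm w \<le> norm ((flow t f - f) /\<^sub>R t - (flow t (act (R 1) h) - act (R 1) h) /\<^sub>R t - w)"
    using eventually_at_right_less[of 0]
  proof eventually_elim
    case (elim t)
    let ?d = "(flow t f - f) /\<^sub>R t - (flow t (act (R 1) h) - act (R 1) h) /\<^sub>R t - w"
    have "(1 + t) *\<^sub>R w = flow t w - t *\<^sub>R ?d"
      using elim by (simp add: w_def linear_diff[OF flow_linear] algebra_simps)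
    then have "(1 + t) * norm w = norm (flow t w - t *\<^sub>R ?d)"
      using elim by (metis abs_of_pos add_pos_pos norm_scaleR zero_less_one)
    also have "\<dots> \<le> norm (flow t w) + norm (t *\<^sub>R ?d)" by (rule norm_triangle_ineq4)
    also have "\<dots> \<le> norm w + t * norm ?d" using norm_flow[of t w] elim by simp
    finally have "t * norm w \<le> t * norm ?d" by (simp add: algebra_simps)
    then show ?case using elim by simp
  qed
  ultimately have "norm w \<le> 0" by (intro tendsto_lowerbound) auto
  then have "f = act (R 1) h" by (simp add: w_def)
  moreover have "a = f - h" by (simp add: h_def)
  ultimately show "p \<in> {(act (R 1) h, act (R 1) h - h) | h. True}" using p by blast
qed (use range_R_subset_gen in auto)

text \<open>A semigroup with this generator commutes with the resolvents, hence with the approximating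
  exponentials, and is therefore also their limit.\<close>

lemma flow_unique:
  assumes Q: "semigroup_C0 Q" and gen: "gen Q = {(act (R 1) h, act (R 1) h - h) | h. True}"
    and t: "t \<ge> 0"
  shows "Q t f = flow t f"
proof -
  have linQ: "linear (Q s)" if "s \<ge> 0" for s
    using semigroup_C0D(1)[OF Q that] by (rule bounded_linear.linear)
  have R1: "Q s (act (R 1) h) = act (R 1) (Q s h)" if s: "s \<ge> 0" for s h
  proof -
    have "(act (R 1) h, act (R 1) h - h) \<in> gen Q" using gen by auto
    then have "((\<lambda>r. Q s ((Q r (act (R 1) h) - act (R 1) h) /\<^sub>R r)) \<longlongrightarrow> Q s (act (R 1) h - h)) (at_right 0)"
      unfolding gen_def by (auto intro: bounded_linear.tendsto[OF semigroup_C0D(1)[OF Q s]])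
    moreover have "\<forall>\<^sub>F r in at_right 0. Q s ((Q r (act (R 1) h) - act (R 1) h) /\<^sub>R r)
        = (Q r (Q s (act (R 1) h)) - Q s (act (R 1) h)) /\<^sub>R r"
      using eventually_at_right_less[of 0]
    proof eventually_elim
      case (elim r)
      then show ?case
        using semigroup_C0D(3)[OF Q s, of r] semigroup_C0D(3)[OF Q, of r s] s
        by (simp add: linear_diff[OF linQ] linear_scale[OF linQ] add.commute)
    qed
    ultimately have "(Q s (act (R 1) h), Q s (act (R 1) h - h)) \<in> gen Q"
      unfolding gen_def by (simp add: tendsto_cong)
    then obtain h' where h': "Q s (act (R 1) h) = act (R 1) h'" "Q s (act (R 1) h - h) = act (R 1) h' - h'"
      using gen by auto
    then have "Q s h = h'" using linear_diff[OF linQ[OF s], of "act (R 1) h" h] by simp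
    then show ?thesis using h'(1) by simp
  qed
  have Rk: "Q s (act (R k) h) = act (R k) (Q s h)" if s: "s \<ge> 0" and k: "k > 0" for s h k
  proof -
    \<comment> \<open>the commutator \<open>d\<close> below satisfies \<open>(k - 1) R 1 d = - d\<close>, which the resolvent identity excludes unless \<open>d = 0\<close>\<close>
    have "act (R 1) (Q s (act (R k) h)) = Q s (act (R 1) (act (R k) h))" by (simp add: R1 s)
    also have "\<dots> = Q s (act (R k) (act (R 1) h))"
      using R_commute[of 1 k] k by (simp flip: act_times)
    finally have *: "act (R 1) (Q s (act (R k) h)) = Q s (act (R k) (act (R 1) h))" .
    have "(k - 1) *\<^sub>R Q s (act (R k) (act (R 1) h)) = act (R 1) (Q s h) - Q s (act (R k) h)"
      using R_times_R1[OF k, of h] linear_diff[OF linQ[OF s]] linear_scale[OF linQ[OF s]] R1[OF s] by metis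
    then have "(k - 1) *\<^sub>R act (R 1) (Q s (act (R k) h)) = act (R 1) (Q s h) - Q s (act (R k) h)"
      by (simp add: *)
    moreover have "(k - 1) *\<^sub>R act (R 1) (act (R k) (Q s h)) = act (R 1) (Q s h) - act (R k) (Q s h)"
      using R_times_R1[OF k, of "Q s h"] R_commute[of 1 k] k by (simp flip: act_times)
    ultimately have e: "(k - 1) *\<^sub>R act (R 1) d = - d" if "d = Q s (act (R k) h) - act (R k) (Q s h)" for d
      using that by (simp add: act.diff_right scaleR_diff_right)
    define d where "d = Q s (act (R k) h) - act (R k) (Q s h)"
    have "(k - 1) *\<^sub>R act (R k) (act (R 1) d) = - act (R k) d"
      using e[OF d_def] by (metis act.scaleR_right act.minus_right)
    then have "act (R 1) d = 0" using R_times_R1[OF k, of d] by simp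
    then have "d = 0" by (rule R_inj)
    then show ?thesis by (simp add: d_def)
  qed
  have comm: "Q s (approx k r g) = approx k r (Q s g)" if srk: "s \<ge> 0" "r \<ge> 0" "k > 0" for s r k g
  proof -
    obtain C where C: "\<And>x. norm (Q s x) \<le> norm x * C" "C > 0"
      using bounded_linear.pos_bounded[OF semigroup_C0D(1)[OF Q srk(1)]] by auto
    obtain B where B: "\<And>x. act B x = Q s x"
      using ex_oper[OF semigroup_C0D(1)[OF Q srk(1)], of C] C by (auto simp: mult.commute)
    have ext: "S = T" if "\<And>x. act S x = act T x" for S T :: "'h oper"
      using that by (metis act_def blinfun_eqI lin_of_inject)
    have "B * R k = R k * B" using Rk srk by (intro ext) (simp add: act_times B)
    then have "(r *\<^sub>R Yosida k) * B = B * (r *\<^sub>R Yosida k)"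
      by (simp add: Yosida_def algebra_simps)
    then have "B * exp (r *\<^sub>R Yosida k) = exp (r *\<^sub>R Yosida k) * B" using exp_commute by metis
    then show ?thesis unfolding approx_def B[symmetric] act_times[symmetric] by simp
  qed
  obtain M where M: "M \<ge> 1" "\<And>s g. s \<in> {0..t} \<Longrightarrow> norm (Q s g) \<le> M * norm g"
    using semigroup_locally_bounded[OF Q, of t] by blast
  have onD: "Q t (act (R 1) h) = flow t (act (R 1) h)" for h
  proof -
    let ?f = "act (R 1) h"
    have "(\<lambda>n. norm (Q t ?f - approx (real (Suc n)) t ?f)) \<longlonglongrightarrow> 0"
    proof (rule tendsto_sandwich[OF _ _ tendsto_const])
      have "(\<lambda>n. t * M\<^sup>2 * norm (?f - h - act (Yosida (real (Suc n))) ?f)) \<longlonglongrightarrow> t * M\<^sup>2 * norm (?f - h - (?f - h))"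
        by (intro tendsto_intros filterlim_compose[OF Yosida_tendsto of_Suc_at_top])
      then show "(\<lambda>n. t * M\<^sup>2 * norm (?f - h - act (Yosida (real (Suc n))) ?f)) \<longlonglongrightarrow> 0" by simp
      show "\<forall>\<^sub>F n in sequentially. norm (Q t ?f - approx (real (Suc n)) t ?f)
          \<le> t * M\<^sup>2 * norm (?f - h - act (Yosida (real (Suc n))) ?f)"
        by (intro always_eventually allI commuting_semigroup_approx[OF Q comm M(2) M(1)]) (use gen t in auto)
    qed auto
    then have "(\<lambda>n. Q t ?f - approx (real (Suc n)) t ?f) \<longlonglongrightarrow> 0"
      by (simp only: tendsto_norm_zero_iff)
    from tendsto_diff[OF tendsto_const this, of "Q t ?f"]
    have "(\<lambda>n. approx (real (Suc n)) t ?f) \<longlonglongrightarrow> Q t ?f" by simp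
    then show ?thesis using approx_convergent[OF t] LIMSEQ_unique by blast
  qed
  have "norm (Q t f - flow t f) \<le> 0"
  proof (rule field_le_epsilon)
    fix e :: real assume e: "e > 0"
    obtain h where h: "norm (f - act (R 1) h) < e / (M + 1)"
      using R_dense[of "e / (M + 1)" f] e M by auto
    let ?g = "f - act (R 1) h"
    have "Q t f - flow t f = Q t ?g - flow t ?g"
      using t by (simp add: linear_diff[OF linQ] linear_diff[OF flow_linear] onD)
    also have "norm \<dots> \<le> M * norm ?g + norm ?g"
      using M(2)[of t ?g] norm_flow[OF t, of ?g] t norm_triangle_ineq4[of "Q t ?g" "flow t ?g"] by simp
    also have "\<dots> = (M + 1) * norm ?g" by (simp add: algebra_simps)
    also have "\<dots> \<le> (M + 1) * (e / (M + 1))" using h M by (intro mult_left_mono) auto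
    finally show "norm (Q t f - flow t f) \<le> 0 + e" using M by simp
  qed
  then show ?thesis by simp
qed

text \<open>The derivative is taken within the interval, so at interior points it is two-sided. For a
  contraction semigroup difference quotients to both sides are controlled by the one at zero.\<close>

lemma flow_has_vector_derivative:
  assumes "a \<in> {0..T}"
  shows "((\<lambda>t. flow t (act (R 1) h)) has_vector_derivative flow a (act (R 1) h - h)) (at a within {0..T})"
proof -
  define f where "f = act (R 1) h"
  define b where "b = f - h"
  define rho where "rho s = norm ((flow s f - f) /\<^sub>R s - b) + norm (flow s b - b)" for s
  have "((\<lambda>s. (flow s f - f) /\<^sub>R s) \<longlongrightarrow> b) (at_right 0)" "((\<lambda>s. flow s b) \<longlongrightarrow> b) (at_right 0)"
    using range_R_subset_gen[of h] semigroup_C0D(4)[OF semigroup_flow, of b]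
    by (auto simp: gen_def f_def b_def)
  then have rho0: "(rho \<longlongrightarrow> 0) (at_right 0)"
    unfolding rho_def[abs_def] by (intro tendsto_add_zero tendsto_norm_zero LIM_zero)
  have bound: "norm (flow y f - flow a f - (y - a) *\<^sub>R flow a b) / norm (y - a) \<le> rho \<bar>y - a\<bar>"
    if y: "y \<ge> 0" "y \<noteq> a" for y
  proof -
    define s where "s = \<bar>y - a\<bar>"
    have s: "s > 0" using y by (simp add: s_def)
    have a: "a \<ge> 0" using assms by simp
    have d: "norm (flow x (flow s f - f - s *\<^sub>R b)) \<le> s * norm ((flow s f - f) /\<^sub>R s - b)" if "x \<ge> 0" for x
    proof -
      have "flow s f - f - s *\<^sub>R b = s *\<^sub>R ((flow s f - f) /\<^sub>R s - b)"
        using s by (simp add: scaleR_diff_right)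
      then show ?thesis using norm_flow[OF that, of "flow s f - f - s *\<^sub>R b"] s by (simp del: scaleR_diff_right)
    qed
    have "norm (flow y f - flow a f - (y - a) *\<^sub>R flow a b) \<le> s * rho s"
    proof (cases "y > a")
      case True
      then have ys: "y = a + s" "y - a = s" by (auto simp: s_def)
      have "flow y f = flow a (flow s f)" unfolding ys(1) using flow_add s a by simp
      then have "flow y f - flow a f - (y - a) *\<^sub>R flow a b = flow a (flow s f - f - s *\<^sub>R b)"
        using s a ys(2) by (simp add: linear_diff[OF flow_linear] linear_scale[OF flow_linear])
      then have "norm (flow y f - flow a f - (y - a) *\<^sub>R flow a b) \<le> s * norm ((flow s f - f) /\<^sub>R s - b)"
        using d[OF a] by simp
      also have "\<dots> \<le> s * rho s" using s by (intro mult_left_mono) (auto simp: rho_def)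
      finally show ?thesis .
    next
      case False
      then have ys: "a = y + s" "y - a = - s" using y by (auto simp: s_def)
      have "flow a f = flow y (flow s f)" "flow a b = flow y (flow s b)" unfolding ys(1) using flow_add s y by simp_all
      then have "flow y f - flow a f - (y - a) *\<^sub>R flow a b
          = s *\<^sub>R flow y (flow s b - b) - flow y (flow s f - f - s *\<^sub>R b)"
        using s y ys(2)
        by (simp add: linear_diff[OF flow_linear] linear_scale[OF flow_linear] scaleR_diff_right)
      then have "norm (flow y f - flow a f - (y - a) *\<^sub>R flow a b)
          \<le> norm (s *\<^sub>R flow y (flow s b - b)) + norm (flow y (flow s f - f - s *\<^sub>R b))"
        by (simp only: norm_triangle_ineq4)
      also have "norm (s *\<^sub>R flow y (flow s b - b)) \<le> s * norm (flow s b - b)"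
        using s norm_flow[OF y(1), of "flow s b - b"] by simp
      finally show ?thesis using d[OF y(1)] by (simp add: rho_def distrib_left)
    qed
    then show ?thesis using s by (simp add: s_def divide_le_eq mult.commute)
  qed
  have "((\<lambda>y. rho \<bar>y - a\<bar>) \<longlongrightarrow> 0) (at a within {0..T})"
  proof (rule filterlim_compose[OF rho0])
    show "filterlim (\<lambda>y. \<bar>y - a\<bar>) (at_right 0) (at a within {0..T})"
      unfolding filterlim_at
      by (auto intro!: tendsto_rabs_zero LIM_zero tendsto_ident_at simp: eventually_at_filter)
  qed
  have "((\<lambda>y. norm (flow y f - flow a f - (y - a) *\<^sub>R flow a b) / norm (y - a)) \<longlongrightarrow> 0) (at a within {0..T})"
  proof (rule tendsto_sandwich[OF _ _ tendsto_const])
    show "((\<lambda>y. rho \<bar>y - a\<bar>) \<longlongrightarrow> 0) (at a within {0..T})" by fact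
  qed (auto simp: eventually_at_filter intro!: always_eventually bound[unfolded real_norm_def])
  then show ?thesis
    unfolding has_vector_derivative_def has_derivative_iff_norm
    by (simp add: f_def b_def bounded_linear_scaleR_left)
qed

end

section \<open>The formal Laplacian, the Dirichlet problem and the energy\<close>

context weighted_graph
begin

definition nbr :: "'a \<Rightarrow> 'a set" where "nbr x = {y. b x y > 0}"

definition deg :: "'a \<Rightarrow> real" where "deg x = (\<Sum>y\<in>nbr x. b x y) / m x"

definition Lap :: "('a \<Rightarrow> real) \<Rightarrow> 'a \<Rightarrow> real" where
  "Lap f x = (\<Sum>y\<in>nbr x. b x y * (f x - f y)) / m x"

lemma finite_nbr: "finite (nbr x)"
  by (simp add: nbr_def locally_finite)

lemma nbr_sym: "y \<in> nbr x \<longleftrightarrow> x \<in> nbr y"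
  by (simp add: nbr_def weight_sym)

lemma not_nbr: "y \<notin> nbr x \<Longrightarrow> b x y = 0"
  using weight_nonneg[of x y] by (simp add: nbr_def)

lemma m_nz: "m x \<noteq> 0" using measure_pos[of x] by simp

lemma m_ge0: "0 \<le> m x" using measure_pos[of x] by simp

lemma deg_nonneg: "deg x \<ge> 0"
  unfolding deg_def using measure_pos[of x] by (intro divide_nonneg_pos sum_nonneg weight_nonneg)

lemma Lap_sum: "finite F \<Longrightarrow> nbr x \<subseteq> F \<Longrightarrow> Lap f x = (\<Sum>y\<in>F. b x y * (f x - f y)) / m x"
  unfolding Lap_def using not_nbr by (auto intro!: sum.mono_neutral_left arg_cong2[of _ _ _ _ "(/)"])

lemma Lap_deg: "Lap f x = deg x * f x - (\<Sum>y\<in>nbr x. b x y * f y) / m x"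
  by (simp add: Lap_def deg_def right_diff_distrib sum_subtractf sum_distrib_right diff_divide_distrib)

lemma Lap_add: "Lap (\<lambda>x. f x + g x) x = Lap f x + Lap g x"
  by (simp add: Lap_def sum.distrib[symmetric] add_divide_distrib[symmetric] algebra_simps)

lemma Lap_diff: "Lap (\<lambda>x. f x - g x) x = Lap f x - Lap g x"
  by (simp add: Lap_def sum_subtractf[symmetric] diff_divide_distrib[symmetric] algebra_simps)

lemma Lap_cmult: "Lap (\<lambda>x. c * f x) x = c * Lap f x"
  by (simp add: Lap_def sum_distrib_left algebra_simps)

lemma Lap_tendsto:
  assumes "\<And>x. ((\<lambda>n. f n x) \<longlongrightarrow> g x) F" shows "((\<lambda>n. Lap (f n) x) \<longlongrightarrow> Lap g x) F"
  unfolding Lap_def using m_nz by (intro tendsto_intros assms)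

lemma Lap_at_min: "(\<And>y. y \<in> nbr x \<Longrightarrow> f x \<le> f y) \<Longrightarrow> Lap f x \<le> 0"
  unfolding Lap_def using measure_pos[of x]
  by (intro divide_nonpos_pos sum_nonpos mult_nonneg_nonpos weight_nonneg) auto

text \<open>At a negative global minimum, attained in \<open>K\<close>, both terms of \<open>Lap w + l w\<close> would be nonpositive,
  the second strictly negative.\<close>

lemma min_principle:
  assumes K: "finite K" and l: "l > 0"
    and sup: "\<And>x. x \<in> K \<Longrightarrow> Lap w x + l * w x \<ge> 0" and bd: "\<And>x. x \<notin> K \<Longrightarrow> w x \<ge> 0"
  shows "w x \<ge> 0"
proof (rule ccontr)
  assume "\<not> ?thesis"
  then have x: "w x < 0" "x \<in> K" using bd[of x] by (auto simp: not_le)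
  obtain z where z: "z \<in> K" "\<And>y. y \<in> K \<Longrightarrow> w z \<le> w y"
    using arg_min_if_finite(1)[OF K, of w] arg_min_least[OF K, of _ w] x(2) by blast
  then have wz: "w z < 0" using x by fastforce
  then have "w z \<le> w y" for y using z(2)[of y] bd[of y] by (cases "y \<in> K") auto
  then have "Lap w z \<le> 0" by (intro Lap_at_min)
  moreover have "l * w z < 0" using wz l by (simp add: mult_pos_neg)
  ultimately show False using sup[OF z(1)] by simp
qed

definition dirichlet_sol :: "'a set \<Rightarrow> real \<Rightarrow> ('a \<Rightarrow> real) \<Rightarrow> ('a \<Rightarrow> real) \<Rightarrow> bool" where
  "dirichlet_sol K l h u \<longleftrightarrow> (\<forall>x. x \<notin> K \<longrightarrow> u x = 0) \<and> (\<forall>x\<in>K. Lap u x + l * u x = h x)"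

lemma dirichlet_unique:
  assumes "finite K" "l > 0" "dirichlet_sol K l h u" "dirichlet_sol K l h w"
  shows "u = w"
proof -
  have "u x - w x \<ge> 0 \<and> w x - u x \<ge> 0" for x
    using assms min_principle[of K l "\<lambda>x. u x - w x" x] min_principle[of K l "\<lambda>x. w x - u x" x]
    by (simp add: dirichlet_sol_def Lap_diff algebra_simps)
  then show ?thesis by (intro ext) (meson eq_iff diff_ge_0_iff_ge)
qed

text \<open>Solving the equation at \<open>x\<close> for \<open>u x\<close> gives a monotone fixed point iteration. Started at zero it
  increases, and it is bounded since for large \<open>H\<close> the constant \<open>H\<close> is mapped below itself.\<close>

lemma dirichlet_exists_nonneg:
  assumes K: "finite K" and l: "l > 0" and h: "\<And>x. x \<in> K \<Longrightarrow> h x \<ge> 0"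
  shows "\<exists>u. dirichlet_sol K l h u"
proof -
  define step where "step u x = (if x \<in> K then (h x + (\<Sum>y\<in>nbr x. b x y * u y) / m x) / (l + deg x) else 0)"
    for u :: "'a \<Rightarrow> real" and x
  define U where "U n = (step ^^ n) (\<lambda>_. 0)" for n
  have pos: "l + deg x > 0" for x using l deg_nonneg[of x] by simp
  have step_mono: "step u x \<le> step w x" if "\<And>y. u y \<le> w y" for u w x
    using that pos[of x] measure_pos[of x] weight_nonneg
    by (auto simp: step_def intro!: divide_right_mono sum_mono mult_left_mono m_ge0 less_imp_le[OF pos])
  define H where "H = (\<Sum>x\<in>K. h x) / l"
  have H: "h x \<le> l * H" if "x \<in> K" for x
    using member_le_sum[of x K h] that h K l by (simp add: H_def)
  have H0: "H \<ge> 0" unfolding H_def using h l by (intro divide_nonneg_pos sum_nonneg)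
  have step_bd: "step (\<lambda>_. H) x \<le> H" for x
  proof (cases "x \<in> K")
    case True
    have "h x + (\<Sum>y\<in>nbr x. b x y * H) / m x \<le> l * H + deg x * H"
      using H[OF True] by (simp add: deg_def sum_distrib_right)
    then show ?thesis using True pos[of x] by (simp add: step_def divide_le_eq algebra_simps)
  qed (simp add: step_def H0)
  have U_le: "U n x \<le> U (Suc n) x" for n x
  proof (induction n arbitrary: x)
    case 0
    then show ?case using h pos[of x] by (simp add: U_def step_def)
  next
    case (Suc n)
    then show ?case using step_mono[of "U n" "U (Suc n)" x] by (simp add: U_def)
  qed
  have U_bd: "U n x \<le> H" for n x
  proof (induction n arbitrary: x)
    case (Suc n)
    then show ?case using step_mono[of "U n" "\<lambda>_. H" x] step_bd[of x] by (simp add: U_def)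
  qed (simp add: U_def H0)
  define u where "u x = lim (\<lambda>n. U n x)" for x
  have lim: "(\<lambda>n. U n x) \<longlonglongrightarrow> u x" for x
  proof -
    have "incseq (\<lambda>n. U n x)" by (rule incseq_SucI) (rule U_le)
    then have "convergent (\<lambda>n. U n x)"
      by (rule incseq_convergent[where B = H]) (auto simp: U_bd convergent_def)
    then show ?thesis unfolding u_def by (simp add: convergent_LIMSEQ_iff)
  qed
  have fix_u: "u x = step u x" for x
  proof (rule LIMSEQ_unique)
    show "(\<lambda>n. U (Suc n) x) \<longlonglongrightarrow> u x" by (rule LIMSEQ_Suc[OF lim])
    have "(\<lambda>n. step (U n) x) \<longlonglongrightarrow> step u x"
      unfolding step_def using pos[of x] m_nz[of x] by (auto intro!: tendsto_intros lim)
    then show "(\<lambda>n. U (Suc n) x) \<longlonglongrightarrow> step u x" by (simp add: U_def)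
  qed
  have "Lap u x + l * u x = h x" if "x \<in> K" for x
  proof -
    have "(l + deg x) * u x = h x + (\<Sum>y\<in>nbr x. b x y * u y) / m x"
      using fix_u[of x] that pos[of x] by (simp add: step_def field_simps)
    then show ?thesis by (simp add: Lap_deg algebra_simps)
  qed
  moreover have "u x = 0" if "x \<notin> K" for x using fix_u[of x] that by (simp add: step_def)
  ultimately show ?thesis by (auto simp: dirichlet_sol_def)
qed

lemma dirichlet_sol_lincomb:
  assumes "dirichlet_sol K l h u" "dirichlet_sol K l k w"
  shows "dirichlet_sol K l (\<lambda>x. c * h x + d * k x) (\<lambda>x. c * u x + d * w x)"
proof -
  have "c * p + d * q + l * (c * r + d * s) = c * (p + l * r) + d * (q + l * s)" for p q r s
    by (simp add: algebra_simps)
  then show ?thesis using assms by (simp add: dirichlet_sol_def Lap_add Lap_cmult)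
qed

text \<open>By linearity, from the positive and the negative part of the right-hand side.\<close>

lemma dirichlet_exists:
  assumes K: "finite K" and l: "l > 0" shows "\<exists>u. dirichlet_sol K l h u"
proof -
  obtain u w where "dirichlet_sol K l (\<lambda>x. max (h x) 0) u" "dirichlet_sol K l (\<lambda>x. max (- h x) 0) w"
    using dirichlet_exists_nonneg[OF K l] by (metis max.cobounded2)
  from dirichlet_sol_lincomb[OF this, of 1 "- 1"]
  have "dirichlet_sol K l (\<lambda>x. max (h x) 0 - max (- h x) 0) (\<lambda>x. u x - w x)" by simp
  moreover have "max (h x) 0 - max (- h x) 0 = h x" for x by simp
  ultimately show ?thesis by auto
qed

definition dir :: "'a set \<Rightarrow> real \<Rightarrow> ('a \<Rightarrow> real) \<Rightarrow> 'a \<Rightarrow> real" where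
  "dir K l h = (THE u. dirichlet_sol K l h u)"

lemma dir_sol: "finite K \<Longrightarrow> l > 0 \<Longrightarrow> dirichlet_sol K l h (dir K l h)"
  unfolding dir_def by (rule theI'[of "dirichlet_sol K l h"], rule ex_ex1I, erule (1) dirichlet_exists, erule (3) dirichlet_unique)

lemma dir_eqI: "finite K \<Longrightarrow> l > 0 \<Longrightarrow> dirichlet_sol K l h u \<Longrightarrow> dir K l h = u"
  by (rule dirichlet_unique[OF _ _ dir_sol])

lemma dir_outside: "finite K \<Longrightarrow> l > 0 \<Longrightarrow> x \<notin> K \<Longrightarrow> dir K l h x = 0"
  and dir_Lap: "finite K \<Longrightarrow> l > 0 \<Longrightarrow> x \<in> K \<Longrightarrow> Lap (dir K l h) x + l * dir K l h x = h x"
  using dir_sol[of K l h] by (auto simp: dirichlet_sol_def)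

lemma dir_lincomb:
  assumes "finite K" "l > 0"
  shows "dir K l (\<lambda>x. c * h x + d * k x) = (\<lambda>x. c * dir K l h x + d * dir K l k x)"
  by (intro dir_eqI dirichlet_sol_lincomb dir_sol assms)

text \<open>The form in which the minimum principle is used: a supersolution that is nonnegative outside of
  \<open>K\<close> dominates the Dirichlet solution.\<close>

lemma dir_compare:
  assumes "finite K" "l > 0" and "\<And>x. x \<in> K \<Longrightarrow> h x \<le> Lap w x + l * w x" "\<And>x. x \<notin> K \<Longrightarrow> w x \<ge> 0"
  shows "dir K l h x \<le> w x"
  using min_principle[of K l "\<lambda>x. w x - dir K l h x" x] assms dir_Lap[OF assms(1,2)] dir_outside[OF assms(1,2)]
  by (simp add: Lap_diff algebra_simps)

lemma dir_nonneg:
  assumes "finite K" "l > 0" "\<And>x. x \<in> K \<Longrightarrow> h x \<ge> 0" shows "dir K l h x \<ge> 0"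
  by (rule min_principle[OF assms(1,2)]) (simp_all add: dir_Lap dir_outside assms)

lemma dir_mono_set:
  assumes "finite K'" "l > 0" "K \<subseteq> K'" "\<And>x. x \<in> K' \<Longrightarrow> h x \<ge> 0"
  shows "dir K l h x \<le> dir K' l h x"
proof (rule dir_compare)
  show "finite K" using assms finite_subset by blast
qed (use assms in \<open>auto simp: dir_Lap dir_nonneg\<close>)

lemma dir_le:
  assumes "finite K" "l > 0" "\<And>x. x \<in> K \<Longrightarrow> h x \<le> c" "c \<ge> 0"
  shows "l * dir K l h x \<le> c"
proof -
  have "dir K l h x \<le> c / l"
    by (rule dir_compare) (use assms in \<open>auto simp: Lap_def\<close>)
  then show ?thesis using assms by (simp add: field_simps)
qed

lemma energy_commute: "energy b f g = energy b g f"
proof -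
  have "(\<lambda>(x, y). b x y * (f x - f y) * (g x - g y)) = (\<lambda>(x, y). b x y * (g x - g y) * (f x - f y))"
    by (auto simp: mult_ac)
  then show ?thesis by (simp only: energy_def)
qed

lemma energy_nonneg: "energy b f f \<ge> 0"
proof -
  have "0 \<le> b x y * (f x - f y) * (f x - f y)" for x y
    using mult_nonneg_nonneg[OF weight_nonneg zero_le_square[of "f x - f y"], of x y] by (simp add: mult.assoc)
  then show ?thesis unfolding energy_def by (intro mult_nonneg_nonneg infsum_nonneg) auto
qed

text \<open>Finite support of \<open>g\<close> confines the nonzero terms of the energy to a finite square, and
  symmetry of \<open>b\<close> folds the sum onto the support of \<open>g\<close>.\<close>

lemma Green_formula:
  assumes "finite S" "\<And>x. x \<notin> S \<Longrightarrow> g x = 0"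
  shows "energy b f g = (\<Sum>x\<in>S. Lap f x * g x * m x)"
proof -
  define V where "V = S \<union> (\<Union>x\<in>S. nbr x)"
  have fV: "finite V" using assms finite_nbr by (auto simp: V_def)
  have SV: "S \<subseteq> V" by (auto simp: V_def)
  let ?e = "\<lambda>x y. b x y * (f x - f y) * (g x - g y)"
  have "(\<Sum>\<^sub>\<infinity>(x, y). ?e x y) = (\<Sum>\<^sub>\<infinity>(x, y)\<in>V \<times> V. ?e x y)"
  proof (rule infsum_cong_neutral)
    fix p assume "p \<in> UNIV - V \<times> V"
    then obtain x y where p: "p = (x, y)" and xy: "x \<notin> V \<or> y \<notin> V" by (cases p) auto
    have "y \<notin> nbr x \<or> (x \<notin> S \<and> y \<notin> S)" using xy nbr_sym by (auto simp: V_def)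
    then show "(case p of (x, y) \<Rightarrow> ?e x y) = 0" using not_nbr assms(2) by (auto simp: p)
  qed auto
  also have "\<dots> = (\<Sum>x\<in>V. \<Sum>y\<in>V. ?e x y)"
    using fV by (simp add: sum.cartesian_product)
  also have "\<dots> = (\<Sum>x\<in>V. \<Sum>y\<in>V. b x y * (f x - f y) * g x) + (\<Sum>x\<in>V. \<Sum>y\<in>V. b y x * (f y - f x) * g y)"
  proof -
    have "?e x y = b x y * (f x - f y) * g x + b y x * (f y - f x) * g y" for x y
      by (simp add: weight_sym[of y x] algebra_simps)
    then show ?thesis by (simp only: sum.distrib)
  qed
  also have "(\<Sum>x\<in>V. \<Sum>y\<in>V. b y x * (f y - f x) * g y) = (\<Sum>x\<in>V. \<Sum>y\<in>V. b x y * (f x - f y) * g x)"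
    by (rule sum.swap)
  also have "(\<Sum>x\<in>V. \<Sum>y\<in>V. b x y * (f x - f y) * g x) = (\<Sum>x\<in>S. \<Sum>y\<in>V. b x y * (f x - f y) * g x)"
    using assms SV fV by (intro sum.mono_neutral_right) auto
  also have "\<dots> = (\<Sum>x\<in>S. Lap f x * g x * m x)"
  proof (rule sum.cong[OF refl])
    fix x assume "x \<in> S"
    then have "Lap f x = (\<Sum>y\<in>V. b x y * (f x - f y)) / m x"
      by (intro Lap_sum fV) (auto simp: V_def)
    then show "(\<Sum>y\<in>V. b x y * (f x - f y) * g x) = Lap f x * g x * m x"
      using m_nz[of x] by (simp flip: sum_distrib_right)
  qed
  finally show ?thesis by (simp add: energy_def)
qed

lemma Cc_diff: "f \<in> Cc \<Longrightarrow> g \<in> Cc \<Longrightarrow> (\<lambda>x. f x - g x) \<in> Cc"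
  unfolding Cc_def by (auto intro: finite_subset[of _ "{x. f x \<noteq> 0} \<union> {x. g x \<noteq> 0}"])

lemma energy_diff_left:
  assumes "h \<in> Cc"
  shows "energy b (\<lambda>x. f x - g x) h = energy b f h - energy b g h"
proof -
  have G: "energy b u h = (\<Sum>x | h x \<noteq> 0. Lap u x * h x * m x)" for u
    by (rule Green_formula) (use assms in \<open>auto simp: Cc_def\<close>)
  show ?thesis by (simp add: G Lap_diff left_diff_distrib sum_subtractf)
qed

lemma energy_cmult_left:
  assumes "h \<in> Cc"
  shows "energy b (\<lambda>x. c * f x) h = c * energy b f h"
proof -
  have G: "energy b u h = (\<Sum>x | h x \<noteq> 0. Lap u x * h x * m x)" for u
    by (rule Green_formula) (use assms in \<open>auto simp: Cc_def\<close>)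
  show ?thesis by (simp add: G Lap_cmult sum_distrib_left mult.assoc)
qed

lemma energy_diff_right: "f \<in> Cc \<Longrightarrow> energy b f (\<lambda>x. g x - h x) = energy b f g - energy b f h"
  using energy_diff_left[of f g h] energy_commute[of f "\<lambda>x. g x - h x"]
    energy_commute[of f g] energy_commute[of f h] by linarith

text \<open>The Cauchy-Schwarz inequality in a form without square roots; \<open>c\<close> is free to be optimised.\<close>

lemma energy_bound:
  assumes f: "f \<in> Cc" and g: "g \<in> Cc" and c: "c > 0"
  shows "2 * \<bar>energy b f g\<bar> \<le> c * energy b f f + energy b g g / c"
proof -
  have *: "0 \<le> k * k * energy b f f - 2 * k * energy b f g + energy b g g" for k
  proof -
    let ?kf = "\<lambda>x. k * f x"
    have kf: "?kf \<in> Cc" using f unfolding Cc_def by (auto elim: rev_finite_subset)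
    have "0 \<le> energy b (\<lambda>x. ?kf x - g x) (\<lambda>x. ?kf x - g x)" by (rule energy_nonneg)
    also have "\<dots> = energy b ?kf (\<lambda>x. ?kf x - g x) - energy b g (\<lambda>x. ?kf x - g x)"
      by (rule energy_diff_left[OF Cc_diff[OF kf g]])
    also have "\<dots> = energy b ?kf ?kf - energy b ?kf g - (energy b g ?kf - energy b g g)"
      by (simp only: energy_diff_right[OF kf] energy_diff_right[OF g])
    also have "energy b ?kf g = k * energy b f g" by (rule energy_cmult_left[OF g])
    also have "energy b g ?kf = k * energy b f g" 
      by (rule trans[OF energy_commute trans[OF energy_cmult_left[OF g]]]) (rule refl)
    also have "energy b ?kf ?kf = k * (k * energy b f f)"
      by (simp only: energy_cmult_left[OF kf] energy_commute[of f ?kf] energy_cmult_left[OF f])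
    finally show ?thesis by (simp add: algebra_simps)
  qed
  have "2 * energy b f g \<le> c * energy b f f + energy b g g / c"
    using *[of c] c by (simp add: field_simps)
  moreover have "- (2 * energy b f g) \<le> c * energy b f f + energy b g g / c"
    using *[of "- c"] c by (simp add: field_simps)
  ultimately show ?thesis by linarith
qed

end

section \<open>The resolvent as a limit over balls\<close>

context weighted_graph
begin

text \<open>\<open>emb\<close> and \<open>val\<close> are the isometry between \<open>l2 m\<close> and the unweighted space and its inverse.\<close>

definition emb :: "('a \<Rightarrow> real) \<Rightarrow> 'a ell2" where "emb f = Abs_ell2 (\<lambda>x. f x * sqrt (m x))"

definition val :: "'a ell2 \<Rightarrow> 'a \<Rightarrow> real" where "val u x = coord u x / sqrt (m x)"

lemma sqrt_m: "sqrt (m x) > 0" "sqrt (m x) * sqrt (m x) = m x"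
  using measure_pos[of x] by auto

lemma l2_iff: "f \<in> l2 m \<longleftrightarrow> (\<lambda>x. (f x * sqrt (m x))\<^sup>2) summable_on UNIV"
  using m_ge0 by (simp add: l2_def power_mult_distrib)

lemma coord_emb: "f \<in> l2 m \<Longrightarrow> coord (emb f) x = f x * sqrt (m x)"
  unfolding emb_def by (subst coord_Abs) (simp_all add: l2_iff)

lemma val_emb: "f \<in> l2 m \<Longrightarrow> val (emb f) = f"
  by (rule ext) (simp add: val_def coord_emb m_nz)

lemma coord_val: "coord u x = val u x * sqrt (m x)"
  using sqrt_m(1)[of x] by (simp add: val_def)

lemma val_l2: "val u \<in> l2 m"
  using coord_summable[of u] by (simp add: l2_iff coord_val)

lemma emb_val: "emb (val u) = u"
  by (rule ell2_eqI) (simp add: coord_val val_emb val_l2)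

lemma val_simps [simp]:
  "val (u + w) x = val u x + val w x" "val (u - w) x = val u x - val w x"
  "val (c *\<^sub>R u) x = c * val u x" "val 0 x = 0" "val (- u) x = - val u x"
  by (simp_all add: val_def add_divide_distrib diff_divide_distrib)

lemma bounded_linear_val: "bounded_linear (\<lambda>u. val u x)"
  unfolding val_def using bounded_linear_coord by (rule bounded_linear_compose[OF bounded_linear_divide])

lemmas tendsto_val = bounded_linear.tendsto[OF bounded_linear_val]

lemma inner_val: "inner u w = l2_inner m (val u) (val w)"
proof -
  have "coord u x * coord w x = val u x * val w x * m x" for x
    unfolding coord_val using sqrt_m(2)[of x] by (metis mult.assoc mult.left_commute)
  then show ?thesis by (simp add: inner_ell2_def l2_inner_def)
qed

lemma norm_val: "norm u = l2_norm m (val u)"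
  by (simp add: norm_eq_sqrt_inner inner_val l2_norm_def)

lemma l2_lincomb:
  assumes "f \<in> l2 m" "g \<in> l2 m"
  shows "(\<lambda>x. c * f x + d * g x) \<in> l2 m" "emb (\<lambda>x. c * f x + d * g x) = c *\<^sub>R emb f + d *\<^sub>R emb g"
proof -
  have "val (c *\<^sub>R emb f + d *\<^sub>R emb g) = (\<lambda>x. c * f x + d * g x)"
    by (rule ext) (simp add: val_emb assms)
  then show "(\<lambda>x. c * f x + d * g x) \<in> l2 m" "emb (\<lambda>x. c * f x + d * g x) = c *\<^sub>R emb f + d *\<^sub>R emb g"
    using val_l2[of "c *\<^sub>R emb f + d *\<^sub>R emb g"] emb_val[of "c *\<^sub>R emb f + d *\<^sub>R emb g"] by simp_all
qed

lemma l2_diff: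
  assumes "f \<in> l2 m" "g \<in> l2 m"
  shows "(\<lambda>x. f x - g x) \<in> l2 m" "emb (\<lambda>x. f x - g x) = emb f - emb g"
  using l2_lincomb[OF assms, of 1 "- 1"] by simp_all

lemma l2_norm_emb: "f \<in> l2 m \<Longrightarrow> l2_norm m f = norm (emb f)"
  by (simp add: norm_val val_emb)

lemma Cc_l2: "f \<in> Cc \<Longrightarrow> f \<in> l2 m"
  unfolding l2_iff Cc_def using m_nz
  by (intro square_summable_finite_support) (auto elim: rev_finite_subset)

lemma inner_emb_finite:
  assumes "finite S" "\<And>x. x \<notin> S \<Longrightarrow> g x = 0"
  shows "inner u (emb g) = (\<Sum>x\<in>S. val u x * g x * m x)"
proof -
  have "g \<in> Cc" using assms unfolding Cc_def by (auto intro: finite_subset[of _ S])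
  then have "inner u (emb g) = l2_inner m (val u) g" by (simp add: inner_val val_emb Cc_l2)
  also have "\<dots> = (\<Sum>\<^sub>\<infinity>x\<in>S. val u x * g x * m x)"
    unfolding l2_inner_def by (rule infsum_cong_neutral) (use assms in auto)
  finally show ?thesis using assms by simp
qed

definition Dir :: "'a set \<Rightarrow> real \<Rightarrow> 'a ell2 \<Rightarrow> 'a ell2" where
  "Dir K l u = emb (dir K l (val u))"

lemma dir_Cc:
  assumes "finite K" "l > 0" shows "dir K l h \<in> Cc"
proof -
  have "{x. dir K l h x \<noteq> 0} \<subseteq> K" using dir_outside[OF assms] by blast
  then show ?thesis using assms(1) finite_subset by (auto simp: Cc_def)
qed

lemma val_Dir: "finite K \<Longrightarrow> l > 0 \<Longrightarrow> val (Dir K l u) = dir K l (val u)"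
  by (simp add: Dir_def val_emb dir_Cc Cc_l2)

lemma Dir_weak:
  assumes K: "finite K" and l: "l > 0" and g: "\<And>x. x \<notin> K \<Longrightarrow> g x = 0"
  shows "energy b (dir K l (val u)) g + l * inner (Dir K l u) (emb g) = inner u (emb g)"
proof -
  have "Lap (dir K l (val u)) x * g x * m x + l * (dir K l (val u) x * g x * m x) = val u x * g x * m x"
    if "x \<in> K" for x
    unfolding dir_Lap[OF K l that, of "val u", symmetric] by (simp add: algebra_simps)
  then show ?thesis
    by (simp add: Green_formula[OF K g] inner_emb_finite[OF K g] val_Dir[OF K l] sum_distrib_left flip: sum.distrib)
qed

lemma Dir_weak_Dir:
  assumes K: "finite K'" and l: "l > 0" and s: "K \<subseteq> K'"
  shows "energy b (dir K' l (val u)) (dir K l (val w)) + l * inner (Dir K' l u) (Dir K l w) = inner u (Dir K l w)"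
proof -
  have K': "finite K" using K s finite_subset by blast
  show ?thesis
    unfolding Dir_def[of K] by (rule Dir_weak[OF K l]) (use s dir_outside[OF K' l] in auto)
qed

lemma norm_Dir:
  assumes "finite K" "l > 0" shows "norm (Dir K l u) \<le> norm u / l"
proof -
  have "l * (norm (Dir K l u))\<^sup>2 \<le> inner u (Dir K l u)"
    using Dir_weak_Dir[OF assms order_refl, of u u] energy_nonneg[of "dir K l (val u)"]
    by (simp add: power2_norm_eq_inner)
  also have "\<dots> \<le> norm u * norm (Dir K l u)" by (rule norm_cauchy_schwarz)
  finally have "(l * norm (Dir K l u)) * norm (Dir K l u) \<le> norm u * norm (Dir K l u)"
    by (simp add: power2_eq_square mult.assoc)
  then have "l * norm (Dir K l u) \<le> norm u"
    by (cases "Dir K l u = 0") auto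
  then show ?thesis using assms by (simp add: field_simps)
qed

lemma Dir_sym:
  assumes "finite K" "l > 0" shows "inner (Dir K l u) w = inner u (Dir K l w)"
  using Dir_weak_Dir[OF assms order_refl, of u w] Dir_weak_Dir[OF assms order_refl, of w u]
  by (simp add: energy_commute[of "dir K l (val w)"] inner_commute)

lemma Dir_lincomb:
  assumes "finite K" "l > 0"
  shows "Dir K l (c *\<^sub>R u + d *\<^sub>R w) = c *\<^sub>R Dir K l u + d *\<^sub>R Dir K l w"
proof -
  have "val (c *\<^sub>R u + d *\<^sub>R w) = (\<lambda>x. c * val u x + d * val w x)" by (rule ext) simp
  then show ?thesis
    unfolding Dir_def by (simp add: dir_lincomb[OF assms] l2_lincomb Cc_l2 dir_Cc[OF assms])
qed

lemma Dir_linear: "finite K \<Longrightarrow> l > 0 \<Longrightarrow> linear (Dir K l)"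
  using Dir_lincomb[of K l 1 _ 1] Dir_lincomb[of K l _ _ 0 0] by (intro linearI) auto

text \<open>The solution on the smaller set is the projection of the one on the larger set, with respect to
  energy plus \<open>l\<close> times mass. Hence the form norm of an increment telescopes, which is why
  Dirichlet solutions along an exhaustion are Cauchy in this norm.\<close>

lemma Dir_increment:
  fixes u :: "'a ell2"
  assumes K: "finite K'" and l: "l > 0" and s: "K \<subseteq> K'"
  defines "f \<equiv> \<lambda>x. dir K' l (val u) x - dir K l (val u) x"
  shows "energy b f f + l * (norm (Dir K' l u - Dir K l u))\<^sup>2 = inner u (Dir K' l u) - inner u (Dir K l u)"
proof -
  have K': "finite K" using K s finite_subset by blast
  let ?p = "dir K' l (val u)" and ?q = "dir K l (val u)"
  note C = dir_Cc[OF K l, of "val u"] dir_Cc[OF K' l, of "val u"]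
  have "energy b f f = energy b ?p ?p - energy b ?p ?q - (energy b ?q ?p - energy b ?q ?q)"
    unfolding f_def energy_diff_left[OF Cc_diff[OF C]]
    by (simp only: energy_diff_right[OF C(1)] energy_diff_right[OF C(2)])
  moreover have n: "(norm (Dir K' l u - Dir K l u))\<^sup>2 = inner (Dir K' l u) (Dir K' l u)
      - 2 * inner (Dir K' l u) (Dir K l u) + inner (Dir K l u) (Dir K l u)"
    by (simp add: power2_norm_eq_inner inner_diff inner_commute)
  moreover note Dir_weak_Dir[OF K l order_refl, of u u] Dir_weak_Dir[OF K l s, of u u]
    Dir_weak_Dir[OF K' l order_refl, of u u] energy_commute[of ?p ?q]
  ultimately show ?thesis unfolding n by (simp add: algebra_simps)
qed

lemma dir_resolvent:
  assumes "finite K" "j > 0" "k > 0"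
  shows "dir K j h x - dir K k h x = (k - j) * dir K j (dir K k h) x"
proof -
  let ?a = "dir K k h"
  let ?c = "dir K j ?a"
  have "Lap ?a x = h x - k * ?a x" "Lap ?c x = ?a x - j * ?c x" if "x \<in> K" for x
    using dir_Lap[OF assms(1,3) that, of h] dir_Lap[OF assms(1,2) that, of ?a] by linarith+
  then have "dirichlet_sol K j h (\<lambda>x. ?a x + (k - j) * ?c x)"
    using assms by (simp add: dirichlet_sol_def dir_outside Lap_add Lap_cmult) (simp add: algebra_simps)
  then show ?thesis using dir_eqI[OF assms(1,2)] by simp
qed

end

text \<open>The root only serves to exhaust the graph by balls and to place a source; the
  Feller property does not depend on it, so it can be chosen to suit the curvatures.\<close>

locale rooted_graph = weighted_graph b m for b :: "'a \<Rightarrow> 'a \<Rightarrow> real" and m :: "'a \<Rightarrow> real" +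
  fixes rt :: 'a
  assumes conn: "connected_graph b"
begin

abbreviation "d x \<equiv> graph_dist b x rt"

lemma path_to_root: "(x, rt) \<in> adj b ^^ d x"
proof -
  have "(x, rt) \<in> (adj b)\<^sup>*" using conn by (simp add: connected_graph_def)
  then obtain n where "(x, rt) \<in> adj b ^^ n" using rtrancl_power by blast
  then show ?thesis unfolding graph_dist_def by (rule LeastI)
qed

lemma d_le: "(x, rt) \<in> adj b ^^ n \<Longrightarrow> d x \<le> n"
  unfolding graph_dist_def by (rule Least_le)

lemma d_root [simp]: "d rt = 0"
  using d_le[of rt 0] by simp

lemma d_eq_0: "d x = 0 \<Longrightarrow> x = rt"
  using path_to_root[of x] by simp

lemma d_nbr: "y \<in> nbr x \<Longrightarrow> d x \<le> Suc (d y)"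
  using relpow_Suc_I2[of x y "adj b", OF _ path_to_root[of y]] d_le[of x]
  by (simp add: nbr_def adj_def)

lemma d_nbr': "y \<in> nbr x \<Longrightarrow> d y \<le> Suc (d x)"
  using d_nbr nbr_sym by blast

lemma predecessor: "d x = Suc n \<Longrightarrow> \<exists>y\<in>nbr x. d y = n"
proof -
  assume x: "d x = Suc n"
  then have "(x, rt) \<in> adj b ^^ Suc n" using path_to_root[of x] by simp
  then obtain y where y: "(x, y) \<in> adj b" "(y, rt) \<in> adj b ^^ n" by (meson relpow_Suc_D2)
  then have "y \<in> nbr x" by (simp add: nbr_def adj_def)
  moreover have "d y = n" using d_le[OF y(2)] d_nbr[OF \<open>y \<in> nbr x\<close>] x by simp
  ultimately show ?thesis by blast
qed

definition bal :: "nat \<Rightarrow> 'a set" where "bal n = {x. d x \<le> n}"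

lemma finite_bal [simp]: "finite (bal n)"
proof (induction n)
  case 0
  have "bal 0 \<subseteq> {rt}" using d_eq_0 by (auto simp: bal_def)
  then show ?case using finite_subset by blast
next
  case (Suc n)
  have "bal (Suc n) \<subseteq> bal n \<union> (\<Union>x\<in>bal n. nbr x)"
  proof
    fix x assume x: "x \<in> bal (Suc n)"
    show "x \<in> bal n \<union> (\<Union>x\<in>bal n. nbr x)"
    proof (cases "d x \<le> n")
      case False
      then have "d x = Suc n" using x by (simp add: bal_def)
      then obtain y where "y \<in> nbr x" "d y = n" using predecessor by blast
      then show ?thesis using nbr_sym by (auto simp: bal_def)
    qed (simp add: bal_def)
  qed
  then show ?case using Suc finite_nbr by (meson finite_UN finite_UnI finite_subset)
qed

lemma bal_mono: "n \<le> k \<Longrightarrow> bal n \<subseteq> bal k"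
  by (auto simp: bal_def)

lemma finite_subset_bal:
  assumes "finite F" shows "\<exists>n. \<forall>k\<ge>n. F \<subseteq> bal k"
proof -
  have "F \<subseteq> bal (Max (insert 0 (d ` F)))"
    using assms by (auto simp: bal_def intro!: Max_ge)
  then show ?thesis using bal_mono by blast
qed

text \<open>The inner products of \<open>u\<close> with the Dirichlet solutions increase and are bounded, so the increments in
  \<open>Dir_increment\<close> are small. The two conclusions are convergence in the Hilbert space and the Cauchy
  condition in the definition of the closed form.\<close>

lemma Dir_Cauchy:
  assumes l: "l > 0"
  shows "Cauchy (\<lambda>n. Dir (bal n) l u)"
    and "\<forall>e>0. \<exists>N. \<forall>k\<ge>N. \<forall>n\<ge>N. energy b (\<lambda>x. dir (bal k) l (val u) x - dir (bal n) l (val u) x)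
           (\<lambda>x. dir (bal k) l (val u) x - dir (bal n) l (val u) x) < e"
proof -
  let ?a = "\<lambda>n. inner u (Dir (bal n) l u)"
  let ?f = "\<lambda>k n x. dir (bal k) l (val u) x - dir (bal n) l (val u) x"
  have ord: "energy b (?f k n) (?f k n) + l * (norm (Dir (bal k) l u - Dir (bal n) l u))\<^sup>2 = ?a k - ?a n"
    if "n \<le> k" for k n
    by (rule Dir_increment[OF finite_bal l bal_mono[OF that]])
  have nn: "0 \<le> energy b (?f k n) (?f k n) + l * (norm (Dir (bal k) l u - Dir (bal n) l u))\<^sup>2" for k n
    using energy_nonneg l by (intro add_nonneg_nonneg) auto
  have inc: "energy b (?f k n) (?f k n) + l * (norm (Dir (bal k) l u - Dir (bal n) l u))\<^sup>2 = \<bar>?a k - ?a n\<bar>" for k n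
  proof (cases "n \<le> k")
    case True
    then show ?thesis using ord[OF True] nn[of k n] by simp
  next
    case False
    have "energy b (?f k n) (?f k n) = energy b (?f n k) (?f n k)"
      unfolding energy_def by (intro arg_cong2[of _ _ _ _ "(*)"] infsum_cong refl) (auto simp: algebra_simps)
    then show ?thesis using ord[of k n] nn[of n k] False by (simp add: norm_minus_commute)
  qed
  have "incseq ?a"
    unfolding incseq_def
  proof (intro allI impI)
    fix n k :: nat assume "n \<le> k"
    from ord[OF this] nn[of k n] show "?a n \<le> ?a k" by linarith
  qed
  moreover have "\<forall>n. ?a n \<le> norm u * (norm u / l)"
    by (rule allI, rule order_trans[OF norm_cauchy_schwarz]) (intro mult_left_mono norm_Dir finite_bal l, simp)
  ultimately obtain L where "?a \<longlonglongrightarrow> L" using incseq_convergent[of ?a] by blast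
  then have "convergent ?a" by (rule convergentI)
  then have C: "Cauchy ?a" by (rule convergent_Cauchy)
  show "\<forall>e>0. \<exists>N. \<forall>k\<ge>N. \<forall>n\<ge>N. energy b (?f k n) (?f k n) < e"
  proof (intro allI impI)
    fix e :: real assume "e > 0"
    then obtain N where N: "\<And>k n. k \<ge> N \<Longrightarrow> n \<ge> N \<Longrightarrow> \<bar>?a k - ?a n\<bar> < e"
      using C unfolding Cauchy_iff real_norm_def by blast
    have "energy b (?f k n) (?f k n) < e" if "k \<ge> N" "n \<ge> N" for k n
    proof -
      have "0 \<le> l * (norm (Dir (bal k) l u - Dir (bal n) l u))\<^sup>2" using l by simp
      then show ?thesis using N[OF that] inc[of k n] by linarith
    qed
    then show "\<exists>N. \<forall>k\<ge>N. \<forall>n\<ge>N. energy b (?f k n) (?f k n) < e" by blast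
  qed
  show "Cauchy (\<lambda>n. Dir (bal n) l u)"
    unfolding Cauchy_iff
  proof (intro allI impI)
    fix e :: real assume e: "e > 0"
    then have "l * e\<^sup>2 > 0" using l by simp
    then obtain N where N: "\<And>k n. k \<ge> N \<Longrightarrow> n \<ge> N \<Longrightarrow> \<bar>?a k - ?a n\<bar> < l * e\<^sup>2"
      using C unfolding Cauchy_iff real_norm_def by blast
    have "norm (Dir (bal k) l u - Dir (bal n) l u) < e" if "k \<ge> N" "n \<ge> N" for k n
    proof -
      have "l * (norm (Dir (bal k) l u - Dir (bal n) l u))\<^sup>2 < l * e\<^sup>2"
        using N[OF that] inc[of k n] energy_nonneg[of "?f k n"] by linarith
      then show ?thesis using l e by (simp add: power_less_imp_less_base)
    qed
    then show "\<exists>N. \<forall>k\<ge>N. \<forall>n\<ge>N. norm (Dir (bal k) l u - Dir (bal n) l u) < e" by blast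
  qed
qed

text \<open>The choice only bundles the pointwise limit as a bounded operator.\<close>

definition Res :: "real \<Rightarrow> 'a ell2 oper" where
  "Res l = (SOME T. (\<forall>u. act T u = lim (\<lambda>n. Dir (bal n) l u)) \<and> norm T \<le> 1 / l)"

lemma Dir_lim: "l > 0 \<Longrightarrow> (\<lambda>n. Dir (bal n) l u) \<longlonglongrightarrow> lim (\<lambda>n. Dir (bal n) l u)"
  using Cauchy_convergent[OF Dir_Cauchy(1)] by (simp add: convergent_LIMSEQ_iff)

lemma Res_exists:
  assumes l: "l > 0"
  shows "(\<forall>u. act (Res l) u = lim (\<lambda>n. Dir (bal n) l u)) \<and> norm (Res l) \<le> 1 / l"
  unfolding Res_def
proof (rule someI_ex, rule ex_oper)
  let ?F = "\<lambda>u. lim (\<lambda>n. Dir (bal n) l u)"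
  show bd: "norm (?F u) \<le> 1 / l * norm u" for u
    by (rule Lim_bounded[OF tendsto_norm[OF Dir_lim[OF l]], of 0]) (use norm_Dir[OF finite_bal l] in auto)
  show "0 \<le> 1 / l" using l by simp
  show "bounded_linear ?F"
  proof (rule bounded_linear_intro[of _ "1 / l"])
    show "?F (u + w) = ?F u + ?F w" for u w
      by (rule LIMSEQ_unique[OF Dir_lim[OF l]])
         (simp only: linear_add[OF Dir_linear[OF finite_bal l]], intro tendsto_add Dir_lim l)
    show "?F (c *\<^sub>R u) = c *\<^sub>R ?F u" for c u
      by (rule LIMSEQ_unique[OF Dir_lim[OF l]])
         (simp only: linear_scale[OF Dir_linear[OF finite_bal l]], intro tendsto_scaleR tendsto_const Dir_lim l)
  qed (use bd in \<open>simp add: mult.commute\<close>)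
qed

lemma Res_lim: "l > 0 \<Longrightarrow> (\<lambda>n. Dir (bal n) l u) \<longlonglongrightarrow> act (Res l) u"
  using Res_exists Dir_lim by simp

lemma val_Res_lim: "l > 0 \<Longrightarrow> (\<lambda>n. dir (bal n) l (val u) x) \<longlonglongrightarrow> val (act (Res l) u) x"
  using tendsto_val[OF Res_lim, of l u x] by (simp add: val_Dir)

lemma Res_Lap:
  assumes l: "l > 0" shows "Lap (val (act (Res l) u)) x + l * val (act (Res l) u) x = val u x"
proof (rule LIMSEQ_unique)
  show "(\<lambda>n. Lap (dir (bal n) l (val u)) x + l * dir (bal n) l (val u) x)
      \<longlonglongrightarrow> Lap (val (act (Res l) u)) x + l * val (act (Res l) u) x"
    by (intro tendsto_intros Lap_tendsto val_Res_lim l)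
  have "\<forall>\<^sub>F n in sequentially. val u x = Lap (dir (bal n) l (val u)) x + l * dir (bal n) l (val u) x"
    using eventually_ge_at_top[of "d x"]
    by eventually_elim (simp add: dir_Lap l bal_def finite_bal[unfolded bal_def])
  then show "(\<lambda>n. Lap (dir (bal n) l (val u)) x + l * dir (bal n) l (val u) x) \<longlonglongrightarrow> val u x"
    by (rule tendsto_eventually[OF eventually_mono]) simp
qed

lemma Res_sym: "l > 0 \<Longrightarrow> inner (act (Res l) u) w = inner u (act (Res l) w)"
  by (rule LIMSEQ_unique[of "\<lambda>n. inner (Dir (bal n) l u) w"], intro tendsto_intros Res_lim, assumption)
     (simp only: Dir_sym[OF finite_bal], intro tendsto_intros Res_lim)

text \<open>Finitely supported functions are in the range of the resolvent: on balls that contain the support,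
  \<open>g\<close> itself solves the Dirichlet problem. This makes the range dense.\<close>

lemma Res_Cc:
  assumes g: "g \<in> Cc" and l: "l > 0"
  shows "emb g = act (Res l) (emb (\<lambda>x. Lap g x + l * g x))"
proof (rule LIMSEQ_unique[OF _ Res_lim[OF l]])
  define h where "h x = Lap g x + l * g x" for x
  define F where "F = {x. g x \<noteq> 0}"
  have F: "finite F" using g by (simp add: F_def Cc_def)
  have "h x = 0" if "x \<notin> F \<union> (\<Union>x\<in>F. nbr x)" for x
  proof -
    have "g x = 0" "\<And>y. y \<in> nbr x \<Longrightarrow> g y = 0" using that nbr_sym by (auto simp: F_def)
    then show ?thesis by (simp add: h_def Lap_def)
  qed
  then have "{x. h x \<noteq> 0} \<subseteq> F \<union> (\<Union>x\<in>F. nbr x)" by blast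
  then have h: "h \<in> Cc" unfolding Cc_def using F finite_nbr by (auto intro: finite_subset)
  obtain N where N: "\<And>k. k \<ge> N \<Longrightarrow> F \<subseteq> bal k" using finite_subset_bal[OF F] by blast
  have "Dir (bal k) l (emb h) = emb g" if "k \<ge> N" for k
  proof -
    have "dir (bal k) l h = g"
      by (rule dir_eqI[OF finite_bal l]) (use N[OF that] in \<open>auto simp: dirichlet_sol_def h_def F_def\<close>)
    then show ?thesis by (simp add: Dir_def val_emb Cc_l2 h)
  qed
  then have "\<forall>\<^sub>F k in sequentially. Dir (bal k) l (emb h) = emb g"
    unfolding eventually_sequentially by blast
  then show "(\<lambda>n. Dir (bal n) l (emb (\<lambda>x. Lap g x + l * g x))) \<longlonglongrightarrow> emb g"
    by (simp add: tendsto_eventually flip: h_def)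
qed

sublocale resolvent_family Res
proof
  show "norm (Res k) \<le> 1 / k" if "k > 0" for k using Res_exists[OF that] by simp
  show "h = 0" if "act (Res 1) h = 0" for h
  proof (rule ell2_eqI)
    fix x
    have "val h x = 0" using Res_Lap[of 1 h x] that by (simp add: Lap_def)
    then show "coord h x = coord 0 x" by (simp add: coord_val)
  qed
  show "\<exists>h. norm (f - act (Res 1) h) < e" if e: "e > 0" for e f
  proof -
    obtain w where w: "finite {x. coord w x \<noteq> 0}" "norm (f - w) < e"
      using finite_support_dense[OF e] by blast
    have "{x. val w x \<noteq> 0} = {x. coord w x \<noteq> 0}" using sqrt_m(1) by (auto simp: val_def) (metis less_irrefl)
    then have "val w \<in> Cc" using w by (simp add: Cc_def)
    from Res_Cc[OF this, of 1] have "w = act (Res 1) (emb (\<lambda>x. Lap (val w) x + 1 * val w x))"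
      by (simp add: emb_val)
    with w(2) show ?thesis by metis
  qed
  show "Res j - Res k = (k - j) *\<^sub>R (Res j * Res k)" if j: "j > 0" and k: "k > 0" for j k
  proof -
    have "act (Res j) u - act (Res k) u = (k - j) *\<^sub>R act (Res j) (act (Res k) u)" for u
    proof (rule LIMSEQ_unique)
      show "(\<lambda>n. Dir (bal n) j u - Dir (bal n) k u) \<longlonglongrightarrow> act (Res j) u - act (Res k) u"
        by (intro tendsto_intros Res_lim j k)
      have fin: "Dir (bal n) j u - Dir (bal n) k u = (k - j) *\<^sub>R Dir (bal n) j (Dir (bal n) k u)" for n
      proof (rule ell2_eqI)
        fix x
        show "coord (Dir (bal n) j u - Dir (bal n) k u) x = coord ((k - j) *\<^sub>R Dir (bal n) j (Dir (bal n) k u)) x"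
          unfolding coord_val using dir_resolvent[OF finite_bal[of n] j k, of "val u" x] by (simp add: val_Dir j k)
      qed
      have "(\<lambda>n. Dir (bal n) j (Dir (bal n) k u - act (Res k) u)) \<longlonglongrightarrow> 0"
      proof (rule tendsto_norm_zero_cancel, rule tendsto_sandwich[OF _ _ tendsto_const])
        have "(\<lambda>n. norm (Dir (bal n) k u - act (Res k) u) / j) \<longlonglongrightarrow> 0 / j"
          using j by (intro tendsto_divide tendsto_norm_zero LIM_zero Res_lim k tendsto_const) auto
        then show "(\<lambda>n. norm (Dir (bal n) k u - act (Res k) u) / j) \<longlonglongrightarrow> 0" by simp
      qed (use norm_Dir[OF finite_bal j] in auto)
      then have "(\<lambda>n. (k - j) *\<^sub>R (Dir (bal n) j (Dir (bal n) k u - act (Res k) u) + Dir (bal n) j (act (Res k) u)))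
          \<longlonglongrightarrow> (k - j) *\<^sub>R (0 + act (Res j) (act (Res k) u))"
        by (intro tendsto_intros Res_lim j)
      then show "(\<lambda>n. Dir (bal n) j u - Dir (bal n) k u) \<longlonglongrightarrow> (k - j) *\<^sub>R act (Res j) (act (Res k) u)"
        by (simp add: fin linear_diff[OF Dir_linear[OF finite_bal j]])
    qed
    then have "act (Res j - Res k) u = act ((k - j) *\<^sub>R (Res j * Res k)) u" for u
      by (simp add: act.diff_left act.scaleR_left act_times)
    then show ?thesis by (metis act_def blinfun_eqI lin_of_inject)
  qed
qed

lemma Res_nonneg:
  assumes "l > 0" "\<And>x. val u x \<ge> 0" shows "val (act (Res l) u) x \<ge> 0"
  by (rule LIMSEQ_le_const[OF val_Res_lim[OF assms(1)]]) (use dir_nonneg[OF finite_bal assms(1)] assms in auto)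

lemma dir_le_Res:
  assumes "l > 0" "\<And>x. val u x \<ge> 0" shows "dir (bal n) l (val u) x \<le> val (act (Res l) u) x"
  by (rule incseq_le[OF incseq_SucI val_Res_lim[OF assms(1)]])
     (rule dir_mono_set, use assms bal_mono in auto)

lemma Res_le:
  assumes "l > 0" "\<And>n. dir (bal n) l (val u) x \<le> c" shows "val (act (Res l) u) x \<le> c"
  by (rule LIMSEQ_le_const2[OF val_Res_lim[OF assms(1)]]) (use assms in auto)

end

section \<open>The closed form and the heat semigroup\<close>

context rooted_graph
begin

lemma form_approx_Res:
  assumes l: "l > 0"
  shows "form_approx b m (\<lambda>n. dir (bal n) l (val u)) (val (act (Res l) u))"
proof -
  have "l2_norm m (\<lambda>x. dir (bal n) l (val u) x - val (act (Res l) u) x) = norm (Dir (bal n) l u - act (Res l) u)" for n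
    unfolding Dir_def using l2_diff[OF Cc_l2[OF dir_Cc[OF finite_bal[of n] l, of "val u"]] val_l2[of "act (Res l) u"]]
    by (simp add: l2_norm_emb emb_val)
  moreover have "(\<lambda>n. norm (Dir (bal n) l u - act (Res l) u)) \<longlonglongrightarrow> 0"
    by (intro tendsto_norm_zero LIM_zero Res_lim l)
  ultimately show ?thesis
    unfolding form_approx_def using dir_Cc[OF finite_bal l] Dir_Cauchy(2)[OF l, of u] by simp
qed

lemma form_approx_tendsto:
  assumes "form_approx b m \<phi> f" "f \<in> l2 m"
  shows "(\<lambda>n. emb (\<phi> n)) \<longlonglongrightarrow> emb f" "(\<lambda>n. \<phi> n x) \<longlonglongrightarrow> f x"
proof -
  have C: "\<phi> n \<in> l2 m" for n using assms(1) by (simp add: form_approx_def Cc_l2)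
  have "(\<lambda>n. norm (emb (\<phi> n) - emb f)) \<longlonglongrightarrow> 0"
    using assms by (simp add: form_approx_def l2_norm_emb l2_diff C)
  then show lim: "(\<lambda>n. emb (\<phi> n)) \<longlonglongrightarrow> emb f" using tendsto_norm_zero_iff LIM_zero_iff by blast
  show "(\<lambda>n. \<phi> n x) \<longlonglongrightarrow> f x"
    using tendsto_val[OF lim, of x] by (simp add: val_emb C assms(2))
qed

text \<open>Green's formula for the closed form. For a fixed test function \<open>\<psi> k\<close> the energy is a finite sum,
  which converges along with \<open>\<phi> n\<close>; the error from \<open>\<psi> n - \<psi> k\<close> is small uniformly, as the energy
  of \<open>\<phi> n\<close> is bounded. In particular the limit does not depend on the approximating sequences.\<close>

lemma form_Green:
  assumes phi: "form_approx b m \<phi> f" and f: "f \<in> l2 m" and h: "\<And>x. Lap f x = val h x"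
    and psi: "form_approx b m \<psi> g" and g: "g \<in> l2 m"
  shows "(\<lambda>n. energy b (\<phi> n) (\<psi> n)) \<longlonglongrightarrow> inner h (emb g)"
proof (rule LIMSEQ_I)
  fix e :: real assume e: "e > 0"
  have C: "\<phi> n \<in> Cc" "\<psi> n \<in> Cc" for n using phi psi by (simp_all add: form_approx_def)
  have cphi: "\<exists>N. \<forall>k\<ge>N. \<forall>n\<ge>N. energy b (\<lambda>x. \<phi> k x - \<phi> n x) (\<lambda>x. \<phi> k x - \<phi> n x) < r"
    and cpsi: "\<exists>N. \<forall>k\<ge>N. \<forall>n\<ge>N. energy b (\<lambda>x. \<psi> k x - \<psi> n x) (\<lambda>x. \<psi> k x - \<psi> n x) < r"
    if "r > 0" for r
    using phi psi that by (simp_all add: form_approx_def)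
  obtain N0 where N0: "\<And>k. k \<ge> N0 \<Longrightarrow> energy b (\<lambda>x. \<phi> k x - \<phi> N0 x) (\<lambda>x. \<phi> k x - \<phi> N0 x) < 1"
    using cphi[of 1] by auto
  define B where "B = 2 + 2 * energy b (\<phi> N0) (\<phi> N0)"
  have B: "energy b (\<phi> k) (\<phi> k) \<le> B" if "k \<ge> N0" for k
  proof -
    let ?w = "\<lambda>x. \<phi> k x - \<phi> N0 x"
    have "energy b ?w ?w = energy b (\<phi> k) (\<phi> k) - energy b (\<phi> k) (\<phi> N0) - (energy b (\<phi> N0) (\<phi> k) - energy b (\<phi> N0) (\<phi> N0))"
      unfolding energy_diff_left[OF Cc_diff[OF C(1) C(1)]]
      by (simp only: energy_diff_right[OF C(1)])
    moreover have "2 * energy b ?w (\<phi> N0) \<le> 1 * energy b ?w ?w + energy b (\<phi> N0) (\<phi> N0) / 1"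
      using energy_bound[OF Cc_diff[OF C(1) C(1)] C(1), of 1 k N0 N0] by linarith
    moreover have "energy b ?w (\<phi> N0) = energy b (\<phi> k) (\<phi> N0) - energy b (\<phi> N0) (\<phi> N0)"
      by (rule energy_diff_left[OF C(1)])
    ultimately show ?thesis using N0[OF that] energy_commute[of "\<phi> k" "\<phi> N0"] by (simp add: B_def)
  qed
  have B1: "B > 0" using energy_nonneg[of "\<phi> N0"] by (simp add: B_def)
  \<comment> \<open>balances the two error terms of \<open>energy_bound\<close> at \<open>e/2\<close> each\<close>
  define c where "c = e / (2 * B)"
  have c: "c > 0" using e B1 by (simp add: c_def)
  obtain N1 where N1: "\<And>k n. k \<ge> N1 \<Longrightarrow> n \<ge> N1 \<Longrightarrow> energy b (\<lambda>x. \<psi> k x - \<psi> n x) (\<lambda>x. \<psi> k x - \<psi> n x) < c * e / 2"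
    using cpsi[of "c * e / 2"] c e by auto
  have lim: "(\<lambda>n. inner h (emb (\<psi> n))) \<longlonglongrightarrow> inner h (emb g)"
    by (intro tendsto_intros form_approx_tendsto(1)[OF psi g])
  then obtain N2 where N2: "\<And>n. n \<ge> N2 \<Longrightarrow> norm (inner h (emb (\<psi> n)) - inner h (emb g)) < e / 4"
    using LIMSEQ_D[OF lim, of "e / 4"] e by auto
  define k where "k = max N1 N2"
  have fS: "finite {x. \<psi> k x \<noteq> 0}" using C by (simp add: Cc_def)
  have "(\<lambda>n. \<Sum>x | \<psi> k x \<noteq> 0. Lap (\<phi> n) x * \<psi> k x * m x) \<longlonglongrightarrow> (\<Sum>x | \<psi> k x \<noteq> 0. Lap f x * \<psi> k x * m x)"
    by (intro tendsto_intros Lap_tendsto form_approx_tendsto(2)[OF phi f])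
  then have "(\<lambda>n. energy b (\<phi> n) (\<psi> k)) \<longlonglongrightarrow> inner h (emb (\<psi> k))"
    using Green_formula[OF fS, of "\<psi> k"] inner_emb_finite[OF fS, of "\<psi> k" h] by (simp add: h)
  then obtain N3 where N3: "\<And>n. n \<ge> N3 \<Longrightarrow> norm (energy b (\<phi> n) (\<psi> k) - inner h (emb (\<psi> k))) < e / 4"
    using LIMSEQ_D[of _ _ "e / 4"] e by fastforce
  have "norm (energy b (\<phi> n) (\<psi> n) - inner h (emb g)) < e" if n: "n \<ge> max (max N0 N1) N3" for n
  proof -
    let ?w = "\<lambda>x. \<psi> n x - \<psi> k x"
    have "2 * \<bar>energy b (\<phi> n) ?w\<bar> \<le> c * energy b (\<phi> n) (\<phi> n) + energy b ?w ?w / c"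
      by (rule energy_bound[OF C(1) Cc_diff[OF C(2) C(2)] c])
    also have "\<dots> \<le> c * B + (c * e / 2) / c"
      using B[of n] N1[of n k] n c by (intro add_mono mult_left_mono divide_right_mono) (auto simp: k_def)
    also have "\<dots> = e" using c B1 by (simp add: c_def)
    finally have "\<bar>energy b (\<phi> n) ?w\<bar> \<le> e / 2" by simp
    moreover have "energy b (\<phi> n) ?w = energy b (\<phi> n) (\<psi> n) - energy b (\<phi> n) (\<psi> k)"
      by (rule energy_diff_right[OF C(1)])
    moreover have "norm (inner h (emb (\<psi> k)) - inner h (emb g)) < e / 4" using N2 by (simp add: k_def)
    ultimately show ?thesis using N3[of n] n by (simp add: abs_if split: if_splits)
  qed
  then show "\<exists>N. \<forall>n\<ge>N. norm (energy b (\<phi> n) (\<psi> n) - inner h (emb g)) < e" by blast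
qed

lemma Res_form_dom: "val (act (Res 1) u) \<in> form_dom b m"
  unfolding form_dom_def using form_approx_Res[of 1 u] val_l2 by auto

lemma closed_form_Res:
  assumes g: "g \<in> form_dom b m"
  shows "closed_form b m (val (act (Res 1) u)) g = inner (u - act (Res 1) u) (emb g)"
    and "closed_form b m g (val (act (Res 1) u)) = inner (u - act (Res 1) u) (emb g)"
proof -
  obtain \<psi>0 where psi0: "form_approx b m \<psi>0 g" and gl: "g \<in> l2 m" using g by (auto simp: form_dom_def)
  note phi0 = form_approx_Res[of 1 u, simplified]
  have L: "Lap (val (act (Res 1) u)) x = val (u - act (Res 1) u) x" for x
    using Res_Lap[of 1 u x] by simp
  have lim: "(\<lambda>n. energy b (\<phi> n) (\<psi> n)) \<longlonglongrightarrow> inner (u - act (Res 1) u) (emb g)"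
    if "form_approx b m \<phi> (val (act (Res 1) u))" "form_approx b m \<psi> g" for \<phi> \<psi>
    by (rule form_Green[OF that(1) val_l2 L that(2) gl])
  show "closed_form b m (val (act (Res 1) u)) g = inner (u - act (Res 1) u) (emb g)"
    unfolding closed_form_def using lim phi0 psi0 by (intro the_equality) (blast intro: LIMSEQ_unique)+
  show "closed_form b m g (val (act (Res 1) u)) = inner (u - act (Res 1) u) (emb g)"
    unfolding closed_form_def using lim phi0 psi0
    by (subst energy_commute, intro the_equality) (blast intro: LIMSEQ_unique)+
qed

text \<open>The Laplacian is the inverse of the resolvent at 1, minus one. To see that its domain is no larger than the
  range of the resolvent, test with functions from this range and use symmetry of the resolvent.\<close>

lemma laplacian_Res: "laplacian b m = {(val (act (Res 1) u), val (u - act (Res 1) u)) | u. True}"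
proof (intro equalityI subsetI)
  fix p assume "p \<in> {(val (act (Res 1) u), val (u - act (Res 1) u)) | u. True}"
  then obtain u where p: "p = (val (act (Res 1) u), val (u - act (Res 1) u))" by blast
  have "closed_form b m (val (act (Res 1) u)) g = l2_inner m (val (u - act (Res 1) u)) g"
    if "g \<in> form_dom b m" for g
    using closed_form_Res(1)[OF that, of u] that by (simp only: inner_val) (simp add: val_emb form_dom_def)
  then show "p \<in> laplacian b m"
    unfolding p laplacian_def using Res_form_dom val_l2 by blast
next
  fix p assume "p \<in> laplacian b m"
  then obtain f h where p: "p = (f, h)" and f: "f \<in> form_dom b m" and h: "h \<in> l2 m"
    and eq: "\<And>g. g \<in> form_dom b m \<Longrightarrow> closed_form b m f g = l2_inner m h g"
    unfolding laplacian_def by blast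
  have fl: "f \<in> l2 m" using f by (simp add: form_dom_def)
  define w where "w = emb f + emb h"
  have "inner u (emb f) = inner u (act (Res 1) w)" for u
  proof -
    have "inner (u - act (Res 1) u) (emb f) = inner (emb h) (act (Res 1) u)"
      using closed_form_Res(2)[OF f, of u] eq[OF Res_form_dom, of u] by (simp add: inner_val val_emb h)
    then have "inner u (emb f) = inner (act (Res 1) u) w"
      using inner_commute[of "emb h" "act (Res 1) u"] by (simp add: w_def inner_diff_left inner_add_right)
    then show ?thesis by (simp add: Res_sym)
  qed
  then have "emb f = act (Res 1) w" using vector_eq_rdot by (metis inner_commute)
  moreover have "emb h = w - emb f" by (simp add: w_def)
  ultimately show "p \<in> {(val (act (Res 1) u), val (u - act (Res 1) u)) | u. True}"
    using p val_emb[OF fl] val_emb[OF h] by auto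
qed

lemma emb_gen:
  assumes P: "\<And>t f. t \<ge> 0 \<Longrightarrow> f \<in> l2 m \<Longrightarrow> P t f \<in> l2 m"
  shows "(f, h) \<in> generator m P \<longleftrightarrow> f \<in> l2 m \<and> h \<in> l2 m \<and> (emb f, emb h) \<in> gen (\<lambda>t u. emb (P t (val u)))"
proof -
  have "((\<lambda>t. l2_norm m (\<lambda>x. (P t f x - f x) / t - h x)) \<longlongrightarrow> 0) (at_right 0)
      \<longleftrightarrow> ((\<lambda>t. (emb (P t (val (emb f))) - emb f) /\<^sub>R t) \<longlongrightarrow> emb h) (at_right 0)"
    if f: "f \<in> l2 m" and h: "h \<in> l2 m"
  proof -
    have "l2_norm m (\<lambda>x. (P t f x - f x) / t - h x) = norm ((emb (P t (val (emb f))) - emb f) /\<^sub>R t - emb h)"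
      if t: "t > 0" for t
    proof -
      have "val ((emb (P t f) - emb f) /\<^sub>R t - emb h) = (\<lambda>x. (P t f x - f x) / t - h x)"
        using P[of t f] t f h by (intro ext) (simp add: val_emb divide_inverse mult.commute)
      then show ?thesis using norm_val[of "(emb (P t f) - emb f) /\<^sub>R t - emb h"] by (simp add: val_emb f)
    qed
    then have "\<forall>\<^sub>F t in at_right 0. l2_norm m (\<lambda>x. (P t f x - f x) / t - h x)
        = norm ((emb (P t (val (emb f))) - emb f) /\<^sub>R t - emb h)"
      using eventually_at_right_less[of 0] by (auto elim: eventually_mono)
    then have "((\<lambda>t. l2_norm m (\<lambda>x. (P t f x - f x) / t - h x)) \<longlongrightarrow> 0) (at_right 0)
      \<longleftrightarrow> ((\<lambda>t. norm ((emb (P t (val (emb f))) - emb f) /\<^sub>R t - emb h)) \<longlongrightarrow> 0) (at_right 0)"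
      by (rule tendsto_cong)
    also have "\<dots> \<longleftrightarrow> ((\<lambda>t. (emb (P t (val (emb f))) - emb f) /\<^sub>R t) \<longlongrightarrow> emb h) (at_right 0)"
      by (simp only: tendsto_norm_zero_iff LIM_zero_iff)
    finally show ?thesis .
  qed
  then show ?thesis unfolding generator_def gen_def by auto
qed

lemma emb_semigroup:
  assumes P: "C0_semigroup m P" shows "semigroup_C0 (\<lambda>t u. emb (P t (val u)))"
proof -
  have l2: "P t f \<in> l2 m" if "t \<ge> 0" "f \<in> l2 m" for t f using P that by (simp add: C0_semigroup_def)
  show ?thesis
    unfolding semigroup_C0_def
  proof (intro conjI allI impI)
    fix t :: real assume t: "t \<ge> 0"
    have lin: "P t (\<lambda>x. c * f x + e * g x) = (\<lambda>x. c * P t f x + e * P t g x)"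
      if "f \<in> l2 m" "g \<in> l2 m" for c e f g
      using P t that by (simp add: C0_semigroup_def)
    obtain C where C: "\<And>f. f \<in> l2 m \<Longrightarrow> l2_norm m (P t f) \<le> C * l2_norm m f"
      using P t unfolding C0_semigroup_def by meson
    have lc: "emb (P t (val (c *\<^sub>R u + e *\<^sub>R w))) = c *\<^sub>R emb (P t (val u)) + e *\<^sub>R emb (P t (val w))" for c e u w
    proof -
      have "val (c *\<^sub>R u + e *\<^sub>R w) = (\<lambda>x. c * val u x + e * val w x)" by (rule ext) simp
      then show ?thesis using lin[OF val_l2[of u] val_l2[of w]] l2_lincomb[OF l2[OF t val_l2[of u]] l2[OF t val_l2[of w]]] by simp
    qed
    show "bounded_linear (\<lambda>u. emb (P t (val u)))"
    proof (rule bounded_linear_intro)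
      show "emb (P t (val (u + w))) = emb (P t (val u)) + emb (P t (val w))" for u w using lc[of 1 u 1 w] by simp
      show "emb (P t (val (c *\<^sub>R u))) = c *\<^sub>R emb (P t (val u))" for c u using lc[of c u 0 u] by simp
      show "norm (emb (P t (val u))) \<le> norm u * C" for u
        using C[OF val_l2, of u] by (simp add: l2_norm_emb l2 t val_l2 emb_val mult.commute)
    qed
  next
    show "emb (P 0 (val f)) = f" for f using P val_l2[of f] by (simp add: C0_semigroup_def emb_val)
    show "emb (P (s + t) (val f)) = emb (P s (val (emb (P t (val f)))))" if "s \<ge> 0" "t \<ge> 0" for s t f
    proof -
      have "P (s + t) (val f) = P s (P t (val f))" using P that val_l2[of f] by (simp add: C0_semigroup_def)
      then show ?thesis using val_emb[OF l2[OF that(2) val_l2]] by simp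
    qed
    fix f
    have "((\<lambda>t. l2_norm m (\<lambda>x. P t (val f) x - val f x)) \<longlongrightarrow> 0) (at_right 0)"
      using P val_l2[of f] by (simp add: C0_semigroup_def)
    moreover have "\<forall>\<^sub>F t in at_right 0. l2_norm m (\<lambda>x. P t (val f) x - val f x) = norm (emb (P t (val f)) - f)"
      using eventually_at_right_less[of 0]
      by eventually_elim (simp add: l2_norm_emb l2_diff l2 val_l2 emb_val)
    ultimately have "((\<lambda>t. norm (emb (P t (val f)) - f)) \<longlongrightarrow> 0) (at_right 0)" by (simp add: tendsto_cong)
    then show "((\<lambda>t. emb (P t (val f))) \<longlongrightarrow> f) (at_right 0)" by (simp only: tendsto_norm_zero_iff LIM_zero_iff)
  qed
qed

lemma semigroup_val_flow:
  "C0_semigroup m (\<lambda>t f. val (flow t (emb f))) \<and>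
   generator m (\<lambda>t f. val (flow t (emb f))) = {(f, h). (f, \<lambda>x. - h x) \<in> laplacian b m}"
proof
  let ?P = "\<lambda>t f. val (flow t (emb f))"
  have n: "l2_norm m (val u) = norm u" for u by (simp add: norm_val)
  have lin: "linear (flow t)" if "t \<ge> 0" for t by (rule flow_linear[OF that])
  show "C0_semigroup m ?P"
    unfolding C0_semigroup_def
  proof (intro conjI allI impI ballI)
    show "val (flow t (emb f)) \<in> l2 m" for t f by (rule val_l2)
    show "val (flow t (emb (\<lambda>x. c * f x + e * g x))) = (\<lambda>x. c * val (flow t (emb f)) x + e * val (flow t (emb g)) x)"
      if "t \<ge> 0" "f \<in> l2 m" "g \<in> l2 m" for t f g c e
      using that by (intro ext) (simp add: l2_lincomb linear_add[OF lin] linear_scale[OF lin])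
    show "\<exists>C. \<forall>f\<in>l2 m. l2_norm m (val (flow t (emb f))) \<le> C * l2_norm m f" if "t \<ge> 0" for t
      using norm_flow[OF that] by (intro exI[of _ 1]) (simp add: n l2_norm_emb)
    show "val (flow 0 (emb f)) = f" if "f \<in> l2 m" for f using that by (simp add: flow_0 val_emb)
    show "val (flow (s + t) (emb f)) = val (flow s (emb (val (flow t (emb f)))))" if "s \<ge> 0" "t \<ge> 0" for s t f
      using that by (simp add: flow_add emb_val)
    fix f assume f: "f \<in> l2 m"
    have "((\<lambda>t. norm (flow t (emb f) - emb f)) \<longlongrightarrow> 0) (at_right 0)"
      using semigroup_C0D(4)[OF semigroup_flow] by (intro tendsto_norm_zero LIM_zero)
    moreover have "l2_norm m (\<lambda>x. val (flow t (emb f)) x - f x) = norm (flow t (emb f) - emb f)" for t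
      using l2_diff[OF val_l2 f] by (simp add: l2_norm_emb emb_val)
    ultimately show "((\<lambda>t. l2_norm m (\<lambda>x. val (flow t (emb f)) x - f x)) \<longlongrightarrow> 0) (at_right 0)" by simp
  qed
  have g: "gen (\<lambda>t u. emb (?P t (val u))) = {(act (Res 1) h, act (Res 1) h - h) | h. True}"
    by (simp add: emb_val gen_flow)
  show "generator m ?P = {(f, h). (f, \<lambda>x. - h x) \<in> laplacian b m}"
  proof (rule set_eqI)
    fix p :: "('a \<Rightarrow> real) \<times> ('a \<Rightarrow> real)"
    obtain f h where p: "p = (f, h)" by (cases p)
    have "(f, h) \<in> generator m ?P \<longleftrightarrow> f \<in> l2 m \<and> h \<in> l2 m \<and> (\<exists>u. emb f = act (Res 1) u \<and> emb h = act (Res 1) u - u)"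
      unfolding emb_gen[of ?P, OF val_l2] g by auto
    also have "\<dots> \<longleftrightarrow> (\<exists>u. f = val (act (Res 1) u) \<and> h = val (act (Res 1) u - u))"
      using val_emb emb_val val_l2 by metis
    also have "\<dots> \<longleftrightarrow> (\<exists>u. f = val (act (Res 1) u) \<and> (\<lambda>x. - h x) = val (u - act (Res 1) u))"
      by (auto simp: fun_eq_iff) (metis minus_diff_eq minus_equation_iff)
    finally have "(f, h) \<in> generator m ?P \<longleftrightarrow> (f, \<lambda>x. - h x) \<in> laplacian b m"
      unfolding laplacian_Res by auto
    then show "p \<in> generator m ?P \<longleftrightarrow> p \<in> {(f, h). (f, \<lambda>x. - h x) \<in> laplacian b m}" by (simp add: p)
  qed
qed

lemma heat_semigroup_flow:
  assumes t: "t \<ge> 0" and f: "f \<in> l2 m"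
  shows "heat_semigroup b m t f = val (flow t (emb f))"
proof -
  let ?H = "heat_semigroup b m"
  have H: "C0_semigroup m ?H" "generator m ?H = {(f, h). (f, \<lambda>x. - h x) \<in> laplacian b m}"
    using someI[where P = "\<lambda>P. C0_semigroup m P \<and> generator m P = {(f, h). (f, \<lambda>x. - h x) \<in> laplacian b m}",
        OF semigroup_val_flow] by (simp_all add: heat_semigroup_def)
  have l2: "?H t f \<in> l2 m" if "t \<ge> 0" "f \<in> l2 m" for t f using H(1) that by (simp add: C0_semigroup_def)
  have l2': "val (flow t (emb f)) \<in> l2 m" for t f by (rule val_l2)
  have "gen (\<lambda>t u. emb (?H t (val u))) = gen (\<lambda>t u. emb (val (flow t (emb (val u)))))"
  proof (intro set_eqI, clarify)
    fix u w
    have "(u, w) \<in> gen (\<lambda>t u. emb (?H t (val u))) \<longleftrightarrow> (val u, val w) \<in> generator m ?H"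
      by (simp add: emb_gen[of ?H, OF l2] val_l2 emb_val)
    also have "\<dots> \<longleftrightarrow> (val u, val w) \<in> generator m (\<lambda>t f. val (flow t (emb f)))"
      using H(2) semigroup_val_flow by simp
    also have "\<dots> \<longleftrightarrow> (u, w) \<in> gen (\<lambda>t u. emb (val (flow t (emb (val u)))))"
      by (simp only: emb_gen[of "\<lambda>t f. val (flow t (emb f))", OF l2'] val_l2 emb_val simp_thms)
    finally show "(u, w) \<in> gen (\<lambda>t u. emb (?H t (val u))) \<longleftrightarrow> (u, w) \<in> gen (\<lambda>t u. emb (val (flow t (emb (val u)))))" .
  qed
  also have "\<dots> = {(act (Res 1) h, act (Res 1) h - h) | h. True}" by (simp add: emb_val gen_flow)
  finally have "emb (?H t (val (emb f))) = flow t (emb f)"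
    by (rule flow_unique[OF emb_semigroup[OF H(1)] _ t])
  then show ?thesis using val_emb[OF l2[OF t f]] val_emb[OF f] by metis
qed

end

section \<open>The Feller property and the Green function\<close>

lemma C0_iff: "f \<in> C0 \<longleftrightarrow> (\<forall>e>0. finite {x. \<bar>f x\<bar> > e})"
proof (intro iffI allI impI)
  fix e :: real assume "f \<in> C0" "e > 0"
  then obtain g where g: "g \<in> Cc" "\<And>x. \<bar>f x - g x\<bar> \<le> e" by (auto simp: C0_def)
  have "{x. \<bar>f x\<bar> > e} \<subseteq> {x. g x \<noteq> 0}"
  proof
    fix x assume "x \<in> {x. \<bar>f x\<bar> > e}"
    then show "x \<in> {x. g x \<noteq> 0}" using g(2)[of x] by auto
  qed
  then show "finite {x. \<bar>f x\<bar> > e}" using g(1) finite_subset by (auto simp: Cc_def)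
next
  assume fin: "\<forall>e>0. finite {x. \<bar>f x\<bar> > e}"
  show "f \<in> C0"
    unfolding C0_def
  proof (clarify)
    fix e :: real assume "e > 0"
    with fin have "finite {x. \<bar>f x\<bar> > e}" by blast
    then have "(\<lambda>x. if \<bar>f x\<bar> > e then f x else 0) \<in> Cc"
      unfolding Cc_def by (auto elim: rev_finite_subset)
    then show "\<exists>g\<in>Cc. \<forall>x. \<bar>f x - g x\<bar> \<le> e"
      using \<open>e > 0\<close> by (intro bexI[of _ "\<lambda>x. if \<bar>f x\<bar> > e then f x else 0"]) auto
  qed
qed

lemma C0_finite: "f \<in> C0 \<Longrightarrow> e > 0 \<Longrightarrow> finite {x. \<bar>f x\<bar> > e}"
  by (simp add: C0_iff)

lemma C0_dominated:
  assumes g: "g \<in> C0" and le: "\<And>x. \<bar>f x\<bar> \<le> c * g x"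
  shows "f \<in> C0"
  unfolding C0_iff
proof (intro allI impI)
  fix e :: real assume e: "e > 0"
  define k where "k = \<bar>c\<bar> + 1"
  have k: "k > 0" by (simp add: k_def)
  have "{x. \<bar>f x\<bar> > e} \<subseteq> {x. \<bar>g x\<bar> > e / k}"
  proof
    fix x assume "x \<in> {x. \<bar>f x\<bar> > e}"
    moreover have "c * g x \<le> k * \<bar>g x\<bar>"
      using abs_mult[of c "g x"] abs_ge_self[of "c * g x"] mult_right_mono[of "\<bar>c\<bar>" k "\<bar>g x\<bar>"]
      by (simp add: k_def)
    ultimately have "e < k * \<bar>g x\<bar>" using le[of x] by simp
    then show "x \<in> {x. \<bar>g x\<bar> > e / k}" using k by (simp add: divide_less_eq mult.commute)
  qed
  moreover have "finite {x. \<bar>g x\<bar> > e / k}" using g e k by (simp add: C0_iff)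
  ultimately show "finite {x. \<bar>f x\<bar> > e}" by (rule finite_subset)
qed

lemma C0_add:
  assumes "f \<in> C0" "g \<in> C0" shows "(\<lambda>x. f x + g x) \<in> C0"
  unfolding C0_iff
proof (intro allI impI)
  fix e :: real assume "e > 0"
  have "{x. \<bar>f x + g x\<bar> > e} \<subseteq> {x. \<bar>f x\<bar> > e / 2} \<union> {x. \<bar>g x\<bar> > e / 2}" by auto
  moreover have "finite ({x. \<bar>f x\<bar> > e / 2} \<union> {x. \<bar>g x\<bar> > e / 2})"
    using C0_finite[OF assms(1), of "e / 2"] C0_finite[OF assms(2), of "e / 2"] \<open>e > 0\<close> by simp
  ultimately show "finite {x. \<bar>f x + g x\<bar> > e}" by (rule finite_subset)
qed

lemma C0_sum: "finite S \<Longrightarrow> (\<And>y. y \<in> S \<Longrightarrow> f y \<in> C0) \<Longrightarrow> (\<lambda>x. \<Sum>y\<in>S. f y x) \<in> C0"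
  by (induction S rule: finite_induct) (auto intro: C0_add simp: C0_iff[of "\<lambda>_. 0"])

lemma C0_inj_tendsto:
  assumes f: "f \<in> C0" and X: "inj X" shows "(\<lambda>n. f (X n)) \<longlonglongrightarrow> 0"
proof (rule LIMSEQ_I)
  fix e :: real assume e: "e > 0"
  have "finite {x. \<bar>f x\<bar> > e / 2}" using e by (intro C0_finite[OF f]) simp
  then have "finite (X -` {x. \<bar>f x\<bar> > e / 2})" using X by (rule finite_vimageI)
  then obtain N where N: "\<And>n. \<bar>f (X n)\<bar> > e / 2 \<Longrightarrow> n \<le> N"
    unfolding finite_nat_set_iff_bounded_le by auto
  have "norm (f (X n) - 0) < e" if "n \<ge> Suc N" for n
    using N[of n] that e by (force simp: not_less)
  then show "\<exists>N. \<forall>n\<ge>N. norm (f (X n) - 0) < e" by blast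
qed

context rooted_graph
begin

abbreviation "ind y \<equiv> (indicator {y} :: 'a \<Rightarrow> real)"

definition heat :: "real \<Rightarrow> 'a \<Rightarrow> 'a \<Rightarrow> real" where
  "heat t y = val (flow t (emb (ind y)))"

definition green :: "'a \<Rightarrow> real" where "green = val (act (Res 1) (emb (ind rt)))"

lemma indicator_Cc: "finite F \<Longrightarrow> (indicator F :: 'a \<Rightarrow> real) \<in> Cc"
  by (auto simp: Cc_def indicator_def)

lemma val_emb_indicator: "finite F \<Longrightarrow> val (emb (indicator F)) = (indicator F :: 'a \<Rightarrow> real)"
  by (simp add: val_emb Cc_l2 indicator_Cc)

text \<open>Nonnegative functions form a closed convex cone, which the resolvents preserve.\<close>

lemma flow_nonneg:
  assumes "t \<ge> 0" "\<And>x. val u x \<ge> 0" shows "val (flow t u) x \<ge> 0"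
proof -
  let ?S = "\<Inter>x. {u. 0 \<le> val u x}"
  have "flow t u \<in> ?S"
  proof (rule flow_convex_invariant[OF _ _ _ _ assms(1)])
    show "closed ?S"
      by (intro closed_INT ballI closed_Collect_le continuous_intros
          linear_continuous_on[OF bounded_linear_val])
    show "convex ?S" by (auto simp: convex_def)
    show "k *\<^sub>R act (Res k) f \<in> ?S" if "k > 0" "f \<in> ?S" for k f
      using that Res_nonneg[of k f] by simp
  qed (use assms in auto)
  then show ?thesis by simp
qed

lemma flow_le_1:
  assumes "t \<ge> 0" "\<And>x. val u x \<le> 1" shows "val (flow t u) x \<le> 1"
proof -
  let ?S = "\<Inter>x. {u. val u x \<le> 1}"
  have "flow t u \<in> ?S"
  proof (rule flow_convex_invariant[OF _ _ _ _ assms(1)])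
    show "closed ?S"
      by (intro closed_INT ballI closed_Collect_le continuous_intros
          linear_continuous_on[OF bounded_linear_val])
    show "convex ?S" by (auto simp: convex_def intro!: convex_bound_le)
    show "k *\<^sub>R act (Res k) f \<in> ?S" if k: "k > 0" and f: "f \<in> ?S" for k f
    proof -
      have "val (act (Res k) f) x \<le> 1 / k" for x
      proof (rule Res_le[OF k])
        show "dir (bal n) k (val f) x \<le> 1 / k" for n
          using dir_le[OF finite_bal k, of n "val f" 1 x] f k by (simp add: field_simps)
      qed
      then show ?thesis using k by (simp add: field_simps)
    qed
  qed (use assms in auto)
  then show ?thesis by simp
qed

lemma heat_nonneg: "t \<ge> 0 \<Longrightarrow> heat t y x \<ge> 0"
  unfolding heat_def by (rule flow_nonneg) (simp_all add: val_emb_indicator)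

lemma val_sum: "val (\<Sum>y\<in>F. u y) x = (\<Sum>y\<in>F. val (u y) x)"
  by (induction F rule: infinite_finite_induct) simp_all

lemma heat_sum_le_1:
  assumes "finite F" "t \<ge> 0" shows "(\<Sum>y\<in>F. heat t y x) \<le> 1"
proof -
  have "emb (indicator F) = (\<Sum>y\<in>F. emb (ind y))"
  proof (rule ell2_eqI)
    fix z
    have "(\<Sum>y\<in>F. ind y z) = indicator F z" using assms(1) by (simp add: indicator_def)
    then show "coord (emb (indicator F)) z = coord (\<Sum>y\<in>F. emb (ind y)) z"
      using assms by (simp add: coord_val val_sum val_emb_indicator)
  qed
  then have "(\<Sum>y\<in>F. heat t y x) = val (flow t (emb (indicator F))) x"
    by (simp add: heat_def val_sum linear_sum[OF flow_linear[OF assms(2)]])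
  also have "\<dots> \<le> 1" by (rule flow_le_1) (use assms in \<open>auto simp: val_emb_indicator indicator_def\<close>)
  finally show ?thesis .
qed

lemma heat_kernel_heat: "t \<ge> 0 \<Longrightarrow> heat_kernel b m t x y * f * m y = heat t y x * f"
  using m_nz[of y] by (simp add: heat_kernel_def heat_semigroup_flow Cc_l2 indicator_Cc heat_def)

lemma heat_action_heat: "t \<ge> 0 \<Longrightarrow> heat_action b m t f x = (\<Sum>\<^sub>\<infinity>y. heat t y x * f y)"
  by (simp add: heat_action_def heat_kernel_heat)

text \<open>Integrated form of \<open>d/ds (e\<^sup>-\<^sup>s P\<^sub>s w) = - e\<^sup>-\<^sup>s P\<^sub>s (1 + \<Delta>) w\<close> for \<open>w = (\<Delta> + 1)\<^sup>-\<^sup>1 u\<close>.\<close>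

lemma heat_integral:
  assumes T: "T \<ge> 0"
  shows "((\<lambda>s. exp (- s) * val (flow s u) x) has_integral
    val (act (Res 1) u) x - exp (- T) * val (flow T (act (Res 1) u)) x) {0..T}"
proof -
  let ?w = "act (Res 1) u"
  let ?F = "\<lambda>s. - (exp (- s) * val (flow s ?w) x)"
  have "(?F has_vector_derivative exp (- a) * val (flow a u) x) (at a within {0..T})" if a: "a \<in> {0..T}" for a
  proof -
    have "((\<lambda>s. val (flow s ?w) x) has_real_derivative val (flow a (?w - u)) x) (at a within {0..T})"
      unfolding has_real_derivative_iff_has_vector_derivative
      by (rule bounded_linear.has_vector_derivative[OF bounded_linear_val flow_has_vector_derivative[OF a]])
    then have "(?F has_real_derivative
        - (- exp (- a) * val (flow a ?w) x + val (flow a (?w - u)) x * exp (- a))) (at a within {0..T})"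
      by (auto intro!: derivative_eq_intros)
    moreover have "val (flow a (?w - u)) x = val (flow a ?w) x - val (flow a u) x"
      using a by (simp add: linear_diff[OF flow_linear])
    ultimately show ?thesis
      unfolding has_real_derivative_iff_has_vector_derivative[symmetric] by (simp add: algebra_simps)
  qed
  from fundamental_theorem_of_calculus[OF T this] show ?thesis by (simp add: flow_0)
qed

lemma green_nonneg: "green x \<ge> 0"
  unfolding green_def by (rule Res_nonneg) (simp_all add: val_emb_indicator)

lemma green_Lap: "Lap green x + green x = ind rt x"
  using Res_Lap[of 1 "emb (ind rt)" x] by (simp add: green_def val_emb_indicator)

text \<open>A zero of \<open>G \<ge> 0\<close> is a minimum, so the equation makes \<open>G\<close> vanish at the neighbours as well, and
  along a path to the root, where the source term excludes it.\<close>

lemma green_pos: "green x > 0"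
proof (rule ccontr)
  assume "\<not> ?thesis"
  then have x: "green x = 0" using green_nonneg[of x] by simp
  have "green x \<noteq> 0" for x
  proof (induction "d x" arbitrary: x)
    case 0
    then have "x = rt" using d_eq_0 by simp
    then show ?case using Lap_at_min[of rt green] green_nonneg green_Lap[of rt] by fastforce
  next
    case (Suc n)
    obtain y where y: "y \<in> nbr x" "d y = n" using predecessor Suc(2) by metis
    show ?case
    proof
      assume 0: "green x = 0"
      have "(\<Sum>z\<in>nbr x. b x z * green z) > 0"
      proof (rule sum_pos2[OF finite_nbr y(1)])
        show "0 < b x y * green y"
          using y Suc(1)[of y] green_nonneg[of y] by (simp add: nbr_def)
      qed (use weight_nonneg green_nonneg in auto)
      then have "Lap green x < 0"
        unfolding Lap_deg using 0 measure_pos[of x] by (simp add: divide_pos_pos)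
      moreover have "0 \<le> ind rt x" by simp
      ultimately show False using green_Lap[of x] 0 by linarith
    qed
  qed
  then show False using x by blast
qed

text \<open>\<open>G\<close> is 1-excessive, \<open>P\<^sub>t G \<le> e\<^sup>t G\<close>, and the indicator of \<open>y\<close> is at most \<open>G / G(y)\<close>.\<close>

lemma heat_le_green:
  assumes t: "t \<ge> 0" shows "heat t y x \<le> exp t / green y * green x"
proof -
  let ?u = "emb (ind rt)" let ?w = "act (Res 1) ?u"
  have u: "val ?u x \<ge> 0" for x by (simp add: val_emb_indicator)
  have "0 \<le> val ?w x - exp (- t) * val (flow t ?w) x"
    by (rule has_integral_nonneg[OF heat_integral[OF t]]) (use flow_nonneg u in auto)
  then have 1: "val (flow t ?w) x \<le> exp t * green x"
    by (simp add: green_def exp_minus field_simps)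
  have "0 \<le> val (flow t (?w - green y *\<^sub>R emb (ind y))) x"
  proof (rule flow_nonneg[OF t])
    show "0 \<le> val (?w - green y *\<^sub>R emb (ind y)) z" for z
      using green_nonneg[of z] by (simp add: val_emb_indicator indicator_def green_def)
  qed
  then have "green y * heat t y x \<le> val (flow t ?w) x"
    by (simp add: heat_def linear_diff[OF flow_linear[OF t]] linear_scale[OF flow_linear[OF t]])
  with 1 have "green y * heat t y x \<le> exp t * green x" by linarith
  then show ?thesis using green_pos[of y] by (simp add: field_simps)
qed

lemma Feller_if_green: 
  assumes G: "green \<in> C0" shows "Feller b m"
  unfolding Feller_def
proof (intro allI impI ballI)
  fix t :: real and f :: "'a \<Rightarrow> real" assume t: "t \<ge> 0" and f: "f \<in> C0"
  have H: "heat t y \<in> C0" for y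
    by (rule C0_dominated[OF G, of _ "exp t / green y"]) (use heat_le_green[OF t] heat_nonneg[OF t] in auto)
  show "heat_action b m t f \<in> C0"
    unfolding C0_iff
  proof (intro allI impI)
    fix e :: real assume e: "e > 0"
    then obtain g where g: "g \<in> Cc" "\<And>y. \<bar>f y - g y\<bar> \<le> e / 2"
      using f unfolding C0_def by (auto dest!: spec[of _ "e / 2"])
    define S where "S = {y. g y \<noteq> 0}"
    have S: "finite S" using g by (simp add: S_def Cc_def)
    define q where "q x = (\<Sum>y\<in>S. heat t y x * g y)" for x
    have "q \<in> C0"
      unfolding q_def
    proof (rule C0_sum[OF S])
      show "(\<lambda>x. heat t y x * g y) \<in> C0" for y
        by (rule C0_dominated[OF H[of y], of _ "\<bar>g y\<bar>"]) (simp add: abs_mult heat_nonneg t mult.commute)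
    qed
    then have fin: "finite {x. \<bar>q x\<bar> > e / 2}" using e by (intro C0_finite) auto
    have close: "\<bar>heat_action b m t f x - q x\<bar> \<le> e / 2" for x
    proof -
      have sH: "(\<lambda>y. heat t y x) summable_on UNIV"
        by (rule nonneg_bdd_above_summable_on) (auto intro!: bdd_aboveI2 heat_sum_le_1 heat_nonneg t)
      have H1: "(\<Sum>\<^sub>\<infinity>y. heat t y x) \<le> 1" by (rule infsum_le_finite_sums[OF sH heat_sum_le_1[OF _ t]])
      have sumg: "(\<lambda>y. heat t y x * g y) summable_on UNIV"
        by (rule summable_on_cong_neutral[where T = S, THEN iffD2]) (use S in \<open>auto simp: S_def\<close>)
      have sd: "(\<lambda>y. heat t y x * (f y - g y)) summable_on UNIV"
      proof (rule abs_summable_summable, rule Infinite_Sum.abs_summable_on_comparison_test')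
        show "(\<lambda>y. heat t y x * (e / 2)) summable_on UNIV" by (intro summable_on_cmult_left sH)
        show "norm (heat t y x * (f y - g y)) \<le> heat t y x * (e / 2)" for y
          using mult_left_mono[OF g(2)[of y] heat_nonneg[OF t, of y x]] heat_nonneg[OF t, of y x] by (simp add: abs_mult)
      qed
      have "heat_action b m t f x = (\<Sum>\<^sub>\<infinity>y. heat t y x * (f y - g y)) + (\<Sum>\<^sub>\<infinity>y. heat t y x * g y)"
        unfolding heat_action_heat[OF t] by (subst infsum_add[OF sd sumg, symmetric]) (simp add: algebra_simps)
      also have "(\<Sum>\<^sub>\<infinity>y. heat t y x * g y) = (\<Sum>\<^sub>\<infinity>y\<in>S. heat t y x * g y)"
        by (rule infsum_cong_neutral) (auto simp: S_def)
      finally have "heat_action b m t f x - q x = (\<Sum>\<^sub>\<infinity>y. heat t y x * (f y - g y))"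
        using S by (simp add: q_def)
      moreover have "(\<Sum>\<^sub>\<infinity>y. heat t y x * (f y - g y)) \<le> (\<Sum>\<^sub>\<infinity>y. heat t y x * (e / 2))"
      proof (intro infsum_mono sd summable_on_cmult_left sH mult_left_mono)
        show "f y - g y \<le> e / 2" for y using g(2)[of y] by linarith
      qed (use heat_nonneg[OF t] in auto)
      moreover have "(\<Sum>\<^sub>\<infinity>y. heat t y x * (- (e / 2))) \<le> (\<Sum>\<^sub>\<infinity>y. heat t y x * (f y - g y))"
      proof (intro infsum_mono sd summable_on_cmult_left sH mult_left_mono)
        show "- (e / 2) \<le> f y - g y" for y using g(2)[of y] by linarith
      qed (use heat_nonneg[OF t] in auto)
      moreover have "(\<Sum>\<^sub>\<infinity>y. heat t y x * (e / 2)) \<le> e / 2"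
        using mult_right_mono[OF H1, of "e / 2"] e unfolding infsum_cmult_left' by linarith
      moreover have "- (e / 2) \<le> (\<Sum>\<^sub>\<infinity>y. heat t y x * (- (e / 2)))"
        using mult_right_mono[OF H1, of "e / 2"] e unfolding infsum_cmult_left' by linarith
      ultimately show ?thesis by linarith
    qed
    have "e / 2 < \<bar>q x\<bar>" if "e < \<bar>heat_action b m t f x\<bar>" for x
      using close[of x] that by linarith
    then have "{x. \<bar>heat_action b m t f x\<bar> > e} \<subseteq> {x. \<bar>q x\<bar> > e / 2}" by blast
    then show "finite {x. \<bar>heat_action b m t f x\<bar> > e}" using fin by (rule finite_subset)
  qed
qed

lemma green_le_1: "green x \<le> 1"
  unfolding green_def
proof (rule Res_le)
  show "dir (bal n) 1 (val (emb (ind rt))) x \<le> 1" for n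
    using dir_le[OF finite_bal, of 1 n "ind rt" 1 x] by (simp add: val_emb_indicator)
qed simp

text \<open>Were \<open>G\<close> larger than \<open>e\<close> along a sequence of distinct vertices, dominated convergence in
  \<open>heat_integral\<close> along this sequence would contradict the choice of \<open>T\<close>.\<close>

lemma green_if_Feller:
  assumes F: "Feller b m" shows "green \<in> C0"
proof (rule ccontr)
  assume "green \<notin> C0"
  then obtain e where e: "e > 0" "infinite {x. \<bar>green x\<bar> > e}" by (auto simp: C0_iff)
  obtain X :: "nat \<Rightarrow> 'a" where X: "inj X" "range X \<subseteq> {x. \<bar>green x\<bar> > e}"
    using infinite_countable_subset[OF e(2)] by blast
  have H: "heat t rt \<in> C0" if t: "t \<ge> 0" for t
  proof -
    have "ind rt \<in> C0" unfolding C0_iff by (auto simp: indicator_def elim: rev_finite_subset[of "{rt}"])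
    then have "heat_action b m t (ind rt) \<in> C0" using F t by (simp add: Feller_def)
    moreover have "heat_action b m t (ind rt) x = heat t rt x" for x
    proof -
      have "(\<Sum>\<^sub>\<infinity>y. heat t y x * ind rt y) = (\<Sum>\<^sub>\<infinity>y\<in>{rt}. heat t y x * ind rt y)"
        by (rule infsum_cong_neutral) auto
      then show ?thesis by (simp add: heat_action_heat[OF t])
    qed
    ultimately show ?thesis by (metis ext)
  qed
  \<comment> \<open>late enough for the tail \<open>e\<^sup>-\<^sup>T P\<^sub>T G \<le> e\<^sup>-\<^sup>T\<close> to be at most \<open>e/2\<close>\<close>
  define T where "T = max 0 (- ln (e / 2))"
  have T: "T \<ge> 0" by (simp add: T_def)
  have "exp (- T) \<le> exp (ln (e / 2))" by (simp add: T_def)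
  then have expT: "exp (- T) \<le> e / 2" using e by simp
  let ?I = "\<lambda>n. integral {0..T} (\<lambda>s. exp (- s) * heat s rt (X n))"
  have int: "((\<lambda>s. exp (- s) * heat s rt x) has_integral green x - exp (- T) * val (flow T (act (Res 1) (emb (ind rt)))) x) {0..T}" for x
    using heat_integral[OF T, of "emb (ind rt)" x] by (simp add: heat_def green_def)
  have "?I \<longlonglongrightarrow> integral {0..T} (\<lambda>s. 0)"
  proof (rule dominated_convergence(2)[where h = "\<lambda>_. 1"])
    show "(\<lambda>s. exp (- s) * heat s rt (X n)) integrable_on {0..T}" for n using int by blast
    show "norm (exp (- s) * heat s rt (X n)) \<le> 1" if "s \<in> {0..T}" for n s
      using heat_sum_le_1[of "{rt}" s "X n"] heat_nonneg[of s rt "X n"] that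
        mult_mono[of "exp (- s)" 1 "heat s rt (X n)" 1] by (simp add: abs_mult)
    show "(\<lambda>n. exp (- s) * heat s rt (X n)) \<longlonglongrightarrow> 0" if "s \<in> {0..T}" for s
      using that by (intro tendsto_mult_right_zero C0_inj_tendsto H X) auto
  qed auto
  then have "\<forall>\<^sub>F n in sequentially. ?I n < e / 2" using e by (intro order_tendstoD(2)) auto
  then obtain n where n: "?I n < e / 2" by (auto simp: eventually_sequentially)
  have "?I n = green (X n) - exp (- T) * val (flow T (act (Res 1) (emb (ind rt)))) (X n)"
    by (rule integral_unique[OF int])
  moreover have "val (flow T (act (Res 1) (emb (ind rt)))) (X n) \<le> 1"
    by (rule flow_le_1[OF T]) (use green_le_1 in \<open>simp add: green_def\<close>)
  then have "exp (- T) * val (flow T (act (Res 1) (emb (ind rt)))) (X n) \<le> exp (- T)"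
    using mult_left_mono[of _ 1 "exp (- T)"] by simp
  moreover have "\<bar>green (X n)\<bar> > e" using X(2) by blast
  then have "green (X n) > e" using green_nonneg[of "X n"] by simp
  ultimately show False using n expT by linarith
qed

lemma Feller_iff_green: "Feller b m \<longleftrightarrow> green \<in> C0"
  using Feller_if_green green_if_Feller by blast

end

section \<open>Comparison with radial functions\<close>

text \<open>Two consecutive values of the radial Dirichlet solution on the ball of radius \<open>N\<close>, listed from the
  boundary inwards, for outer and inner curvatures \<open>p\<close> and \<open>q\<close>: entry \<open>j\<close> belongs to the radius
  \<open>N + 1 - j\<close>, with the value 0 just outside of the ball and the value 1 on its boundary sphere.\<close>

primrec inward_pair :: "(nat \<Rightarrow> real) \<Rightarrow> (nat \<Rightarrow> real) \<Rightarrow> nat \<Rightarrow> nat \<Rightarrow> real \<times> real" where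
  "inward_pair p q N 0 = (0, 1)"
| "inward_pair p q N (Suc j) = (case inward_pair p q N j of (a, c) \<Rightarrow>
     (c, c + (p (N - j) * (c - a) + c) / q (N - j)))"

definition inward :: "(nat \<Rightarrow> real) \<Rightarrow> (nat \<Rightarrow> real) \<Rightarrow> nat \<Rightarrow> nat \<Rightarrow> real" where
  "inward p q N j = fst (inward_pair p q N j)"

lemma inward_simps:
  "inward p q N 0 = 0" "inward p q N (Suc 0) = 1"
  "inward p q N (Suc (Suc j)) = inward p q N (Suc j)
     + (p (N - j) * (inward p q N (Suc j) - inward p q N j) + inward p q N (Suc j)) / q (N - j)"
  by (simp_all add: inward_def case_prod_beta)

lemma inward_mono:
  assumes "\<And>r. p r \<ge> 0" "\<And>r. q r \<ge> 0"
  shows "0 \<le> inward p q N j \<and> inward p q N j \<le> inward p q N (Suc j)"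
proof (induction j)
  case (Suc j)
  then have "0 \<le> (p (N - j) * (inward p q N (Suc j) - inward p q N j) + inward p q N (Suc j)) / q (N - j)"
    using assms by (intro divide_nonneg_nonneg add_nonneg_nonneg mult_nonneg_nonneg) auto
  then show ?case using Suc by (simp add: inward_simps(3))
qed (simp add: inward_simps)

context rooted_graph
begin

lemma outer_curv_sum: "outer_curv b m rt x = (\<Sum>y\<in>nbr x. if d y = Suc (d x) then b x y else 0) / m x"
proof -
  have "(\<Sum>\<^sub>\<infinity>y\<in>sph b rt (int (d x) + 1). b x y) = (\<Sum>\<^sub>\<infinity>y\<in>nbr x. if d y = Suc (d x) then b x y else 0)"
    by (rule infsum_cong_neutral) (auto simp: sph_def not_nbr)
  then show ?thesis by (simp add: outer_curv_def finite_nbr)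
qed

lemma inner_curv_sum: "inner_curv b m rt x = (\<Sum>y\<in>nbr x. if Suc (d y) = d x then b x y else 0) / m x"
proof -
  have "(\<Sum>\<^sub>\<infinity>y\<in>sph b rt (int (d x) - 1). b x y) = (\<Sum>\<^sub>\<infinity>y\<in>nbr x. if Suc (d y) = d x then b x y else 0)"
    by (rule infsum_cong_neutral) (auto simp: sph_def not_nbr)
  then show ?thesis by (simp add: inner_curv_def finite_nbr)
qed

lemma outer_curv_nonneg: "outer_curv b m rt x \<ge> 0"
  unfolding outer_curv_sum using weight_nonneg m_ge0 by (intro divide_nonneg_nonneg sum_nonneg) auto

lemma inner_curv_nonneg: "inner_curv b m rt x \<ge> 0"
  unfolding inner_curv_sum using weight_nonneg m_ge0 by (intro divide_nonneg_nonneg sum_nonneg) auto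

lemma inner_curv_pos:
  assumes "d x > 0" shows "inner_curv b m rt x > 0"
proof -
  obtain y where y: "y \<in> nbr x" "Suc (d y) = d x"
    using predecessor[of x "d x - 1"] assms by auto
  have "(\<Sum>y\<in>nbr x. if Suc (d y) = d x then b x y else 0) > 0"
    by (rule sum_pos2[OF finite_nbr y(1)]) (use y weight_nonneg in \<open>auto simp: nbr_def\<close>)
  then show ?thesis unfolding inner_curv_sum using measure_pos[of x] by simp
qed

text \<open>At the root the truncated \<open>d x - 1\<close> is \<open>0\<close>, so that the inner term vanishes, as it should.\<close>

lemma Lap_radial:
  "Lap (\<lambda>x. \<phi> (d x)) x = outer_curv b m rt x * (\<phi> (d x) - \<phi> (Suc (d x)))
     + inner_curv b m rt x * (\<phi> (d x) - \<phi> (d x - 1))"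
proof -
  have "b x y * (\<phi> (d x) - \<phi> (d y)) = (if d y = Suc (d x) then b x y else 0) * (\<phi> (d x) - \<phi> (Suc (d x)))
      + (if Suc (d y) = d x then b x y else 0) * (\<phi> (d x) - \<phi> (d x - 1))" if y: "y \<in> nbr x" for y
  proof -
    consider "d y = Suc (d x)" | "d y = d x" | "Suc (d y) = d x"
      using d_nbr[OF y] d_nbr'[OF y] by linarith
    then show ?thesis
    proof cases
      case 3
      then have "d x - 1 = d y" "d y \<noteq> Suc (d x)" by linarith+
      then show ?thesis using 3 by simp
    qed simp_all
  qed
  then have "Lap (\<lambda>x. \<phi> (d x)) x = (\<Sum>y\<in>nbr x. (if d y = Suc (d x) then b x y else 0) * (\<phi> (d x) - \<phi> (Suc (d x)))
      + (if Suc (d y) = d x then b x y else 0) * (\<phi> (d x) - \<phi> (d x - 1))) / m x"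
    unfolding Lap_def by (simp cong: sum.cong)
  then show ?thesis
    by (simp only: outer_curv_sum inner_curv_sum sum.distrib sum_distrib_right[symmetric]
        add_divide_distrib times_divide_eq_left)
qed

lemma sphere_nonempty: "\<exists>x. d x = n"
proof (rule ccontr)
  assume none: "\<not> ?thesis"
  have "d x < n" for x
  proof (rule ccontr)
    assume "\<not> d x < n"
    moreover have "d x = n + k \<Longrightarrow> False" for k x
    proof (induction k arbitrary: x)
      case 0
      then show ?case using none by simp
    next
      case (Suc k)
      then show ?case using predecessor[of x "n + k"] by auto
    qed
    ultimately show False by (metis le_add_diff_inverse not_less)
  qed
  then have "UNIV \<subseteq> bal n" by (auto simp: bal_def less_imp_le)
  then show False using infinite_vertices finite_bal[of n] finite_subset by blast
qed

text \<open>The minimum principle on the ball minus a smaller ball, applied to \<open>C \<gamma>\<close> minus a Dirichlet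
  solution: \<open>C\<close> is chosen to dominate on the small ball, and outside of the large one the
  Dirichlet solution is zero.\<close>

lemma green_le_radial_supersolution:
  assumes pos: "\<And>r. \<gamma> r > 0" and anti: "\<And>r. \<gamma> (Suc r) \<le> \<gamma> r"
    and eq: "\<And>r. r \<ge> R \<Longrightarrow> p r * (\<gamma> r - \<gamma> (Suc r)) + q r * (\<gamma> r - \<gamma> (r - 1)) + \<gamma> r \<ge> 0"
    and R: "R > 0" and p: "\<And>x. d x \<ge> R \<Longrightarrow> outer_curv b m rt x \<ge> p (d x)"
    and q: "\<And>x. d x \<ge> R \<Longrightarrow> inner_curv b m rt x \<le> q (d x)"
  shows "\<exists>C. \<forall>x. green x \<le> C * \<gamma> (d x)"
proof -
  define C where "C = Max (insert 0 ((\<lambda>x. green x / \<gamma> (d x)) ` bal R))"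
  have C0: "C \<ge> 0" by (simp add: C_def)
  have CR: "green x \<le> C * \<gamma> (d x)" if "x \<in> bal R" for x
  proof -
    have "green x / \<gamma> (d x) \<le> C" unfolding C_def using that by (intro Max_ge) auto
    then show ?thesis using pos[of "d x"] by (simp add: pos_divide_le_eq)
  qed
  have anti': "\<gamma> r \<le> \<gamma> (r - 1)" for r using anti[of "r - 1"] by (cases r) auto
  have "green x \<le> C * \<gamma> (d x)" for x
    unfolding green_def
  proof (rule Res_le)
    fix n
    let ?u = "dir (bal n) 1 (ind rt)"
    have ug: "?u x \<le> green x" for x
      using dir_le_Res[of 1 "emb (ind rt)" n x] by (simp add: green_def val_emb_indicator)
    have "0 \<le> C * \<gamma> (d x) - ?u x" for x
    proof (rule min_principle[of "bal n - bal R" 1])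
      show "0 \<le> Lap (\<lambda>x. C * \<gamma> (d x) - ?u x) x + 1 * (C * \<gamma> (d x) - ?u x)" if x: "x \<in> bal n - bal R" for x
      proof -
        have dR: "d x \<ge> R" using x by (auto simp: bal_def)
        have "x \<noteq> rt" using dR R by auto
        then have u: "Lap ?u x + 1 * ?u x = 0" using dir_Lap[of "bal n" 1 x "ind rt"] x by simp
        have "0 \<le> p (d x) * (\<gamma> (d x) - \<gamma> (Suc (d x))) + q (d x) * (\<gamma> (d x) - \<gamma> (d x - 1)) + \<gamma> (d x)"
          by (rule eq[OF dR])
        also have "p (d x) * (\<gamma> (d x) - \<gamma> (Suc (d x))) \<le> outer_curv b m rt x * (\<gamma> (d x) - \<gamma> (Suc (d x)))"
          using p[OF dR] anti by (intro mult_right_mono) auto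
        also have "q (d x) * (\<gamma> (d x) - \<gamma> (d x - 1)) \<le> inner_curv b m rt x * (\<gamma> (d x) - \<gamma> (d x - 1))"
          using q[OF dR] anti' by (intro mult_right_mono_neg) auto
        finally have "0 \<le> Lap (\<lambda>x. \<gamma> (d x)) x + \<gamma> (d x)" by (simp add: Lap_radial)
        then have "0 \<le> C * (Lap (\<lambda>x. \<gamma> (d x)) x + \<gamma> (d x))" using C0 by simp
        then show ?thesis using u by (simp add: Lap_diff Lap_cmult algebra_simps)
      qed
      show "0 \<le> C * \<gamma> (d x) - ?u x" if "x \<notin> bal n - bal R" for x
      proof (cases "x \<in> bal R")
        case True
        then show ?thesis using CR[OF True] ug[of x] by linarith
      next
        case False
        then show ?thesis using that C0 pos[of "d x"] by (simp add: dir_outside)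
      qed
    qed auto
    then show "dir (bal n) 1 (val (emb (ind rt))) x \<le> C * \<gamma> (d x)" by (simp add: val_emb_indicator)
  qed simp
  then show ?thesis by blast
qed

text \<open>The constant \<open>C\<close> must not depend on \<open>N\<close>; it is found from the values of the Green function on the
  ball of radius \<open>R\<close> and the common bound \<open>B\<close>.\<close>

lemma radial_subsolution_le_green:
  assumes anti: "\<And>N r. \<gamma> N (Suc r) \<le> \<gamma> N r" and bd: "\<And>N r. \<gamma> N r \<le> B" and out: "\<And>N r. r > N \<Longrightarrow> \<gamma> N r = 0"
    and eq: "\<And>N r. R \<le> r \<Longrightarrow> r \<le> N \<Longrightarrow> p r * (\<gamma> N r - \<gamma> N (Suc r)) + q r * (\<gamma> N r - \<gamma> N (r - 1)) + \<gamma> N r \<le> 0"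
    and R: "R > 0" and p: "\<And>x. d x \<ge> R \<Longrightarrow> outer_curv b m rt x \<le> p (d x)"
    and q: "\<And>x. d x \<ge> R \<Longrightarrow> inner_curv b m rt x \<ge> q (d x)"
  shows "\<exists>C. \<forall>N x. \<gamma> N (d x) \<le> C * green x"
proof -
  define C where "C = Max (insert 0 ((\<lambda>x. B / green x) ` bal R))"
  have C0: "C \<ge> 0" by (simp add: C_def)
  have CR: "B \<le> C * green x" if "x \<in> bal R" for x
  proof -
    have "B / green x \<le> C" unfolding C_def using that by (intro Max_ge) auto
    then show ?thesis using green_pos[of x] by (simp add: pos_divide_le_eq)
  qed
  have anti': "\<gamma> N r \<le> \<gamma> N (r - 1)" for N r using anti[of N "r - 1"] by (cases r) auto
  have "0 \<le> C * green x - \<gamma> N (d x)" for N x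
  proof (rule min_principle[of "bal N - bal R" 1 "\<lambda>x. C * green x - \<gamma> N (d x)"])
    show "0 \<le> Lap (\<lambda>x. C * green x - \<gamma> N (d x)) x + 1 * (C * green x - \<gamma> N (d x))" if x: "x \<in> bal N - bal R" for x
    proof -
      have dR: "d x \<ge> R" "d x \<le> N" using x by (auto simp: bal_def)
      have "x \<noteq> rt" using dR R by auto
      then have u: "Lap green x + green x = 0" using green_Lap[of x] by simp
      have "outer_curv b m rt x * (\<gamma> N (d x) - \<gamma> N (Suc (d x))) \<le> p (d x) * (\<gamma> N (d x) - \<gamma> N (Suc (d x)))"
        using p[OF dR(1)] anti by (intro mult_right_mono) auto
      moreover have "inner_curv b m rt x * (\<gamma> N (d x) - \<gamma> N (d x - 1)) \<le> q (d x) * (\<gamma> N (d x) - \<gamma> N (d x - 1))"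
        using q[OF dR(1)] anti' by (intro mult_right_mono_neg) auto
      ultimately have "Lap (\<lambda>x. \<gamma> N (d x)) x + \<gamma> N (d x) \<le> 0"
        using eq[OF dR] unfolding Lap_radial by linarith
      moreover have "C * Lap green x + C * green x = 0" using u by (metis distrib_left mult_zero_right)
      ultimately show ?thesis by (simp add: Lap_diff Lap_cmult)
    qed
    show "0 \<le> C * green x - \<gamma> N (d x)" if "x \<notin> bal N - bal R" for x
    proof (cases "x \<in> bal R")
      case True
      then show ?thesis using CR[OF True] bd[of N "d x"] by linarith
    next
      case False
      then have "\<gamma> N (d x) = 0" using that by (intro out) (simp add: bal_def)
      then show ?thesis using C0 green_nonneg[of x] by simp
    qed
  qed auto
  then show ?thesis by (intro exI[of _ C]) simp
qed

text \<open>Balls are finite and all spheres are nonempty. This is what carries decay from one graph to another.\<close>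

lemma radial_C0_iff: "(\<lambda>x. \<gamma> (d x)) \<in> C0 \<longleftrightarrow> \<gamma> \<longlonglongrightarrow> 0"
proof
  assume g: "(\<lambda>x. \<gamma> (d x)) \<in> C0"
  show "\<gamma> \<longlonglongrightarrow> 0"
  proof (rule LIMSEQ_I)
    fix e :: real assume e: "e > 0"
    then have "finite {x. \<bar>\<gamma> (d x)\<bar> > e / 2}" by (intro C0_finite[OF g]) simp
    from finite_subset_bal[OF this] obtain n where n: "{x. \<bar>\<gamma> (d x)\<bar> > e / 2} \<subseteq> bal n" by blast
    have "norm (\<gamma> r - 0) < e" if "r \<ge> Suc n" for r
    proof -
      obtain x where x: "d x = r" using sphere_nonempty by blast
      then have "x \<notin> bal n" using that by (simp add: bal_def)
      then have "\<not> \<bar>\<gamma> (d x)\<bar> > e / 2" using n by blast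
      then show ?thesis using e x by simp
    qed
    then show "\<exists>n. \<forall>r\<ge>n. norm (\<gamma> r - 0) < e" by blast
  qed
next
  assume lim: "\<gamma> \<longlonglongrightarrow> 0"
  show "(\<lambda>x. \<gamma> (d x)) \<in> C0"
    unfolding C0_iff
  proof (intro allI impI)
    fix e :: real assume "e > 0"
    then obtain n where n: "\<And>r. r \<ge> n \<Longrightarrow> norm (\<gamma> r - 0) < e" using LIMSEQ_D[OF lim] by blast
    have "{x. \<bar>\<gamma> (d x)\<bar> > e} \<subseteq> bal n"
    proof
      fix x assume "x \<in> {x. \<bar>\<gamma> (d x)\<bar> > e}"
      then show "x \<in> bal n" using n[of "d x"] by (cases "d x \<ge> n") (auto simp: bal_def)
    qed
    then show "finite {x. \<bar>\<gamma> (d x)\<bar> > e}" by (rule finite_subset) simp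
  qed
qed

lemma model_curv:
  assumes M: "model_with_root b m rt"
  shows "model_outer_curv b m rt (int (d x)) = outer_curv b m rt x"
    and "model_inner_curv b m rt (int (d x)) = inner_curv b m rt x"
proof -
  have eq: "outer_curv b m rt y = outer_curv b m rt x \<and> inner_curv b m rt y = inner_curv b m rt x" if "d y = d x" for y
    using M that unfolding model_with_root_def by blast
  show "model_outer_curv b m rt (int (d x)) = outer_curv b m rt x"
    unfolding model_outer_curv_def
  proof (rule the_equality)
    show "\<forall>y\<in>sph b rt (int (d x)). outer_curv b m rt y = outer_curv b m rt x"
      by (rule ballI, rule conjunct1[OF eq]) (simp add: sph_def)
    show "k = outer_curv b m rt x" if "\<forall>y\<in>sph b rt (int (d x)). outer_curv b m rt y = k" for k
      using that by (auto simp: sph_def)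
  qed
  show "model_inner_curv b m rt (int (d x)) = inner_curv b m rt x"
    unfolding model_inner_curv_def
  proof (rule the_equality)
    show "\<forall>y\<in>sph b rt (int (d x)). inner_curv b m rt y = inner_curv b m rt x"
      by (rule ballI, rule conjunct2[OF eq]) (simp add: sph_def)
    show "k = inner_curv b m rt x" if "\<forall>y\<in>sph b rt (int (d x)). inner_curv b m rt y = k" for k
      using that by (auto simp: sph_def)
  qed
qed

text \<open>\<open>\<gamma>' N\<close> is the Dirichlet solution on the ball of radius \<open>N\<close> as a function of the radius, and \<open>\<gamma>\<close> the
  Green function. Solving inwards shows the decrease in the radius, because each increment is a
  nonnegative combination of the previous increment and the previous value.\<close>

lemma model_green:
  assumes M: "model_with_root b m rt"
  defines "p \<equiv> \<lambda>r. model_outer_curv b m rt (int r)" and "q \<equiv> \<lambda>r. model_inner_curv b m rt (int r)"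
  shows "\<exists>\<gamma> \<gamma>'. (\<forall>x. green x = \<gamma> (d x)) \<and> (\<forall>r. \<gamma> r > 0) \<and> (\<forall>r. \<gamma> (Suc r) \<le> \<gamma> r) \<and>
     (\<forall>r\<ge>1. p r * (\<gamma> r - \<gamma> (Suc r)) + q r * (\<gamma> r - \<gamma> (r - 1)) + \<gamma> r = 0) \<and>
     (\<forall>r. (\<lambda>N. \<gamma>' N r) \<longlonglongrightarrow> \<gamma> r) \<and> (\<forall>N r. \<gamma>' N r \<le> 1) \<and>
     (\<forall>N r. \<gamma>' N (Suc r) \<le> \<gamma>' N r) \<and> (\<forall>N r. r > N \<longrightarrow> \<gamma>' N r = 0) \<and>
     (\<forall>N r. 1 \<le> r \<longrightarrow> r \<le> N \<longrightarrow>
        p r * (\<gamma>' N r - \<gamma>' N (Suc r)) + q r * (\<gamma>' N r - \<gamma>' N (r - 1)) + \<gamma>' N r = 0)"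
proof -
  have px: "p (d x) = outer_curv b m rt x" and qx: "q (d x) = inner_curv b m rt x" for x
    using model_curv[OF M] by (simp_all add: p_def q_def)
  obtain X where X: "\<And>r. d (X r) = r" using sphere_nonempty by metis
  have p0: "p r \<ge> 0" and q0: "q r \<ge> 0" for r
    using outer_curv_nonneg[of "X r"] inner_curv_nonneg[of "X r"] px[of "X r"] qx[of "X r"] by (simp_all add: X)
  have qpos: "q r > 0" if "r > 0" for r
    using inner_curv_pos[of "X r"] qx[of "X r"] that by (simp add: X)
  define \<phi> where "\<phi> N r = inward p q N (Suc N - r)" for N r
  note bm = inward_mono[of p q, OF p0 q0]
  have phi_eq: "p r * (\<phi> N r - \<phi> N (Suc r)) + q r * (\<phi> N r - \<phi> N (r - 1)) + \<phi> N r = 0" if "1 \<le> r" "r \<le> N" for r N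
  proof -
    have s: "Suc N - r = Suc (N - r)" "Suc N - Suc r = N - r" "Suc N - (r - 1) = Suc (Suc (N - r))" "N - (N - r) = r"
      using that by auto
    show ?thesis
      unfolding \<phi>_def s inward_simps(3) using qpos[of r] that by simp
  qed
  have phi_anti: "\<phi> N (Suc r) \<le> \<phi> N r" for N r
  proof (cases "r \<le> N")
    case True
    then have s: "Suc N - r = Suc (N - r)" "Suc N - Suc r = N - r" by auto
    show ?thesis unfolding \<phi>_def s using bm by blast
  qed (simp add: \<phi>_def)
  have phi_out: "\<phi> N r = 0" if "r > N" for N r using that by (simp add: \<phi>_def inward_simps)
  have phi0: "\<phi> N 0 \<ge> 1" for N
  proof -
    have "1 \<le> inward p q N (Suc j)" for j
      by (induction j) (use bm in \<open>auto simp: inward_simps(2) intro: order_trans\<close>)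
    then show ?thesis by (simp add: \<phi>_def)
  qed
  \<comment> \<open>the strength of the source at the root, by which \<open>\<phi>\<close> has to be divided\<close>
  define c where "c N = p 0 * (\<phi> N 0 - \<phi> N 1) + \<phi> N 0" for N
  have c: "c N > 0" for N
    using phi0[of N] p0[of 0] phi_anti[of N 0] by (auto simp: c_def intro!: add_nonneg_pos)
  define \<gamma>' where "\<gamma>' N r = \<phi> N r / c N" for N r
  have g'_eq: "p r * (\<gamma>' N r - \<gamma>' N (Suc r)) + q r * (\<gamma>' N r - \<gamma>' N (r - 1)) + \<gamma>' N r = 0"
    if "1 \<le> r" "r \<le> N" for r N
  proof -
    have "p r * (\<gamma>' N r - \<gamma>' N (Suc r)) + q r * (\<gamma>' N r - \<gamma>' N (r - 1)) + \<gamma>' N r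
      = (p r * (\<phi> N r - \<phi> N (Suc r)) + q r * (\<phi> N r - \<phi> N (r - 1)) + \<phi> N r) / c N"
      by (simp add: \<gamma>'_def add_divide_distrib diff_divide_distrib right_diff_distrib)
    then show ?thesis by (simp only: phi_eq[OF that])
  qed
  have g'_anti: "\<gamma>' N (Suc r) \<le> \<gamma>' N r" for N r
    unfolding \<gamma>'_def using c[of N] phi_anti by (intro divide_right_mono) auto
  have g'_out: "\<gamma>' N r = 0" if "r > N" for N r using phi_out[OF that] by (simp add: \<gamma>'_def)
  have dir_radial: "dir (bal N) 1 (ind rt) = (\<lambda>x. \<gamma>' N (d x))" for N
  proof (rule dir_eqI)
    have "Lap (\<lambda>x. \<gamma>' N (d x)) x + \<gamma>' N (d x) = ind rt x" if "x \<in> bal N" for x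
    proof (cases "x = rt")
      case True
      have "Lap (\<lambda>x. \<gamma>' N (d x)) rt + \<gamma>' N 0 = p 0 * (\<gamma>' N 0 - \<gamma>' N 1) + \<gamma>' N 0"
        using px[of rt] by (simp add: Lap_radial)
      also have "\<dots> = (p 0 * (\<phi> N 0 - \<phi> N 1) + \<phi> N 0) / c N"
        by (simp add: \<gamma>'_def add_divide_distrib diff_divide_distrib right_diff_distrib)
      also have "\<dots> = c N / c N" by (simp only: c_def)
      finally show ?thesis using True c[of N] by simp
    next
      case False
      then have "1 \<le> d x" using d_eq_0[of x] by (cases "d x") auto
      moreover have "d x \<le> N" using that by (simp add: bal_def)
      ultimately show ?thesis using g'_eq[of "d x" N] False by (simp add: Lap_radial px qx)
    qed
    then show "dirichlet_sol (bal N) 1 (ind rt) (\<lambda>x. \<gamma>' N (d x))"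
      using g'_out by (auto simp: dirichlet_sol_def bal_def)
  qed auto
  have lim: "(\<lambda>N. \<gamma>' N (d x)) \<longlonglongrightarrow> green x" for x
    using val_Res_lim[of 1 "emb (ind rt)" x] by (simp add: val_emb_indicator green_def dir_radial)
  define \<gamma> where "\<gamma> r = green (X r)" for r
  have lim': "(\<lambda>N. \<gamma>' N r) \<longlonglongrightarrow> \<gamma> r" for r using lim[of "X r"] by (simp add: X \<gamma>_def)
  have rad: "green x = \<gamma> (d x)" for x by (rule LIMSEQ_unique[OF lim lim'])
  have "\<gamma> (Suc r) \<le> \<gamma> r" for r by (rule LIMSEQ_le[OF lim' lim']) (use g'_anti in auto)
  moreover have "p r * (\<gamma> r - \<gamma> (Suc r)) + q r * (\<gamma> r - \<gamma> (r - 1)) + \<gamma> r = 0" if "r \<ge> 1" for r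
  proof -
    have "X r \<noteq> rt" using X[of r] d_root that by (metis not_one_le_zero)
    then have "Lap green (X r) + green (X r) = 0" using green_Lap[of "X r"] by simp
    moreover have "green = (\<lambda>x. \<gamma> (d x))" using rad by blast
    ultimately have "Lap (\<lambda>x. \<gamma> (d x)) (X r) + \<gamma> r = 0" by (simp add: X)
    then show ?thesis using px[of "X r"] qx[of "X r"] by (simp add: Lap_radial X)
  qed
  moreover have "\<gamma>' N r \<le> 1" for N r
  proof -
    have "\<gamma>' N r = dir (bal N) 1 (ind rt) (X r)" by (simp add: dir_radial X)
    also have "\<dots> \<le> green (X r)"
      using dir_le_Res[of 1 "emb (ind rt)" N "X r"] by (simp add: green_def val_emb_indicator)
    finally show ?thesis using green_le_1[of "X r"] by linarith
  qed
  moreover have "\<gamma> r > 0" for r using green_pos by (simp add: \<gamma>_def)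
  ultimately show ?thesis
    using rad lim' g'_anti g'_out g'_eq by (intro exI[of _ \<gamma>] exI[of _ \<gamma>']) blast
qed

end

theorem theorem4p19:
  fixes b :: "'a \<Rightarrow> 'a \<Rightarrow> real" and m :: "'a \<Rightarrow> real"
    and b' :: "'c \<Rightarrow> 'c \<Rightarrow> real" and m' :: "'c \<Rightarrow> real" and v :: 'c
  assumes "weighted_graph b m" and "connected_graph b"
    and "weighted_graph b' m'" and "connected_graph b'"
    and "model_with_root b' m' v"
  shows "(stronger_curv_growth b m b' m' v \<and> Feller b' m' \<longrightarrow> Feller b m) \<and>
         (weaker_curv_growth b m b' m' v \<and> \<not> Feller b' m' \<longrightarrow> \<not> Feller b m)"
proof -
  interpret M: rooted_graph b' m' v
    using assms by (intro rooted_graph.intro rooted_graph_axioms.intro)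
  have G: "rooted_graph b m"
    using assms by (intro rooted_graph.intro rooted_graph_axioms.intro)
  let ?p = "\<lambda>r. model_outer_curv b' m' v (int r)" and ?q = "\<lambda>r. model_inner_curv b' m' v (int r)"
  obtain \<gamma> \<gamma>' where rad: "\<And>x. M.green x = \<gamma> (graph_dist b' x v)" and pos: "\<And>r. \<gamma> r > 0"
    and anti: "\<And>r. \<gamma> (Suc r) \<le> \<gamma> r"
    and eq: "\<And>r. r \<ge> 1 \<Longrightarrow> ?p r * (\<gamma> r - \<gamma> (Suc r)) + ?q r * (\<gamma> r - \<gamma> (r - 1)) + \<gamma> r = 0"
    and lim: "\<And>r. (\<lambda>N. \<gamma>' N r) \<longlonglongrightarrow> \<gamma> r" and le1: "\<And>N r. \<gamma>' N r \<le> 1"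
    and anti': "\<And>N r. \<gamma>' N (Suc r) \<le> \<gamma>' N r" and out': "\<And>N r. r > N \<Longrightarrow> \<gamma>' N r = 0"
    and eq': "\<And>N r. 1 \<le> r \<Longrightarrow> r \<le> N \<Longrightarrow>
        ?p r * (\<gamma>' N r - \<gamma>' N (Suc r)) + ?q r * (\<gamma>' N r - \<gamma>' N (r - 1)) + \<gamma>' N r = 0"
    using M.model_green[OF assms(5)] by metis
  have "M.green = (\<lambda>x. \<gamma> (graph_dist b' x v))" using rad by blast
  then have MF: "Feller b' m' \<longleftrightarrow> \<gamma> \<longlonglongrightarrow> 0"
    by (simp only: M.Feller_iff_green M.radial_C0_iff)
  show ?thesis
  proof (intro conjI impI; elim conjE)
    assume "stronger_curv_growth b m b' m' v" and F: "Feller b' m'"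
    then obtain x0 R where R: "\<And>r x. r \<ge> R \<Longrightarrow> x \<in> sph b x0 r \<Longrightarrow>
        outer_curv b m x0 x \<ge> model_outer_curv b' m' v r \<and> inner_curv b m x0 x \<le> model_inner_curv b' m' v r"
      unfolding stronger_curv_growth_def by blast
    interpret G: rooted_graph b m x0 by (rule G)
    have "\<exists>C. \<forall>x. G.green x \<le> C * \<gamma> (graph_dist b x x0)"
    proof (rule G.green_le_radial_supersolution[where R = "max 1 (nat R)" and p = ?p and q = ?q])
      show "?p (graph_dist b x x0) \<le> outer_curv b m x0 x" "inner_curv b m x0 x \<le> ?q (graph_dist b x x0)"
        if "max 1 (nat R) \<le> graph_dist b x x0" for x
        using R[of "int (graph_dist b x x0)" x] that by (auto simp: sph_def)
    qed (use pos anti eq in auto)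
    then obtain C where C: "\<And>x. G.green x \<le> C * \<gamma> (graph_dist b x x0)" by blast
    have "(\<lambda>x. \<gamma> (graph_dist b x x0)) \<in> C0"
      using F by (simp add: G.radial_C0_iff MF)
    then have "G.green \<in> C0" by (rule C0_dominated[of _ _ C]) (use C G.green_nonneg in auto)
    then show "Feller b m" by (simp add: G.Feller_iff_green)
  next
    assume "weaker_curv_growth b m b' m' v" and F: "\<not> Feller b' m'"
    then obtain x0 R where R: "\<And>r x. r \<ge> R \<Longrightarrow> x \<in> sph b x0 r \<Longrightarrow>
        outer_curv b m x0 x \<le> model_outer_curv b' m' v r \<and> inner_curv b m x0 x \<ge> model_inner_curv b' m' v r"
      unfolding weaker_curv_growth_def by blast
    interpret G: rooted_graph b m x0 by (rule G)
    have "\<exists>C. \<forall>N x. \<gamma>' N (graph_dist b x x0) \<le> C * G.green x"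
    proof (rule G.radial_subsolution_le_green[where R = "max 1 (nat R)" and p = ?p and q = ?q])
      show "outer_curv b m x0 x \<le> ?p (graph_dist b x x0)" "?q (graph_dist b x x0) \<le> inner_curv b m x0 x"
        if "max 1 (nat R) \<le> graph_dist b x x0" for x
        using R[of "int (graph_dist b x x0)" x] that by (auto simp: sph_def)
    qed (use anti' le1 out' eq' in auto)
    then obtain C where C: "\<And>N x. \<gamma>' N (graph_dist b x x0) \<le> C * G.green x" by blast
    have C': "\<gamma> (graph_dist b x x0) \<le> C * G.green x" for x
      by (rule LIMSEQ_le_const2[OF lim]) (use C in auto)
    show "\<not> Feller b m"
    proof
      assume "Feller b m"
      then have "G.green \<in> C0" by (simp add: G.Feller_iff_green)
      then have "(\<lambda>x. \<gamma> (graph_dist b x x0)) \<in> C0"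
        by (rule C0_dominated[of _ _ C]) (use C' pos in \<open>auto simp: abs_of_pos\<close>)
      then show False using F by (simp add: G.radial_C0_iff MF)
    qed
  qed
qed

end
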